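(* Let $\mu$ be a probability measure on $\mathbb{C}$, and let $\{a_{i,j}\}_{i\ge1;1\le j\le i}$ and $\{b_{i,j}\}_{i\ge1;1\le j\le i}$ be two $\mu$-distributed and log-Cesàro bounded triangular arrays of complex numbers satisfying $$\sum_{i=1}^n\log_+\frac{1}{|a_{n,i}-b_{n,i}|}=o(n^2)\quad\text{as }n\to\infty.$$ For each $i\ge1$, let $\{\xi_{i,j}\}_{j\le i}$ be a sequence of independent random variables such that $\xi_{i,j}=a_{i,j}$ or $\xi_{i,j}=b_{i,j}$ with equal probability. For each $n\in\mathbb{N}$ let $$P_n(z):=(z-\xi_{n,1})\cdots(z-\xi_{n,n}).$$ Then, as $n\to\infty$, $\mathcal{M}(P_n)\to\mu$ almost surely, and $\mathcal{M}(P_n^{(k)})\to\mu$ in probability for any $k\in\mathbb{N}$.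
   Context: A triangular array $\{a_{n,i}\}_{n\ge1;1\le i\le n}$ of complex numbers is $\mu$-distributed if $\frac1n\sum_{i=1}^n\delta_{a_{n,i}}$ converges weakly to the probability measure $\mu$ as $n\to\infty$. It is log-Cesàro bounded if the sequence $\{\frac1n\sum_{i=1}^n\log_+|a_{n,i}|\}_{n\ge1}$ is bounded, where $\log_+x=\max(\log x,0)$ (and $\log_+0=0$, $\log_+\infty=\infty$). For a non-constant polynomial $P$, $\mathcal{M}(P)$ denotes the uniform probability measure on the multiset of zeros of $P$ (zeros counted with multiplicity). $P_n^{(k)}$ is the $k$-th derivative (so $\mathcal{M}(P_n^{(k)})$ is considered for $n>k$). Convergence of random probability measures, almost surely or in probability, is with respect to the topology of weak convergence of probability measures on $\mathbb{C}$. *)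

theory Defs
  imports "HOL-Probability.Probability"
begin

(* Values in [0,\<infinity>]; log_plus 0 = 0 because ln 0 = 0 in HOL. *)
definition log_plus :: "ennreal \<Rightarrow> ennreal" where
  "log_plus x = (if x = \<infinity> then \<infinity> else ennreal (max (ln (enn2real x)) 0))"

(* Weak topology on the Borel probability measures on 'a: the coarsest one for which
   \<nu> \<mapsto> \<integral>f d\<nu> is continuous for every bounded continuous f. *)
definition weak_topology :: "'a::topological_space measure topology" where
  "weak_topology = topology_generated_by
     {{\<nu>. prob_space \<nu> \<and> sets \<nu> = sets borel \<and> (LINT x|\<nu>. f x) \<in> V} | (f :: 'a \<Rightarrow> real) V.
        continuous_on UNIV f \<and> bounded (range f) \<and> open V}"

abbreviation weakly_converges :: "(nat \<Rightarrow> 'a::topological_space measure) \<Rightarrow> 'a measure \<Rightarrow> bool" where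
  "weakly_converges N \<mu> \<equiv> limitin weak_topology N \<mu> sequentially"

(* Convergence in probability of random elements of a topological space to a constant.
   The outer measure equals the measure on measurable sets; it is used so that the
   definition does not depend on the value emeasure M A = 0 for non-measurable A. *)
definition converges_in_prob :: "'w measure \<Rightarrow> 'b topology \<Rightarrow> (nat \<Rightarrow> 'w \<Rightarrow> 'b) \<Rightarrow> 'b \<Rightarrow> bool" where
  "converges_in_prob M T X c \<longleftrightarrow> c \<in> topspace T \<and>
     (\<forall>U. openin T U \<and> c \<in> U \<longrightarrow>
        (\<lambda>n. outer_measure_of M {\<omega> \<in> space M. X n \<omega> \<notin> U}) \<longlonglongrightarrow> 0)"

(* Only meaningful for a nonempty multiset. *)
definition uniform_mset_measure :: "complex multiset \<Rightarrow> complex measure" where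
  "uniform_mset_measure A = distr (measure_pmf (pmf_of_multiset A)) borel (\<lambda>z. z)"

(* Only meaningful for a non-constant polynomial; proots counts roots with multiplicity. *)
definition zeros_measure :: "complex poly \<Rightarrow> complex measure" where
  "zeros_measure p = uniform_mset_measure (proots p)"

(* A triangular array is a function of which only the values a n i with 1 \<le> i \<le> n matter. *)
definition mu_distributed :: "complex measure \<Rightarrow> (nat \<Rightarrow> nat \<Rightarrow> complex) \<Rightarrow> bool" where
  "mu_distributed \<mu> a \<longleftrightarrow>
     weakly_converges (\<lambda>n. uniform_mset_measure (image_mset (a n) (mset_set {1..n}))) \<mu>"

definition log_Cesaro_bounded :: "(nat \<Rightarrow> nat \<Rightarrow> complex) \<Rightarrow> bool" where
  "log_Cesaro_bounded a \<longleftrightarrow>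
     (\<exists>C::real. \<forall>n\<ge>1. (\<Sum>i=1..n. log_plus (ennreal (cmod (a n i)))) / of_nat n \<le> ennreal C)"

lemma emeasure_uniform_mset_measure:
  assumes "A \<noteq> {#}" "B \<in> sets borel"
  shows "emeasure (uniform_mset_measure A) B =
           ennreal (real (size (filter_mset (\<lambda>z. z \<in> B) A)) / real (size A))"
proof -
  have "emeasure (uniform_mset_measure A) B = emeasure (measure_pmf (pmf_of_multiset A)) B"
    unfolding uniform_mset_measure_def using assms by (subst emeasure_distr) auto
  also have "\<dots> = emeasure (measure_pmf (pmf_of_multiset A)) (B \<inter> set_mset A)"
    using assms by (metis emeasure_Int_set_pmf set_pmf_of_multiset)
  also have "\<dots> = ennreal (\<Sum>x\<in>B \<inter> set_mset A. count A x / size A)"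
    using assms by (subst emeasure_measure_pmf_finite) auto
  also have "(\<Sum>x\<in>B \<inter> set_mset A. count A x / size A) =
               real (size (filter_mset (\<lambda>z. z \<in> B) A)) / real (size A)"
  proof -
    have "(\<Sum>x\<in>B \<inter> set_mset A. count A x) = size (filter_mset (\<lambda>z. z \<in> B) A)"
      unfolding size_multiset_overloaded_eq by (intro sum.cong) auto
    then show ?thesis
      by (metis of_nat_sum sum_divide_distrib)
  qed
  finally show ?thesis .
qed

lemma emeasure_empirical:
  assumes "n \<ge> 1" "B \<in> sets borel"
  shows "emeasure (uniform_mset_measure (image_mset x (mset_set {1..n}))) B =
           ennreal ((1 / real n) * (\<Sum>i=1..n. indicator B (x i)))"
proof -
  have "size (filter_mset (\<lambda>z. z \<in> B) (image_mset x (mset_set {1..n}))) = card {i\<in>{1..n}. x i \<in> B}"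
    by (simp add: filter_mset_image_mset filter_mset_mset_set)
  moreover have "(\<Sum>i=1..n. indicator B (x i)) = real (card {i\<in>{1..n}. x i \<in> B})"
    by (simp add: indicator_def sum.If_cases Int_def)
  moreover have "image_mset x (mset_set {1..n}) \<noteq> {#}"
    using assms by (simp add: mset_set_empty_iff)
  ultimately show ?thesis
    using assms by (simp add: emeasure_uniform_mset_measure)
qed

lemma topspace_weak_topology:
  "topspace (weak_topology :: 'a::topological_space measure topology) =
     {\<nu>. prob_space \<nu> \<and> sets \<nu> = sets borel}"
proof -
  have "\<exists>(f :: 'a \<Rightarrow> real) V. continuous_on UNIV f \<and> bounded (range f) \<and> open V \<and> (LINT x|\<nu>. f x) \<in> V" for \<nu>
    by (rule exI[of _ "\<lambda>_. 0"], rule exI[of _ UNIV]) (auto simp: image_def)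
  then show ?thesis
    unfolding weak_topology_def by (simp add: topology_generated_by_topspace) blast
qed

lemma weakly_converges_iff:
  fixes N :: "nat \<Rightarrow> 'a::topological_space measure"
  assumes "\<And>n. prob_space (N n)" "\<And>n. sets (N n) = sets borel"
    and "prob_space \<mu>" "sets \<mu> = sets borel"
  shows "weakly_converges N \<mu> \<longleftrightarrow>
     (\<forall>f :: 'a \<Rightarrow> real. continuous_on UNIV f \<and> bounded (range f) \<longrightarrow>
        (\<lambda>n. LINT x|N n. f x) \<longlonglongrightarrow> (LINT x|\<mu>. f x))"
proof (intro iffI allI impI)
  fix f :: "'a \<Rightarrow> real"
  assume L: "weakly_converges N \<mu>" and f: "continuous_on UNIV f \<and> bounded (range f)"
  show "(\<lambda>n. LINT x|N n. f x) \<longlonglongrightarrow> (LINT x|\<mu>. f x)"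
  proof (rule topological_tendstoI)
    fix V :: "real set" assume V: "open V" "(LINT x|\<mu>. f x) \<in> V"
    let ?U = "{\<nu>. prob_space \<nu> \<and> sets \<nu> = sets borel \<and> (LINT x|\<nu>. f x) \<in> V}"
    have "openin weak_topology ?U"
      unfolding weak_topology_def using f V by (intro topology_generated_by_Basis) blast
    moreover have "\<mu> \<in> ?U" using assms V by simp
    ultimately have "\<forall>\<^sub>F n in sequentially. N n \<in> ?U"
      using L unfolding limitin_def by blast
    then show "\<forall>\<^sub>F n in sequentially. (LINT x|N n. f x) \<in> V"
      by (rule eventually_mono) simp
  qed
next
  assume R: "\<forall>f :: 'a \<Rightarrow> real. continuous_on UNIV f \<and> bounded (range f) \<longrightarrow>
        (\<lambda>n. LINT x|N n. f x) \<longlonglongrightarrow> (LINT x|\<mu>. f x)"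
  have "\<mu> \<in> U \<longrightarrow> (\<forall>\<^sub>F n in sequentially. N n \<in> U)" if "openin weak_topology U" for U
    using that[unfolded weak_topology_def openin_topology_generated_by_iff]
  proof (induction U rule: generate_topology_on.induct)
    case (Int a b)
    then show ?case by (auto intro: eventually_conj)
  next
    case (UN K)
    show ?case
    proof
      assume "\<mu> \<in> \<Union>K"
      then obtain k where "k \<in> K" "\<mu> \<in> k" by blast
      with UN have "\<forall>\<^sub>F n in sequentially. N n \<in> k" by blast
      then show "\<forall>\<^sub>F n in sequentially. N n \<in> \<Union>K"
        by (rule eventually_mono) (use \<open>k \<in> K\<close> in blast)
    qed
  next
    case (Basis s)
    then obtain f :: "'a \<Rightarrow> real" and V where s:
      "s = {\<nu>. prob_space \<nu> \<and> sets \<nu> = sets borel \<and> (LINT x|\<nu>. f x) \<in> V}"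
      "continuous_on UNIV f" "bounded (range f)" "open V" by blast
    show ?case
    proof
      assume "\<mu> \<in> s"
      then have "\<forall>\<^sub>F n in sequentially. (LINT x|N n. f x) \<in> V"
        using R s by (auto intro: topological_tendstoD)
      then show "\<forall>\<^sub>F n in sequentially. N n \<in> s"
        using assms s by simp
    qed
  qed simp
  then show "weakly_converges N \<mu>"
    using assms by (simp add: limitin_def topspace_weak_topology)
qed

end

(* Convergence of M(P_n) is a law of large numbers: Hoeffding's inequality and Borel-Cantelli for
   countably many test functions.

   For the derivatives, Jensen's formula writes the integral of
   ln max(2 rho, |w - c|) - ln max(rho, |w - c|) against the zeros w of a polynomial as a difference
   of means of its log-modulus over two circles about c, and convolving with these compactly
   supported kernels recovers every compactly supported test function. So it suffices that the mean
   of |ln |P_n^(k) / P_n|| / n over a circle tends to 0 in expectation. Pointwise,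
   P_n^(k)(z) / (k! P_n(z)) is the k-th elementary symmetric polynomial of the numbers
   1 / (z - xi_(n,i)): it is at most exp(o(n)) unless z is exponentially close to the array, and
   it is rarely smaller than exp(-o(n)), because Cauchy-Schwarz decoupling over k blocks of indices
   replaces it by a product of k independent linear sums, each of which spreads by Sperner's theorem
   (Littlewood-Offord). Uniform integrability over the circle comes from Jensen's formula as well. *)
theory Submission
  imports Defs "HOL-Complex_Analysis.Complex_Analysis"
    "HOL-Computational_Algebra.Fundamental_Theorem_Algebra" "HOL-Real_Asymp.Real_Asymp"
begin

subsection \<open>Averages over the subsets of a finite set\<close>

text \<open>The hypotheses allow typical gaps between \<open>a n i\<close> and \<open>b n i\<close>
  as small as exp(-o(n)), so anticoncentration must be uniform in the gap: the number of coins
  required depends only on k and the target probability, and the gap \<open>\<tau>\<close> enters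
  through \<open>\<tau> ^ k\<close>, again exp(-o(n)). The symmetric polynomial is not linear in the
  coins; comparing two copies of one block with the rest fixed cancels the constant coefficient, one
  factor X divides out, and the degree drops by one. No rate is tracked for the resulting
  probability, hence convergence in probability for derivatives, while for the roots themselves the
  deviation bound is summable. The two radii in the kernel do two jobs: they give it compact
  support, and they make the leading coefficient cancel in Jensen's formula. Fair coins are treated
  as uniform averages \<open>pavg\<close> over subsets; the passage to the given probability space
  comes only at the end, where for all large n the two values differ at every index, so that
  outcomes correspond to equally likely subsets.\<close>

definition pavg :: "'a set \<Rightarrow> ('a set \<Rightarrow> real) \<Rightarrow> real" where
  "pavg B g = (\<Sum>S\<in>Pow B. g S) / 2 ^ card B"

lemma pavg_mono:
  assumes "\<And>S. S \<subseteq> B \<Longrightarrow> g S \<le> h S"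
  shows "pavg B g \<le> pavg B h"
  unfolding pavg_def using assms by (intro divide_right_mono sum_mono) auto

lemma pavg_cong:
  assumes "\<And>S. S \<subseteq> B \<Longrightarrow> g S = h S"
  shows "pavg B g = pavg B h"
  using assms by (intro antisym pavg_mono) auto

lemma pavg_const [simp]: "finite B \<Longrightarrow> pavg B (\<lambda>_. c) = c"
  by (simp add: pavg_def card_Pow)

lemma pavg_add: "pavg B (\<lambda>S. g S + h S) = pavg B g + pavg B h"
  by (simp add: pavg_def sum.distrib add_divide_distrib)

lemma pavg_cmult: "pavg B (\<lambda>S. c * g S) = c * pavg B g"
  by (simp add: pavg_def sum_distrib_left)

lemma pavg_le_const: "finite B \<Longrightarrow> (\<And>S. S \<subseteq> B \<Longrightarrow> g S \<le> c) \<Longrightarrow> pavg B g \<le> c"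
  using pavg_mono[of B g "\<lambda>_. c"] by simp

lemma pavg_nonneg: "(\<And>S. S \<subseteq> B \<Longrightarrow> 0 \<le> g S) \<Longrightarrow> 0 \<le> pavg B g"
  unfolding pavg_def by (intro divide_nonneg_nonneg sum_nonneg) auto

lemma pavg_swap: "pavg A (\<lambda>S. pavg B (g S)) = pavg B (\<lambda>T. pavg A (\<lambda>S. g S T))"
  unfolding pavg_def by (simp add: sum_divide_distrib mult.commute) (rule sum.swap)

text \<open>A subset of a disjoint union is a pair of subsets, so coins on disjoint blocks are
  independent. This is how some coins are frozen while the others are averaged.\<close>

lemma pavg_Un:
  assumes "finite A" "finite B" "A \<inter> B = {}"
  shows "pavg (A \<union> B) g = pavg A (\<lambda>S. pavg B (\<lambda>T. g (S \<union> T)))"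
proof -
  have "(\<Sum>U\<in>Pow (A \<union> B). g U) = (\<Sum>(S, T)\<in>Pow A \<times> Pow B. g (S \<union> T))"
    using assms
    by (intro sum.reindex_bij_witness[of _ "\<lambda>(S, T). S \<union> T" "\<lambda>U. (U \<inter> A, U \<inter> B)"])
       (auto simp: Int_Un_distrib2 intro!: arg_cong[where f = g])
  also have "\<dots> = (\<Sum>S\<in>Pow A. \<Sum>T\<in>Pow B. g (S \<union> T))"
    by (simp add: sum.cartesian_product)
  finally show ?thesis
    using assms
    by (simp add: pavg_def card_Un_disjoint power_add sum_divide_distrib mult.commute)
qed

text \<open>The variance about the mean \<open>m\<close> is nonnegative.\<close>

lemma pavg_square_le:
  assumes "finite B"
  shows "(pavg B h)\<^sup>2 \<le> pavg B (\<lambda>S. (h S)\<^sup>2)"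
proof -
  define m where "m = pavg B h"
  have "0 \<le> pavg B (\<lambda>S. (h S - m)\<^sup>2)"
    by (rule pavg_nonneg) simp
  also have "\<dots> = pavg B (\<lambda>S. (h S)\<^sup>2 + ((-2 * m) * h S + m\<^sup>2))"
    by (rule pavg_cong) (simp add: power2_eq_square algebra_simps)
  also have "\<dots> = pavg B (\<lambda>S. (h S)\<^sup>2) - m\<^sup>2"
    unfolding pavg_add pavg_cmult using assms by (simp add: m_def[symmetric] power2_eq_square)
  finally show ?thesis by (simp add: m_def)
qed

text \<open>Cauchy--Schwarz decoupling: two independent copies of the first block share the second.\<close>
lemma pavg_decouple:
  assumes "finite A" "finite B"
  shows "(pavg A (\<lambda>S. pavg B (\<lambda>T. of_bool (Q S T))))\<^sup>2 \<le>
           pavg A (\<lambda>S. pavg A (\<lambda>S'. pavg B (\<lambda>T. of_bool (Q S T \<and> Q S' T))))"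
proof -
  define h where "h T = pavg A (\<lambda>S. of_bool (Q S T))" for T
  have "(pavg A (\<lambda>S. pavg B (\<lambda>T. of_bool (Q S T))))\<^sup>2 = (pavg B h)\<^sup>2"
    unfolding h_def by (subst pavg_swap) (rule refl)
  also have "\<dots> \<le> pavg B (\<lambda>T. (h T)\<^sup>2)"
    by (rule pavg_square_le) fact
  also have "\<dots> = pavg B (\<lambda>T. pavg A (\<lambda>S. pavg A (\<lambda>S'. of_bool (Q S T \<and> Q S' T))))"
  proof (rule pavg_cong)
    fix T
    show "(h T)\<^sup>2 = pavg A (\<lambda>S. pavg A (\<lambda>S'. of_bool (Q S T \<and> Q S' T)))"
      unfolding of_bool_conj pavg_cmult power2_eq_square
      by (simp add: mult.commute[of "of_bool _"] pavg_cmult flip: h_def)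
  qed
  also have "\<dots> = pavg A (\<lambda>S. pavg A (\<lambda>S'. pavg B (\<lambda>T. of_bool (Q S T \<and> Q S' T))))"
    by (simp add: pavg_swap[of B A])
  finally show ?thesis .
qed

subsection \<open>Antichains and the Littlewood--Offord bound\<close>

text \<open>The members of \<open>F\<close> avoiding i form an antichain in \<open>E - {i}\<close>.
  Summing the induction hypothesis over i counts each A once for every element it misses, and
  absorption of binomials turns that multiplicity into \<open>card E\<close> times the desired
  weight. The set \<open>E\<close> misses nothing, but an antichain containing it is a
  singleton.\<close>

lemma LYM_inequality:
  assumes "finite E" "F \<subseteq> Pow E" "\<And>A B. A \<in> F \<Longrightarrow> B \<in> F \<Longrightarrow> A \<subseteq> B \<Longrightarrow> A = B"
  shows "(\<Sum>A\<in>F. 1 / real (card E choose card A)) \<le> 1"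
  using assms
proof (induction "card E" arbitrary: E F)
  case 0
  then have "F \<subseteq> {{}}" by auto
  then have "F = {} \<or> F = {{}}" by auto
  then show ?case by auto
next
  case (Suc m)
  have finF: "finite F" using Suc.prems by (meson finite_Pow_iff finite_subset)
  show ?case
  proof (cases "E \<in> F")
    case True
    then have "F = {E}" using Suc.prems(2) Suc.prems(3)[OF _ True] by blast
    then show ?thesis by simp
  next
    case False
    have sub: "finite A" "card A \<le> m" "card (E - A) = Suc m - card A" if "A \<in> F" for A
    proof -
      have "A \<subset> E" using that False Suc.prems by auto
      then show "finite A" using Suc.prems(1) by (auto intro: finite_subset)
      show "card A \<le> m" using psubset_card_mono[OF _ \<open>A \<subset> E\<close>] Suc by auto
      show "card (E - A) = Suc m - card A"
        using \<open>A \<subset> E\<close> Suc \<open>finite A\<close> by (simp add: card_Diff_subset)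
    qed
    have "(\<Sum>A\<in>F. real (Suc m) / real (Suc m choose card A)) =
          (\<Sum>A\<in>F. \<Sum>i\<in>E - A. 1 / real (m choose card A))"
    proof (rule sum.cong)
      fix A assume A: "A \<in> F"
      have "(Suc m - card A) * (Suc m choose card A) = Suc m * (m choose card A)"
        using binomial_absorb_comp[of "Suc m" "card A"] by simp
      then have "real (Suc m - card A) * real (Suc m choose card A) = real (Suc m) * real (m choose card A)"
        by (metis of_nat_mult)
      moreover have "(Suc m choose card A) > 0" "(m choose card A) > 0"
        using sub[OF A] by simp_all
      ultimately show "real (Suc m) / real (Suc m choose card A) = (\<Sum>i\<in>E - A. 1 / real (m choose card A))"
        using sub[OF A] by (simp add: field_simps)
    qed simp
    also have "\<dots> = (\<Sum>A\<in>F. \<Sum>i\<in>{i\<in>E. i \<notin> A}. 1 / real (m choose card A))"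
      by (intro sum.cong) auto
    also have "\<dots> = (\<Sum>i\<in>E. \<Sum>A\<in>{A\<in>F. i \<notin> A}. 1 / real (m choose card A))"
      by (rule sum.swap_restrict) (use finF Suc in auto)
    also have "\<dots> \<le> (\<Sum>i\<in>E. 1)"
    proof (rule sum_mono)
      fix i assume i: "i \<in> E"
      have c: "card (E - {i}) = m" using Suc i by simp
      have "(\<Sum>A\<in>{A\<in>F. i \<notin> A}. 1 / real (card (E - {i}) choose card A)) \<le> 1"
        by (rule Suc.hyps(1)) (use Suc i c in auto)
      then show "(\<Sum>A\<in>{A\<in>F. i \<notin> A}. 1 / real (m choose card A)) \<le> 1" using c by simp
    qed
    also have "\<dots> = real (Suc m)" using Suc by simp
    finally have "real (Suc m) * (\<Sum>A\<in>F. 1 / real (Suc m choose card A)) \<le> real (Suc m) * 1"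
      by (simp add: sum_distrib_left)
    then show ?thesis using Suc.hyps(2) by (simp del: of_nat_Suc)
  qed
qed

text \<open>Each weight in the LYM sum is at least the reciprocal of the central binomial
  coefficient.\<close>

lemma Sperner:
  assumes "finite E" "F \<subseteq> Pow E" "\<And>A B. A \<in> F \<Longrightarrow> B \<in> F \<Longrightarrow> A \<subseteq> B \<Longrightarrow> A = B"
  shows "card F \<le> card E choose (card E div 2)"
proof -
  define M where "M = (card E choose (card E div 2))"
  have M: "M > 0" by (simp add: M_def)
  have "real (card F) / real M = (\<Sum>A\<in>F. 1 / real M)" by simp
  also have "\<dots> \<le> (\<Sum>A\<in>F. 1 / real (card E choose card A))"
  proof (rule sum_mono)
    fix A assume "A \<in> F"
    then have "card A \<le> card E" using assms(1,2) by (intro card_mono) auto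
    then have "(card E choose card A) > 0" by simp
    moreover have "(card E choose card A) \<le> M"
      unfolding M_def by (rule binomial_maximum)
    ultimately show "1 / real M \<le> 1 / real (card E choose card A)"
      using M by (intro divide_left_mono mult_pos_pos) auto
  qed
  also have "\<dots> \<le> 1" by (rule LYM_inequality) fact+
  finally show ?thesis using M by (simp add: M_def)
qed

text \<open>Consecutive central coefficients have ratio 2(2m+1)/(m+1), and in squared form the
  induction closes because (2m+1)(2m+3) <= 4(m+1)^2. This gives the m^(-1/2) decay behind the
  Littlewood-Offord bound.\<close>

lemma central_binomial_square_le: "real (2 * m choose m) ^ 2 * (2 * real m + 1) \<le> 16 ^ m"
proof (induction m)
  case (Suc m)
  define b where "b = real (2 * m choose m)"
  define b' where "b' = real (2 * Suc m choose Suc m)"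
  have 1: "Suc m * (2 * Suc m choose Suc m) = 2 * Suc m * (Suc (2 * m) choose m)"
  proof -
    have "2 * Suc m - 1 = Suc (2 * m)" by simp
    then show ?thesis using binomial_absorption[of m "2 * Suc m"] by metis
  qed
  have 2: "Suc m * (Suc (2 * m) choose m) = Suc (2 * m) * (2 * m choose m)"
  proof -
    have "Suc (2 * m) - m = Suc m" "Suc (2 * m) - 1 = 2 * m" by auto
    then show ?thesis using binomial_absorb_comp[of "Suc (2 * m)" m] by metis
  qed
  have "Suc m * (Suc m * (2 * Suc m choose Suc m)) = 2 * Suc m * (Suc m * (Suc (2 * m) choose m))"
    unfolding 1 by simp
  then have "Suc m * (Suc m * (2 * Suc m choose Suc m)) = 2 * Suc m * (Suc (2 * m) * (2 * m choose m))"
    unfolding 2 .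
  then have "Suc m * (2 * Suc m choose Suc m) = 2 * (Suc (2 * m) * (2 * m choose m))"
    by (subst (asm) mult.assoc, subst (asm) mult.left_commute, subst (asm) mult_cancel1) simp
  then have "real (Suc m) * b' = 2 * (real (Suc (2 * m)) * b)"
    unfolding b_def b'_def by (metis of_nat_mult of_nat_numeral)
  then have e: "(real m + 1) * b' = 2 * (2 * real m + 1) * b" by (simp add: algebra_simps)
  have "(real m + 1)^2 * (b'^2 * (2 * real m + 3)) = ((real m + 1) * b')^2 * (2 * real m + 3)"
    by (simp add: power2_eq_square)
  also have "\<dots> = 4 * ((2 * real m + 1) * (2 * real m + 3)) * (b^2 * (2 * real m + 1))"
    unfolding e power_mult_distrib by (simp add: power2_eq_square)
  also have "\<dots> \<le> 4 * (4 * (real m + 1)^2) * 16 ^ m"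
  proof (rule mult_mono[OF _ Suc.IH[folded b_def]])
    show "4 * ((2 * real m + 1) * (2 * real m + 3)) \<le> 4 * (4 * (real m + 1)^2)"
      by (simp add: power2_eq_square algebra_simps)
  qed auto
  finally have "(real m + 1)^2 * (b'^2 * (2 * real m + 3)) \<le> (real m + 1)^2 * 16 ^ Suc m" by simp
  then have "b'^2 * (2 * real m + 3) \<le> 16 ^ Suc m"
    by (rule mult_left_le_imp_le) simp
  then show ?case by (simp add: b'_def algebra_simps)
qed simp

lemma ex_central_binomial_small:
  assumes "\<eta> > 0"
  shows "\<exists>m. real (2 * m choose m) / 4 ^ m \<le> \<eta>"
proof -
  obtain m :: nat where m: "real m \<ge> 1 / \<eta>\<^sup>2" using real_arch_simple by blast
  have "(real (2 * m choose m) / 4 ^ m)\<^sup>2 * (2 * real m + 1) \<le> 1"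
  proof -
    have "(4 ^ m)\<^sup>2 = (16 :: real) ^ m"
      by (simp add: power2_eq_square flip: power_mult_distrib)
    then show ?thesis using central_binomial_square_le[of m] by (simp add: power_divide)
  qed
  then have "(real (2 * m choose m) / 4 ^ m)\<^sup>2 \<le> 1 / (2 * real m + 1)"
    by (simp add: field_simps)
  also have "\<dots> \<le> 1 / (1 / \<eta>\<^sup>2)"
    using m assms by (intro divide_left_mono) auto
  finally have "(real (2 * m choose m) / 4 ^ m)\<^sup>2 \<le> \<eta>\<^sup>2" by simp
  then show ?thesis using assms power2_le_imp_le by (intro exI[of _ m]) auto
qed

text \<open>In the direction \<open>\<phi>\<close> the sum grows by at least \<open>\<tau>/2\<close> along strict inclusions, so the subsets
  whose sum falls into a fixed small ball form an antichain.\<close>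
lemma Littlewood_Offord_direction:
  fixes p q :: "'a \<Rightarrow> complex" and \<phi> :: "complex \<Rightarrow> real"
  assumes fin: "finite B" and card: "card B = 2 * m" and \<tau>: "\<tau> > 0"
    and \<phi>: "linear \<phi>" "\<And>z. \<phi> z \<le> cmod z"
    and d: "\<And>i. i \<in> B \<Longrightarrow> \<phi> (p i - q i) \<ge> \<tau> / 2"
  shows "pavg B (\<lambda>S. of_bool (cmod ((\<Sum>i\<in>B. if i \<in> S then p i else q i) - w) < \<tau> / 4))
           \<le> real (2 * m choose m) / 4 ^ m"
proof -
  define f where "f S = (\<Sum>i\<in>B. if i \<in> S then p i else q i)" for S
  define F where "F = {S\<in>Pow B. cmod (f S - w) < \<tau> / 4}"
  have "card F \<le> card B choose (card B div 2)"
  proof (rule Sperner)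
    fix S S' assume S: "S \<in> F" "S' \<in> F" "S \<subseteq> S'"
    show "S = S'"
    proof (rule ccontr)
      assume "S \<noteq> S'"
      then obtain j where j: "j \<in> S'" "j \<notin> S" using S by auto
      have S': "S' \<subseteq> B" using S by (auto simp: F_def)
      have "f S' - f S = (\<Sum>i\<in>B. if i \<in> S' - S then p i - q i else 0)"
        unfolding f_def sum_subtractf[symmetric] using S by (intro sum.cong) auto
      also have "\<dots> = (\<Sum>i\<in>S' - S. p i - q i)"
        using fin S' by (subst sum.inter_restrict[symmetric]) (auto intro!: sum.cong)
      finally have "\<phi> (f S' - f S) = (\<Sum>i\<in>S' - S. \<phi> (p i - q i))"
        by (simp add: linear_sum[OF \<phi>(1)])
      also have "\<dots> \<ge> (\<Sum>i\<in>{j}. \<phi> (p i - q i))"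
      proof (rule sum_mono2)
        show "finite (S' - S)" using S' fin finite_subset by blast
        show "0 \<le> \<phi> (p i - q i)" if "i \<in> S' - S - {j}" for i
          using d[of i] that S' \<tau> by (smt (verit) DiffD1 half_gt_zero subsetD)
      qed (use j in auto)
      also have "(\<Sum>i\<in>{j}. \<phi> (p i - q i)) \<ge> \<tau> / 2" using d j S' by auto
      finally have "\<tau> / 2 \<le> \<phi> (f S' - f S)" by simp
      also have "\<dots> \<le> cmod (f S' - f S)" by (rule \<phi>)
      also have "\<dots> = cmod ((f S' - w) - (f S - w))" by simp
      also have "\<dots> \<le> cmod (f S' - w) + cmod (f S - w)" by (rule norm_triangle_ineq4)
      also have "\<dots> < \<tau> / 2" using S by (auto simp: F_def)
      finally show False by simp
    qed
  qed (use fin in \<open>auto simp: F_def\<close>)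
  then have "real (card F) \<le> real (2 * m choose m)" using card by simp
  moreover have "pavg B (\<lambda>S. of_bool (cmod (f S - w) < \<tau> / 4)) = real (card F) / 4 ^ m"
    using fin unfolding pavg_def F_def card by (simp add: Int_def power_mult)
  ultimately show ?thesis unfolding f_def by (simp add: divide_right_mono)
qed

text \<open>The real or the imaginary part of each difference has modulus at least
  \<open>\<tau>\<close>/2, so every index belongs to one of four signed directions. The pigeonhole
  principle finds enough indices in one of them, and the other coins are frozen. The threshold
  \<open>N\<close> is chosen before \<open>\<tau>\<close> and \<open>w\<close>.\<close>

lemma Littlewood_Offord:
  assumes "\<eta> > 0"
  shows "\<exists>N. \<forall>(B :: 'a set) p q \<tau> w. finite B \<longrightarrow> card B \<ge> N \<longrightarrow> \<tau> > 0 \<longrightarrow>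
           (\<forall>i\<in>B. cmod (p i - q i) \<ge> \<tau>) \<longrightarrow>
           pavg B (\<lambda>S. of_bool (cmod ((\<Sum>i\<in>B. if i \<in> S then p i else q i) - w) < \<tau> / 4)) \<le> \<eta>"
proof -
  obtain m where m: "real (2 * m choose m) / 4 ^ m \<le> \<eta>"
    using ex_central_binomial_small[OF assms] by blast
  show ?thesis
  proof (intro exI allI impI)
    fix B :: "'a set" and p q \<tau> w
    \<comment> \<open>The witness is \<open>8 * m\<close>: four directions with fewer than 2m
      indices each cannot cover 8m indices.\<close>
    assume B: "finite B" "8 * m \<le> card B" "\<tau> > 0" "\<forall>i\<in>B. \<tau> \<le> cmod (p i - q i)"
    define \<Phi> where "\<Phi> = {Re, (\<lambda>z. - Re z), Im, (\<lambda>z. - Im z)}"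
    define G where "G \<phi> = {i\<in>B. \<phi> (p i - q i) \<ge> \<tau> / 2}" for \<phi> :: "complex \<Rightarrow> real"
    have \<Phi>: "linear \<phi>" "\<phi> z \<le> cmod z" if "\<phi> \<in> \<Phi>" for \<phi> z
    proof -
      show "linear \<phi>" using that by (auto simp: \<Phi>_def intro!: linearI)
      show "\<phi> z \<le> cmod z" using that abs_Re_le_cmod[of z] abs_Im_le_cmod[of z]
        by (auto simp: \<Phi>_def)
    qed
    have "B \<subseteq> (\<Union>\<phi>\<in>\<Phi>. G \<phi>)"
    proof
      fix i assume i: "i \<in> B"
      have "\<tau> \<le> \<bar>Re (p i - q i)\<bar> + \<bar>Im (p i - q i)\<bar>"
        using B(4) i cmod_le[of "p i - q i"] by fastforce
      then have "\<tau> / 2 \<le> \<bar>Re (p i - q i)\<bar> \<or> \<tau> / 2 \<le> \<bar>Im (p i - q i)\<bar>" by linarith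
      then show "i \<in> (\<Union>\<phi>\<in>\<Phi>. G \<phi>)"
        using i by (auto simp: \<Phi>_def G_def abs_if split: if_splits)
    qed
    moreover have finU: "finite (\<Union>\<phi>\<in>\<Phi>. G \<phi>)" using B by (auto simp: \<Phi>_def G_def)
    ultimately have "card B \<le> card (\<Union>\<phi>\<in>\<Phi>. G \<phi>)" by (rule card_mono[rotated])
    also have "\<dots> \<le> (\<Sum>\<phi>\<in>\<Phi>. card (G \<phi>))" by (rule card_UN_le) (simp add: \<Phi>_def)
    finally have le: "card B \<le> (\<Sum>\<phi>\<in>\<Phi>. card (G \<phi>))" .
    have "\<exists>\<phi>\<in>\<Phi>. 2 * m \<le> card (G \<phi>)"
    proof (rule ccontr)
      assume "\<not> ?thesis"
      then have lt: "card (G \<phi>) < 2 * m" if "\<phi> \<in> \<Phi>" for \<phi> using that by force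
      have "(\<Sum>\<phi>\<in>\<Phi>. card (G \<phi>)) < (\<Sum>\<phi>\<in>\<Phi>. 2 * m)"
        by (rule sum_strict_mono) (use lt in \<open>auto simp: \<Phi>_def\<close>)
      also have "\<dots> = card \<Phi> * (2 * m)" by simp
      also have "\<dots> \<le> 4 * (2 * m)"
        unfolding \<Phi>_def by (intro mult_right_mono order.trans[OF card_insert_le_m1]) auto
      finally show False using le B(2) by simp
    qed
    then obtain \<phi> where \<phi>: "\<phi> \<in> \<Phi>" "2 * m \<le> card (G \<phi>)" by blast
    obtain A where A: "A \<subseteq> G \<phi>" "card A = 2 * m" "finite A"
      using obtain_subset_with_card_n[OF \<phi>(2)] by blast
    have AB: "A \<subseteq> B" using A by (auto simp: G_def)
    then have BA: "B = (B - A) \<union> A" by auto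
    define f where "f S = (\<Sum>i\<in>B. if i \<in> S then p i else q i)" for S
    have "pavg B (\<lambda>S. of_bool (cmod (f S - w) < \<tau> / 4)) =
          pavg (B - A) (\<lambda>S. pavg A (\<lambda>T. of_bool (cmod (f (S \<union> T) - w) < \<tau> / 4)))"
      by (subst BA, rule pavg_Un) (use A B in auto)
    also have "\<dots> \<le> \<eta>"
    proof (rule pavg_le_const)
      fix S assume S: "S \<subseteq> B - A"
      define u where "u = (\<Sum>i\<in>B - A. if i \<in> S then p i else q i)"
      have f: "f (S \<union> T) = u + (\<Sum>i\<in>A. if i \<in> T then p i else q i)" if "T \<subseteq> A" for T
      proof -
        have "f (S \<union> T) = (\<Sum>i\<in>B - A. if i \<in> S \<union> T then p i else q i) +
                          (\<Sum>i\<in>A. if i \<in> S \<union> T then p i else q i)"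
          unfolding f_def by (rule sum.subset_diff) (use AB B in auto)
        also have "\<dots> = u + (\<Sum>i\<in>A. if i \<in> T then p i else q i)"
          unfolding u_def using S that by (intro arg_cong2[of _ _ _ _ "(+)"] sum.cong) auto
        finally show ?thesis .
      qed
      have "pavg A (\<lambda>T. of_bool (cmod (f (S \<union> T) - w) < \<tau> / 4)) =
            pavg A (\<lambda>T. of_bool (cmod ((\<Sum>i\<in>A. if i \<in> T then p i else q i) - (w - u)) < \<tau> / 4))"
        by (rule pavg_cong) (simp add: f algebra_simps)
      also have "\<dots> \<le> real (2 * m choose m) / 4 ^ m"
        by (rule Littlewood_Offord_direction[of _ _ _ \<phi>]) (use A B \<phi> \<Phi> in \<open>auto simp: G_def\<close>)
      finally show "pavg A (\<lambda>T. of_bool (cmod (f (S \<union> T) - w) < \<tau> / 4)) \<le> \<eta>" using m by simp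
    qed (use B in auto)
    finally show "pavg B (\<lambda>S. of_bool (cmod ((\<Sum>i\<in>B. if i \<in> S then p i else q i) - w) < \<tau> / 4)) \<le> \<eta>"
      unfolding f_def .
  qed
qed

subsection \<open>Anticoncentration of elementary symmetric polynomials\<close>

lemma coeff_prod_linear_0: "coeff (\<Prod>i\<in>B. [:1, x i:]) 0 = (1 :: 'a :: comm_ring_1)"
  by (induction B rule: infinite_finite_induct) (simp_all add: coeff_mult)

lemma coeff_prod_linear_1:
  "finite B \<Longrightarrow> coeff (\<Prod>i\<in>B. [:1, x i:]) (Suc 0) = (\<Sum>i\<in>B. x i :: 'a :: comm_ring_1)"
  by (induction B rule: finite_induct) (simp_all add: coeff_prod_linear_0)

text \<open>The coefficient of X^k in the product of the 1 + y_i X is the k-th elementary symmetric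
  polynomial. The induction on k carries an arbitrary cofactor \<open>C\<close> because decoupling
  creates a new one. \<open>N\<close> does not depend on \<open>\<tau>\<close>, which is
  exponentially small in the application.\<close>

lemma coeff_prod_anticoncentration:
  assumes "\<eta> > 0"
  shows "\<exists>N. \<forall>(B :: 'a set) p q \<tau> C. finite B \<longrightarrow> card B \<ge> N \<longrightarrow> \<tau> > 0 \<longrightarrow>
           (\<forall>i\<in>B. cmod (p i - q i) \<ge> \<tau>) \<longrightarrow>
           pavg B (\<lambda>S. of_bool (cmod (coeff (C * (\<Prod>i\<in>B. [:1, if i \<in> S then p i else q i:])) k)
              < cmod (coeff C 0) * (\<tau> / 8) ^ k)) \<le> \<eta>"
  using assms
proof (induction k arbitrary: \<eta>)
  case 0
  show ?case
    using 0 by (auto simp: coeff_mult coeff_prod_linear_0 pavg_def)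
next
  case (Suc k)
  \<comment> \<open>Cauchy-Schwarz bounds the square of the probability, and two errors of size
    \<open>\<eta>'\<close> must add up to the square of \<open>\<eta>\<close>.\<close>
  define \<eta>' where "\<eta>' = \<eta>\<^sup>2 / 2"
  have "\<eta>' > 0" using Suc.prems by (simp add: \<eta>'_def)
  obtain N1 where N1: "\<And>(B :: 'a set) p q \<tau> w. finite B \<Longrightarrow> card B \<ge> N1 \<Longrightarrow> \<tau> > 0 \<Longrightarrow>
           (\<forall>i\<in>B. cmod (p i - q i) \<ge> \<tau>) \<Longrightarrow>
           pavg B (\<lambda>S. of_bool (cmod ((\<Sum>i\<in>B. if i \<in> S then p i else q i) - w) < \<tau> / 4)) \<le> \<eta>'"
    using Littlewood_Offord[OF \<open>\<eta>' > 0\<close>] by blast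
  obtain N2 where N2: "\<And>(B :: 'a set) p q \<tau> C. finite B \<Longrightarrow> card B \<ge> N2 \<Longrightarrow> \<tau> > 0 \<Longrightarrow>
           (\<forall>i\<in>B. cmod (p i - q i) \<ge> \<tau>) \<Longrightarrow>
           pavg B (\<lambda>S. of_bool (cmod (coeff (C * (\<Prod>i\<in>B. [:1, if i \<in> S then p i else q i:])) k)
              < cmod (coeff C 0) * (\<tau> / 8) ^ k)) \<le> \<eta>'"
    using Suc.IH[OF \<open>\<eta>' > 0\<close>] by blast
  show ?case
  proof (intro exI allI impI)
    fix D :: "'a set" and p q \<tau> C
    assume D: "finite D" "N1 + N2 \<le> card D" "\<tau> > 0" "\<forall>i\<in>D. \<tau> \<le> cmod (p i - q i)"
    \<comment> \<open>The block \<open>A\<close> provides a linear sum for Littlewood-Offord; what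
      remains is large enough for the induction hypothesis.\<close>
    obtain A where A: "A \<subseteq> D" "card A = N1" "finite A"
      using obtain_subset_with_card_n[of N1 D] D(2) by auto
    define B where "B = D - A"
    have B: "finite B" "N2 \<le> card B" "A \<inter> B = {}" "D = A \<union> B"
      using A D by (auto simp: B_def card_Diff_subset)
    define L where "L E S = (\<Prod>i\<in>E. [:1, if i \<in> S then p i else q i:])" for E S :: "'a set"
    define e where "e S = (\<Sum>i\<in>A. if i \<in> S then p i else q i)" for S
    define c where "c = cmod (coeff C 0)"
    define Q where "Q S T \<longleftrightarrow> cmod (coeff (C * (L A S * L B T)) (Suc k)) < c * (\<tau> / 8) ^ Suc k" for S T
    have split: "L D (S \<union> T) = L A S * L B T" if "S \<subseteq> A" "T \<subseteq> B" for S T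
    proof -
      have "L D (S \<union> T) = L A (S \<union> T) * L B (S \<union> T)"
        unfolding L_def B(4) by (rule prod.union_disjoint) (use A B in auto)
      also have "L A (S \<union> T) = L A S"
        unfolding L_def using B that by (intro prod.cong) auto
      also have "L B (S \<union> T) = L B T"
        unfolding L_def using B that by (intro prod.cong) auto
      finally show ?thesis .
    qed
    have main: "pavg B (\<lambda>T. of_bool (Q S T \<and> Q S' T)) \<le> of_bool (cmod (e S - e S') < \<tau> / 4) + \<eta>'"
      for S S'
    proof (cases "cmod (e S - e S') < \<tau> / 4")
      case True
      then show ?thesis using \<open>\<eta>' > 0\<close> B
        by (intro pavg_le_const) (auto simp: of_bool_def)
    next
      case False
      \<comment> \<open>Both products have constant coefficient 1, so X divides the difference. The
        quotient is the cofactor for degree k, and its own constant coefficient is that of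
        \<open>C\<close> times the difference of the two linear sums.\<close>
      obtain C' where C': "C * (L A S - L A S') = pCons 0 C'"
      proof -
        obtain x r where r: "C * (L A S - L A S') = pCons x r" by (rule pCons_cases)
        have "x = coeff (C * (L A S - L A S')) 0" by (simp add: r)
        also have "\<dots> = 0" by (simp add: coeff_mult L_def coeff_prod_linear_0)
        finally show ?thesis using r that by simp
      qed
      have "coeff C' 0 = coeff (C * (L A S - L A S')) (Suc 0)" by (simp add: C')
      also have "\<dots> = coeff C 0 * (e S - e S')"
        using A by (simp add: coeff_mult L_def coeff_prod_linear_0 coeff_prod_linear_1 e_def)
      finally have "cmod (coeff C' 0) = c * cmod (e S - e S')" by (simp add: c_def norm_mult)
      also have "\<dots> \<ge> c * (\<tau> / 4)" using False by (intro mult_left_mono) (auto simp: c_def)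
      finally have C'0: "c * (\<tau> / 4) \<le> cmod (coeff C' 0)" .
      have "pavg B (\<lambda>T. of_bool (Q S T \<and> Q S' T)) \<le>
            pavg B (\<lambda>T. of_bool (cmod (coeff (C' * L B T) k) < cmod (coeff C' 0) * (\<tau> / 8) ^ k))"
      proof (rule pavg_mono)
        fix T
        have "cmod (coeff (C' * L B T) k) < cmod (coeff C' 0) * (\<tau> / 8) ^ k" if "Q S T" "Q S' T"
        proof -
          have "coeff (C' * L B T) k = coeff (pCons 0 C' * L B T) (Suc k)" by simp
          also have "\<dots> = coeff (C * (L A S * L B T)) (Suc k) - coeff (C * (L A S' * L B T)) (Suc k)"
            unfolding C'[symmetric] by (simp add: algebra_simps flip: coeff_diff)
          also have "cmod \<dots> \<le> cmod (coeff (C * (L A S * L B T)) (Suc k)) +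
                               cmod (coeff (C * (L A S' * L B T)) (Suc k))"
            by (rule norm_triangle_ineq4)
          \<comment> \<open>Origin of the 8: twice \<open>\<tau> / 8\<close> is
            \<open>\<tau> / 4\<close>, the lower bound on the difference of linear sums in this
            case.\<close>
          also have "\<dots> < 2 * (c * (\<tau> / 8) ^ Suc k)"
            unfolding mult_2 using that by (intro add_strict_mono) (simp_all only: Q_def)
          also have "\<dots> = c * (\<tau> / 4) * (\<tau> / 8) ^ k" by simp
          also have "\<dots> \<le> cmod (coeff C' 0) * (\<tau> / 8) ^ k"
            using C'0 D by (intro mult_right_mono) auto
          finally show ?thesis .
        qed
        then show "of_bool (Q S T \<and> Q S' T) \<le>
            (of_bool (cmod (coeff (C' * L B T) k) < cmod (coeff C' 0) * (\<tau> / 8) ^ k) :: real)"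
          by auto
      qed
      also have "\<dots> \<le> \<eta>'"
        unfolding L_def by (rule N2) (use B D in auto)
      finally show ?thesis by simp
    qed
    define R where "R = pavg D (\<lambda>S. of_bool (cmod (coeff (C * L D S) (Suc k)) < c * (\<tau> / 8) ^ Suc k))"
    have "R = pavg A (\<lambda>S. pavg B (\<lambda>T. of_bool (Q S T)))"
      unfolding R_def B(4)
      by (subst pavg_Un) (use A B in \<open>auto simp: Q_def split[unfolded B(4)] cong: pavg_cong\<close>)
    then have "R\<^sup>2 \<le> pavg A (\<lambda>S. pavg A (\<lambda>S'. pavg B (\<lambda>T. of_bool (Q S T \<and> Q S' T))))"
      using pavg_decouple[of A B Q] A B by simp
    also have "\<dots> \<le> pavg A (\<lambda>S. pavg A (\<lambda>S'. of_bool (cmod (e S - e S') < \<tau> / 4) + \<eta>'))"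
      by (intro pavg_mono main)
    also have "\<dots> = pavg A (\<lambda>S'. pavg A (\<lambda>S. of_bool (cmod (e S - e S') < \<tau> / 4))) + \<eta>'"
      using A by (simp add: pavg_add) (rule pavg_swap)
    \<comment> \<open>For each fixed \<open>S'\<close> the sum \<open>e S'\<close> is a constant
      centre \<open>w\<close>.\<close>
    also have "pavg A (\<lambda>S'. pavg A (\<lambda>S. of_bool (cmod (e S - e S') < \<tau> / 4))) \<le> \<eta>'"
      using A D unfolding e_def by (intro pavg_le_const N1) auto
    finally have "R\<^sup>2 \<le> \<eta>\<^sup>2" by (simp add: \<eta>'_def)
    then have "R \<le> \<eta>" using Suc.prems by (intro power2_le_imp_le[of R \<eta>]) auto
    then show "pavg D (\<lambda>S. of_bool (cmod (coeff (C * (\<Prod>i\<in>D. [:1, if i \<in> S then p i else q i:])) (Suc k))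
              < cmod (coeff C 0) * (\<tau> / 8) ^ Suc k)) \<le> \<eta>"
      unfolding R_def L_def c_def .
  qed
qed

subsection \<open>Jensen's formula on circles\<close>

text \<open>Normalised arc length in the parameter t of \<open>circ c r t\<close>; being a
  probability measure, it turns circle means into expectations.\<close>

definition unit_interval :: "real measure" where
  "unit_interval = restrict_space lborel {0..1}"

definition circ :: "complex \<Rightarrow> real \<Rightarrow> real \<Rightarrow> complex" where
  "circ c r t = c + of_real r * cis (2 * pi * t)"

lemma space_unit_interval: "space unit_interval = {0..1}"
  by (simp add: unit_interval_def space_restrict_space)

interpretation UI: prob_space unit_interval
proof
  show "emeasure unit_interval (space unit_interval) = 1"
    unfolding space_unit_interval unfolding unit_interval_def
    by (subst emeasure_restrict_space) auto
qed

lemma measurable_unit_interval: "f \<in> borel_measurable borel \<Longrightarrow> f \<in> borel_measurable unit_interval"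
  unfolding unit_interval_def by (rule measurable_restrict_space1) simp

lemma continuous_circ [continuous_intros]: "continuous_on A (circ c r)"
  unfolding circ_def cis_conv_exp by (intro continuous_intros)

lemma measurable_circ [measurable]: "circ c r \<in> borel_measurable borel"
  by (intro borel_measurable_continuous_onI continuous_circ)

lemma measurable_circ_UI [measurable]: "circ c r \<in> borel_measurable unit_interval"
  by (rule measurable_unit_interval) measurable

lemma integrable_unit_interval_continuous:
  fixes f :: "real \<Rightarrow> real"
  assumes "continuous_on {0..1} f"
  shows "integrable unit_interval f"
    and "(LINT t|unit_interval. f t) = integral {0..1} f"
proof -
  have *: "set_integrable lborel {0..1} f"
    using borel_integrable_compact[OF _ assms] by (simp add: set_integrable_def)
  then show "integrable unit_interval f"
    unfolding unit_interval_def by (subst integrable_restrict_space) (auto simp: set_integrable_def)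
  have "(LINT t|unit_interval. f t) = (LINT t:{0..1}|lborel. f t)"
    unfolding unit_interval_def set_lebesgue_integral_def by (subst integral_restrict_space) auto
  also have "\<dots> = integral {0..1} f" by (rule set_borel_integral_eq_integral(2)[OF *])
  finally show "(LINT t|unit_interval. f t) = integral {0..1} f" .
qed

text \<open>Two parameters of the same point differ by an integer, so each fibre is
  countable.\<close>

lemma AE_circ_neq:
  assumes "r \<noteq> 0"
  shows "AE t in unit_interval. circ c r t \<noteq> a"
proof -
  have "countable {t. circ c r t = a}"
  proof (cases "\<exists>s. circ c r s = a")
    case True
    then obtain s where s: "circ c r s = a" by blast
    have "{t. circ c r t = a} \<subseteq> range (\<lambda>n::int. s + of_int n)"
    proof
      fix t assume "t \<in> {t. circ c r t = a}"
      then have "cis (2 * pi * t) = cis (2 * pi * s)"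
        using s assms by (auto simp: circ_def)
      then obtain n :: int where "\<i> * complex_of_real (2 * pi * t) =
          \<i> * complex_of_real (2 * pi * s) + (of_int (2 * n) * pi) * \<i>"
        unfolding cis_conv_exp exp_eq by blast
      then have "2 * pi * t = 2 * pi * s + 2 * of_int n * pi"
        by (auto simp: complex_eq_iff)
      then have "2 * pi * t = 2 * pi * (s + of_int n)" by (simp add: algebra_simps)
      then have "t = s + of_int n" by simp
      then show "t \<in> range (\<lambda>n::int. s + of_int n)" by blast
    qed
    then show ?thesis by (rule countable_subset) auto
  qed auto
  then have "{t. circ c r t = a} \<in> null_sets lborel" by (rule countable_imp_null_set_lborel)
  then have "AE t in lborel. t \<notin> {t. circ c r t = a}" by (rule AE_not_in)
  then show ?thesis unfolding unit_interval_def by (subst AE_restrict_space_iff) auto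
qed

text \<open>Mean value property: 1 - wu has positive real part on the closed unit disc, so
  \<open>Ln (1 - w * u)\<close> is holomorphic there, and Cauchy's formula gives its circle mean as
  the value \<open>Ln 1\<close> at the centre.\<close>

lemma integral_ln_one_minus:
  assumes "cmod w < 1"
  shows "(LINT t|unit_interval. ln (cmod (1 - w * cis (2 * pi * t)))) = 0"
proof -
  have lt: "cmod (w * u) < 1" if "cmod u \<le> 1" for u
    using mult_left_mono[OF that, of "cmod w"] assms by (simp add: norm_mult)
  have nz: "1 - w * u \<notin> \<real>\<^sub>\<le>\<^sub>0" if "cmod u \<le> 1" for u
  proof
    assume "1 - w * u \<in> \<real>\<^sub>\<le>\<^sub>0"
    then have "Re (w * u) \<ge> 1" by (auto simp: complex_nonpos_Reals_iff)
    then show False using lt[OF that] complex_Re_le_cmod[of "w * u"] by linarith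
  qed
  have hol: "(\<lambda>u::complex. Ln (1 - w * u)) holomorphic_on cball 0 1"
    by (intro holomorphic_intros nz) auto
  have "((\<lambda>u. Ln (1 - w * u) / (u - 0)) has_contour_integral (2 * of_real pi * \<i> * Ln (1 - w * 0))) (circlepath 0 1)"
    by (rule Cauchy_integral_circlepath_simple[OF hol]) auto
  then have "((\<lambda>t. (Ln (1 - w * circlepath 0 1 t) / circlepath 0 1 t) *
      vector_derivative (circlepath 0 1) (at t)) has_integral 0) {0..1}"
    by (simp add: has_contour_integral)
  moreover have "(Ln (1 - w * circlepath 0 1 t) / circlepath 0 1 t) *
      vector_derivative (circlepath 0 1) (at t) = (2 * pi * \<i>) * Ln (1 - w * cis (2 * pi * t))" for t
    unfolding vector_derivative_circlepath by (simp add: circlepath cis_conv_exp mult_ac)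
  ultimately have "((\<lambda>t. (2 * pi * \<i>) * Ln (1 - w * cis (2 * pi * t))) has_integral 0) {0..1}"
    by simp
  from has_integral_mult_right[OF this, of "1 / (2 * pi * \<i>)"]
  have *: "((\<lambda>t. Ln (1 - w * cis (2 * pi * t))) has_integral 0) {0..1}" by simp
  have "((\<lambda>t. Re (Ln (1 - w * cis (2 * pi * t)))) has_integral 0) {0..1}"
    using has_integral_linear[OF * bounded_linear_Re] by (simp add: o_def)
  moreover have nz': "1 - w * cis (2 * pi * t) \<noteq> 0" for t
    using nz[of "cis (2 * pi * t)"] by auto
  ultimately have *: "((\<lambda>t. ln (cmod (1 - w * cis (2 * pi * t)))) has_integral 0) {0..1}"
    by (simp add: Re_Ln)
  have "continuous_on {0..1} (\<lambda>t. ln (cmod (1 - w * cis (2 * pi * t))))"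
    unfolding cis_conv_exp using nz' by (intro continuous_intros) (simp add: cis_conv_exp)
  from integrable_unit_interval_continuous(2)[OF this] * show ?thesis
    by (simp add: integral_unique)
qed

text \<open>Factoring out the larger of \<open>r\<close> and |a| leaves a factor |1 - w e| with |w|
  < 1 and e on the unit circle, whose logarithm has mean zero.\<close>

lemma integral_ln_circle_generic:
  assumes r: "r > 0" and ne: "cmod a \<noteq> r"
  shows "integrable unit_interval (\<lambda>t. ln (cmod (of_real r * cis (2 * pi * t) - a)))" (is ?A)
    and "(LINT t|unit_interval. ln (cmod (of_real r * cis (2 * pi * t) - a))) = ln (max r (cmod a))" (is ?B)
proof -
  have cont: "continuous_on {0..1} (\<lambda>t. ln (cmod (1 - w * cis (2 * pi * t))))" if "cmod w < 1" for w
  proof -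
    have "1 - w * cis (2 * pi * t) \<noteq> 0" for t
    proof
      assume "1 - w * cis (2 * pi * t) = 0"
      then have "cmod (w * cis (2 * pi * t)) = 1" by simp
      then show False using that by (simp add: norm_mult)
    qed
    then show ?thesis unfolding cis_conv_exp by (intro continuous_intros) (auto simp: cis_conv_exp)
  qed
  have "?A \<and> ?B" if w: "cmod w < 1" and R: "R > 0" "R = max r (cmod a)"
    and eq: "\<And>t. cmod (of_real r * cis (2 * pi * t) - a) = R * cmod (1 - w * cis (2 * pi * t))" for w R
  proof -
    have nz: "cmod (1 - w * cis (2 * pi * t)) > 0" for t
    proof -
      have "cmod (w * cis (2 * pi * t)) < 1" using w by (simp add: norm_mult)
      then show ?thesis by auto
    qed
    have e: "ln (cmod (of_real r * cis (2 * pi * t) - a)) = ln R + ln (cmod (1 - w * cis (2 * pi * t)))" for t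
      unfolding eq using nz R by (simp add: ln_mult)
    have i: "integrable unit_interval (\<lambda>t. ln (cmod (1 - w * cis (2 * pi * t))))"
      by (rule integrable_unit_interval_continuous[OF cont[OF w]])
    show ?thesis
      unfolding e using i integral_ln_one_minus[OF w] R(2) by (simp add: UI.prob_space)
  qed
  note * = this
  show ?A ?B
  proof -
    have "?A \<and> ?B"
    proof (cases "cmod a < r")
      case True
      show ?thesis
      proof (rule *[of "cnj (a / of_real r)" r])
        \<comment> \<open>For |a| < r the natural factorisation contains the conjugate of
          \<open>cis\<close>; conjugating inside the modulus moves the bar to
          \<open>a / r\<close>.\<close>
        fix t
        have "of_real r * cis (2 * pi * t) - a =
              of_real r * cis (2 * pi * t) * (1 - (a / of_real r) * cnj (cis (2 * pi * t)))"
          using r by (simp add: algebra_simps cis_cnj cis_mult)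
        then have "cmod (of_real r * cis (2 * pi * t) - a) =
                   r * cmod (1 - (a / of_real r) * cnj (cis (2 * pi * t)))"
          using r by (simp add: norm_mult)
        also have "cmod (1 - (a / of_real r) * cnj (cis (2 * pi * t))) =
                   cmod (cnj (1 - (a / of_real r) * cnj (cis (2 * pi * t))))" by (rule complex_mod_cnj[symmetric])
        finally show "cmod (of_real r * cis (2 * pi * t) - a) =
                   r * cmod (1 - cnj (a / of_real r) * cis (2 * pi * t))" by simp
      qed (use r True in \<open>auto simp: norm_divide\<close>)
    next
      case False
      then have gt: "cmod a > r" using ne by simp
      then have a: "a \<noteq> 0" using r by auto
      show ?thesis
      proof (rule *[of "of_real r / a" "cmod a"])
        fix t
        have "of_real r * cis (2 * pi * t) - a = - a * (1 - of_real r / a * cis (2 * pi * t))"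
          using a by (simp add: algebra_simps)
        then show "cmod (of_real r * cis (2 * pi * t) - a) =
                   cmod a * cmod (1 - of_real r / a * cis (2 * pi * t))"
          by (simp only: norm_mult norm_minus_cancel)
      qed (use r gt a in \<open>auto simp: norm_divide\<close>)
    qed
    then show ?A ?B by auto
  qed
qed

lemma cmod_circle_diff:
  "(cmod (of_real r * cis x - of_real s * cis y))\<^sup>2 = r\<^sup>2 + s\<^sup>2 - 2 * (r * s) * cos (x - y)"
proof -
  have "(cmod (of_real r * cis x - of_real s * cis y))\<^sup>2 =
        r\<^sup>2 * ((sin x)\<^sup>2 + (cos x)\<^sup>2) + s\<^sup>2 * ((sin y)\<^sup>2 + (cos y)\<^sup>2) - 2 * (r * s) * cos (x - y)"
    unfolding cmod_power2 cos_diff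
    by (simp add: power2_eq_square algebra_simps del: sin_cos_squared_add3)
  then show ?thesis by simp
qed

text \<open>Regularising the singularity only moves the pole off the circle:
  \<open>|r e - a|\<^sup>2 + \<delta>\<^sup>2 = |r' e - a'|\<^sup>2\<close> with \<open>r' > |a'|\<close>, where \<open>r' + |a'|\<close> and \<open>r' - |a'|\<close> are the
  hypotenuses of right triangles with legs \<open>\<delta>\<close> and \<open>r + |a|\<close>, \<open>r - |a|\<close>.\<close>
lemma integral_ln_circle_regularised:
  fixes a :: complex
  assumes r: "r > 0" and \<delta>: "\<delta> > 0"
  defines "f \<equiv> \<lambda>t. ln ((cmod (of_real r * cis (2 * pi * t) - a))\<^sup>2 + \<delta>\<^sup>2) / 2"
  shows "integrable unit_interval f"
    and "ln (max r (cmod a)) \<le> (LINT t|unit_interval. f t)"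
    and "(LINT t|unit_interval. f t) \<le> ln (max r (cmod a) + \<delta>)"
proof -
  define \<rho> where "\<rho> = cmod a"
  define s where "s = sqrt ((r + \<rho>)\<^sup>2 + \<delta>\<^sup>2)"
  define d where "d = sqrt ((r - \<rho>)\<^sup>2 + \<delta>\<^sup>2)"
  define r' where "r' = (s + d) / 2"
  define a' where "a' = (s - d) / 2"
  have \<rho>: "\<rho> \<ge> 0" by (simp add: \<rho>_def)
  have s2: "s\<^sup>2 = (r + \<rho>)\<^sup>2 + \<delta>\<^sup>2" and d2: "d\<^sup>2 = (r - \<rho>)\<^sup>2 + \<delta>\<^sup>2"
    by (simp_all add: s_def d_def)
  have d0: "d > 0" using \<delta> by (simp add: d_def add_nonneg_pos)
  have sd: "d \<le> s" unfolding s_def d_def using r \<rho> by (intro real_sqrt_le_mono) (simp add: power2_eq_square algebra_simps)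
  have s_ge: "r + \<rho> \<le> s" unfolding s_def by (rule real_le_rsqrt) simp
  have d_ge: "\<bar>r - \<rho>\<bar> \<le> d" unfolding d_def by (rule real_le_rsqrt) simp
  have s_le: "s \<le> r + \<rho> + \<delta>" unfolding s_def using r \<rho> \<delta>
    by (intro real_le_lsqrt) (auto simp: power2_eq_square algebra_simps)
  have d_le: "d \<le> \<bar>r - \<rho>\<bar> + \<delta>" unfolding d_def using \<delta>
    by (intro real_le_lsqrt) (auto simp: power2_sum)
  have mx: "max r \<rho> = (r + \<rho> + \<bar>r - \<rho>\<bar>) / 2" by (auto simp: max_def)
  have r': "max r \<rho> \<le> r'" "r' \<le> max r \<rho> + \<delta>"
    unfolding mx r'_def using s_ge d_ge s_le d_le by (auto simp: field_simps)
  have r'0: "r' > 0" using r' r by linarith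
  have a'r': "0 \<le> a'" "a' < r'" using sd d0 by (auto simp: a'_def r'_def)
  have q: "r'\<^sup>2 + a'\<^sup>2 = (s\<^sup>2 + d\<^sup>2) / 2" "r' * a' = (s\<^sup>2 - d\<^sup>2) / 4"
    by (auto simp: r'_def a'_def power2_eq_square field_simps)
  have q1: "r'\<^sup>2 + a'\<^sup>2 = r\<^sup>2 + \<rho>\<^sup>2 + \<delta>\<^sup>2" unfolding q s2 d2 by (simp add: power2_eq_square algebra_simps)
  have q2: "r' * a' = r * \<rho>" unfolding q s2 d2 by (simp add: power2_eq_square algebra_simps)
  obtain \<phi> where \<phi>: "a = of_real \<rho> * cis \<phi>"
    using rcis_cmod_Arg[of a] by (metis \<rho>_def rcis_def)
  \<comment> \<open>The new pole lies on the ray of \<open>a\<close>. The cosine terms of the two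
    squared distances agree because \<open>r' * a' = r * \<rho>\<close>.\<close>
  define b where "b = of_real a' * cis \<phi>"
  have b: "cmod b = a'" using a'r' by (simp add: b_def norm_mult)
  have f: "f t = ln (cmod (of_real r' * cis (2 * pi * t) - b))" for t
  proof -
    have e: "(cmod (of_real r * cis (2 * pi * t) - a))\<^sup>2 + \<delta>\<^sup>2 = (cmod (of_real r' * cis (2 * pi * t) - b))\<^sup>2"
      unfolding \<phi> b_def cmod_circle_diff q2 using q1 by simp
    have "(cmod (of_real r * cis (2 * pi * t) - a))\<^sup>2 + \<delta>\<^sup>2 > 0" using \<delta> by (simp add: add_nonneg_pos)
    then have "cmod (of_real r' * cis (2 * pi * t) - b) > 0" unfolding e by simp
    then show ?thesis unfolding f_def e by (simp add: ln_realpow)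
  qed
  have J: "integrable unit_interval f" "(LINT t|unit_interval. f t) = ln r'"
    unfolding f using integral_ln_circle_generic[OF r'0, of b] b a'r' by (auto simp: max_def)
  show "integrable unit_interval f" by (rule J)
  show "ln (max r (cmod a)) \<le> (LINT t|unit_interval. f t)"
    unfolding J using r' r by (simp add: \<rho>_def)
  show "(LINT t|unit_interval. f t) \<le> ln (max r (cmod a) + \<delta>)"
    unfolding J using r' r'0 by (simp add: \<rho>_def)
qed

text \<open>Removing the regularisation covers a pole on the circle as well. As
  \<open>\<delta>\<close> decreases the regularised logarithms decrease, so monotone convergence is
  applied to their negatives; the bounds on their means close up at the limit.\<close>

theorem Jensen_linear:
  assumes r: "r > 0"
  shows "integrable unit_interval (\<lambda>t. ln (cmod (circ c r t - a)))"
    and "(LINT t|unit_interval. ln (cmod (circ c r t - a))) = ln (max r (cmod (a - c)))"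
proof -
  define b where "b = a - c"
  define u where "u t = cmod (of_real r * cis (2 * pi * t) - b)" for t
  have u: "cmod (circ c r t - a) = u t" for t by (simp add: u_def b_def circ_def algebra_simps)
  define \<delta> where "\<delta> m = 1 / real (Suc m)" for m
  have \<delta>: "\<delta> m > 0" for m by (simp add: \<delta>_def)
  have \<delta>0: "\<delta> \<longlonglongrightarrow> 0" unfolding \<delta>_def by (rule LIMSEQ_Suc[OF lim_1_over_n])
  define f where "f m t = ln ((u t)\<^sup>2 + (\<delta> m)\<^sup>2) / 2" for m t
  note reg = integral_ln_circle_regularised[OF r \<delta>, of b, folded u_def, folded f_def]
  have nz: "AE t in unit_interval. u t > 0"
    using AE_circ_neq[OF less_imp_neq[OF r, symmetric], of c a] by eventually_elim (auto simp flip: u)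
  have meas: "(\<lambda>t. - ln (u t)) \<in> borel_measurable unit_interval"
    unfolding u[symmetric] by measurable
  have anti: "f n t \<le> f m t" if "m \<le> n" "u t > 0" for m n t
  proof -
    have "\<delta> n \<le> \<delta> m" using that by (simp add: \<delta>_def frac_le)
    then have "(\<delta> n)\<^sup>2 \<le> (\<delta> m)\<^sup>2" using \<delta>[of n] by (intro power_mono) auto
    moreover have "(u t)\<^sup>2 > 0" using that by simp
    ultimately show ?thesis unfolding f_def by (simp add: add_pos_nonneg)
  qed
  have "integrable unit_interval (\<lambda>t. - ln (u t)) \<and> (LINT t|unit_interval. - ln (u t)) = - ln (max r (cmod b))"
  proof
    have 1: "integrable unit_interval (\<lambda>t. - f m t)" for m using reg(1) by simp
    have 2: "AE t in unit_interval. mono (\<lambda>m. - f m t)"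
      using nz by eventually_elim (auto simp: mono_def intro!: anti)
    have 3: "AE t in unit_interval. (\<lambda>m. - f m t) \<longlonglongrightarrow> - ln (u t)"
      using nz
    proof eventually_elim
      case (elim t)
      have "(\<lambda>m. - f m t) \<longlonglongrightarrow> - (ln ((u t)\<^sup>2 + 0\<^sup>2) / 2)"
        unfolding f_def using elim by (intro tendsto_intros \<delta>0) auto
      then show ?case using elim by (simp add: ln_realpow)
    qed
    have 4: "(\<lambda>m. LINT t|unit_interval. - f m t) \<longlonglongrightarrow> - ln (max r (cmod b))"
    proof -
      have "(\<lambda>m. LINT t|unit_interval. f m t) \<longlonglongrightarrow> ln (max r (cmod b))"
      proof (rule real_tendsto_sandwich[where f = "\<lambda>_. ln (max r (cmod b))"])
        show "(\<lambda>m. ln (max r (cmod b) + \<delta> m)) \<longlonglongrightarrow> ln (max r (cmod b))"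
          using r by (auto intro!: tendsto_eq_intros \<delta>0)
      qed (use reg in auto)
      from tendsto_minus[OF this] show ?thesis by simp
    qed
    show "integrable unit_interval (\<lambda>t. - ln (u t))"
      by (rule integrable_monotone_convergence[OF 1 2 3 4 meas])
    show "(LINT t|unit_interval. - ln (u t)) = - ln (max r (cmod b))"
      by (rule integral_monotone_convergence[OF 1 2 3 4 meas])
  qed
  then show "integrable unit_interval (\<lambda>t. ln (cmod (circ c r t - a)))"
    and "(LINT t|unit_interval. ln (cmod (circ c r t - a))) = ln (max r (cmod (a - c)))"
    unfolding u b_def[symmetric] by auto
qed

text \<open>The excess of the regularised logarithm ln sqrt(|z|^2 + \<delta>^2) over ln |z| for
  nonzero z. It isolates the singularity and has small mean on circles; at z = 0 division by zero
  gives the value 0, which matters only on null sets.\<close>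

definition log_tail :: "real \<Rightarrow> complex \<Rightarrow> real" where
  "log_tail \<delta> z = ln (1 + (\<delta> / cmod z)\<^sup>2) / 2"

lemma log_tail_nonneg: "log_tail \<delta> z \<ge> 0"
  by (simp add: log_tail_def)

text \<open>Jensen's formula with and without regularisation leaves ln(M + \<delta>) - ln M with M
  >= r. The bound is uniform in the pole, which is what uniform integrability requires.\<close>

lemma log_tail_mean:
  assumes r: "r > 0" and \<delta>: "\<delta> > 0"
  shows "integrable unit_interval (\<lambda>t. log_tail \<delta> (circ c r t - a))"
    and "(LINT t|unit_interval. log_tail \<delta> (circ c r t - a)) \<le> \<delta> / r"
proof -
  define b where "b = a - c"
  define u where "u t = cmod (of_real r * cis (2 * pi * t) - b)" for t
  have u: "cmod (circ c r t - a) = u t" for t by (simp add: u_def b_def circ_def algebra_simps)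
  define f where "f t = ln ((u t)\<^sup>2 + \<delta>\<^sup>2) / 2" for t
  note reg = integral_ln_circle_regularised[OF r \<delta>, of b, folded u_def, folded f_def]
  note J = Jensen_linear[OF r, of c a, unfolded u]
  have ae: "AE t in unit_interval. f t - ln (u t) = log_tail \<delta> (circ c r t - a)"
    using AE_circ_neq[OF less_imp_neq[OF r, symmetric], of c a]
  proof eventually_elim
    case (elim t)
    then have "u t > 0" by (simp flip: u)
    then have "1 + (\<delta> / u t)\<^sup>2 = ((u t)\<^sup>2 + \<delta>\<^sup>2) / (u t)\<^sup>2" by (simp add: power_divide field_simps)
    then show ?case using \<open>u t > 0\<close> \<delta>
      by (simp add: log_tail_def u f_def ln_div ln_realpow add_pos_pos diff_divide_distrib)
  qed
  have m: "(\<lambda>t. log_tail \<delta> (circ c r t - a)) \<in> borel_measurable unit_interval"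
    unfolding log_tail_def by measurable
  have i: "integrable unit_interval (\<lambda>t. f t - ln (u t))" using reg J by simp
  show "integrable unit_interval (\<lambda>t. log_tail \<delta> (circ c r t - a))"
    using integrable_cong_AE[THEN iffD1, OF _ m ae i] i by blast
  have "(LINT t|unit_interval. log_tail \<delta> (circ c r t - a)) = (LINT t|unit_interval. f t - ln (u t))"
    using i m ae by (intro integral_cong_AE) (auto elim!: eventually_mono)
  also have "\<dots> = (LINT t|unit_interval. f t) - ln (max r (cmod b))"
    using reg J by (simp add: b_def)
  also have "\<dots> \<le> ln (max r (cmod b) + \<delta>) - ln (max r (cmod b))" using reg by simp
  also have "\<dots> = ln ((max r (cmod b) + \<delta>) / max r (cmod b))"
    using r \<delta> by (auto simp: ln_div max_def)
  also have "(max r (cmod b) + \<delta>) / max r (cmod b) = 1 + \<delta> / max r (cmod b)"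
    using r by (auto simp: add_divide_distrib max_def)
  also have "ln (1 + \<delta> / max r (cmod b)) \<le> \<delta> / max r (cmod b)"
    using r \<delta> by (intro ln_add_one_self_le_self) auto
  also have "\<dots> \<le> \<delta> / r" using r \<delta> by (intro divide_left_mono) auto
  finally show "(LINT t|unit_interval. log_tail \<delta> (circ c r t - a)) \<le> \<delta> / r" .
qed

text \<open>Markov's inequality for \<open>log_tail\<close>: within distance \<open>\<delta>\<close>
  of the pole it is at least (ln 2)/2, hence at least 1/4.\<close>

lemma measure_circ_near:
  assumes r: "r > 0" and \<delta>: "\<delta> > 0"
  shows "measure unit_interval {t\<in>space unit_interval. cmod (circ c r t - a) < \<delta>} \<le> 4 * \<delta> / r"
proof -
  let ?S = "{t\<in>space unit_interval. cmod (circ c r t - a) < \<delta>}"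
  have S: "?S \<in> sets unit_interval" by measurable
  note lt = log_tail_mean[OF r \<delta>, of c a]
  have "measure unit_interval ?S = (LINT t|unit_interval. indicator ?S t)" using S by simp
  also have "\<dots> \<le> (LINT t|unit_interval. 4 * log_tail \<delta> (circ c r t - a))"
  proof (rule integral_mono_AE)
    show "AE t in unit_interval. indicator ?S t \<le> 4 * log_tail \<delta> (circ c r t - a)"
      using AE_circ_neq[OF less_imp_neq[OF r, symmetric], of c a]
    proof eventually_elim
      case (elim t)
      have "1 \<le> 4 * log_tail \<delta> (circ c r t - a)" if "t \<in> ?S"
      proof -
        have "1 \<le> \<delta> / cmod (circ c r t - a)" using that elim by simp
        then have "1 \<le> (\<delta> / cmod (circ c r t - a))\<^sup>2" by (rule one_le_power)
        then have "ln 2 \<le> ln (1 + (\<delta> / cmod (circ c r t - a))\<^sup>2)" by simp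
        then show ?thesis using ln2_ge_two_thirds by (simp add: log_tail_def)
      qed
      then show ?case using log_tail_nonneg by (auto simp: indicator_def)
    qed
  qed (use S lt in \<open>auto simp: integrable_indicator_iff UI.emeasure_eq_measure\<close>)
  also have "\<dots> \<le> 4 * \<delta> / r" using lt by simp
  finally show ?thesis .
qed

text \<open>From above, |z - a| <= (1 + |z|)(1 + |a|). From below, the logarithm falls under ln
  \<delta> by at most \<open>log_tail\<close>, the only unbounded term near the pole.\<close>

lemma abs_ln_cmod_diff_le:
  assumes \<delta>: "0 < \<delta>" "\<delta> < 1"
  shows "\<bar>ln (cmod (z - a))\<bar> \<le> ln (1 + cmod z) + ln (1 + cmod a) + ln (1 / \<delta>) + log_tail \<delta> (z - a)"
proof (cases "z = a")
  \<comment> \<open>Here \<open>ln 0 = 0\<close> makes the left side vanish.\<close>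
  case True
  have "0 \<le> ln (1 + cmod z) + ln (1 + cmod a) + ln (1 / \<delta>) + log_tail \<delta> (z - a)"
    using \<delta> log_tail_nonneg by (intro add_nonneg_nonneg) auto
  then show ?thesis using True by simp
next
  case False
  then have p: "cmod (z - a) > 0" by simp
  have l0: "0 \<le> ln (1 + cmod z)" "0 \<le> ln (1 + cmod a)" "0 \<le> ln (1 / \<delta>)" "0 \<le> log_tail \<delta> (z - a)"
    using \<delta> log_tail_nonneg by simp_all
  have "ln (cmod (z - a)) \<le> ln ((1 + cmod z) * (1 + cmod a))"
  proof -
    have "cmod (z - a) \<le> cmod z + cmod a" by (rule norm_triangle_ineq4)
    also have "\<dots> \<le> (1 + cmod z) * (1 + cmod a)" by (simp add: algebra_simps)
    finally show ?thesis using p by (intro ln_mono) auto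
  qed
  also have "\<dots> = ln (1 + cmod z) + ln (1 + cmod a)" by (rule ln_mult_pos) (auto simp: add_pos_nonneg)
  finally have u: "ln (cmod (z - a)) \<le> ln (1 + cmod z) + ln (1 + cmod a)" .
  have "- ln (cmod (z - a)) \<le> ln (1 / \<delta>) + log_tail \<delta> (z - a)"
  proof -
    have "ln ((\<delta> / cmod (z - a))\<^sup>2) \<le> ln (1 + (\<delta> / cmod (z - a))\<^sup>2)"
      using p \<delta> by (intro ln_mono) auto
    then have "ln \<delta> - ln (cmod (z - a)) \<le> log_tail \<delta> (z - a)"
      using p \<delta> by (simp add: log_tail_def ln_realpow ln_div)
    then show ?thesis using \<delta> by (simp add: ln_div)
  qed
  then show ?thesis using u l0 by linarith
qed

section \<open>Logarithms of polynomials as sums over their roots\<close>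

lemma ln_cmod_poly:
  fixes p :: "complex poly"
  assumes "poly p z \<noteq> 0"
  shows "ln (cmod (poly p z)) = ln (cmod (lead_coeff p)) + (\<Sum>x\<in>#proots p. ln (cmod (z - x)))"
proof -
  have p: "p \<noteq> 0" using assms by auto
  have "poly (\<Prod>x\<in>#A. [:- x, 1:]) z = (\<Prod>x\<in>#A. z - x)" for A
    by (induction A) (auto simp: algebra_simps)
  then have e: "poly p z = lead_coeff p * (\<Prod>x\<in>#proots p. z - x)"
    by (metis complex_poly_decompose_multiset poly_smult)
  then have nz: "(\<Prod>x\<in>#proots p. z - x) \<noteq> 0" using assms by auto
  have "ln (cmod (\<Prod>x\<in>#A. z - x)) = (\<Sum>x\<in>#A. ln (cmod (z - x)))" if "(\<Prod>x\<in>#A. z - x) \<noteq> 0" for A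
    using that by (induction A) (auto simp: norm_mult ln_mult)
  then show ?thesis unfolding e using nz p by (simp add: norm_mult ln_mult)
qed

lemma AE_unit_interval_Ball_mset:
  "(\<And>x. x \<in># A \<Longrightarrow> AE t in unit_interval. Q x t) \<Longrightarrow> AE t in unit_interval. \<forall>x\<in>#A. Q x t"
  by (rule AE_finite_allI) auto

lemma integral_sum_mset:
  fixes f :: "'a \<Rightarrow> 'b \<Rightarrow> real"
  assumes "\<And>x. integrable M (f x)"
  shows "integrable M (\<lambda>t. \<Sum>x\<in>#A. f x t)"
    and "(LINT t|M. (\<Sum>x\<in>#A. f x t)) = (\<Sum>x\<in>#A. LINT t|M. f x t)"
proof -
  have "integrable M (\<lambda>t. \<Sum>x\<in>#A. f x t) \<and> (LINT t|M. (\<Sum>x\<in>#A. f x t)) = (\<Sum>x\<in>#A. LINT t|M. f x t)"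
    by (induction A) (use assms in auto)
  then show "integrable M (\<lambda>t. \<Sum>x\<in>#A. f x t)"
    and "(LINT t|M. (\<Sum>x\<in>#A. f x t)) = (\<Sum>x\<in>#A. LINT t|M. f x t)" by auto
qed

text \<open>Integrate the logarithm of the factorisation. With \<open>ln 0 = 0\<close> the
  product-to-sum rule can fail at a root, but the circle meets the roots only on a null set of
  parameters.\<close>

theorem Jensen_poly:
  fixes p :: "complex poly"
  assumes p: "p \<noteq> 0" and r: "r > 0"
  shows "integrable unit_interval (\<lambda>t. ln (cmod (poly p (circ c r t))))"
    and "(LINT t|unit_interval. ln (cmod (poly p (circ c r t)))) =
           ln (cmod (lead_coeff p)) + (\<Sum>x\<in>#proots p. ln (max r (cmod (x - c))))"
proof -
  define g where "g t = ln (cmod (lead_coeff p)) + (\<Sum>x\<in>#proots p. ln (cmod (circ c r t - x)))" for t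
  note S = integral_sum_mset[of unit_interval "\<lambda>x t. ln (cmod (circ c r t - x))", OF Jensen_linear(1)[OF r]]
  have g: "integrable unit_interval g"
    "(LINT t|unit_interval. g t) = ln (cmod (lead_coeff p)) + (\<Sum>x\<in>#proots p. ln (max r (cmod (x - c))))"
    unfolding g_def using S(1)[of "proots p"]
    by (simp_all add: S(2) Jensen_linear[OF r] UI.prob_space)
  have "AE t in unit_interval. \<forall>x\<in>#proots p. circ c r t \<noteq> x"
    using AE_circ_neq r by (intro AE_unit_interval_Ball_mset) auto
  then have ae: "AE t in unit_interval. g t = ln (cmod (poly p (circ c r t)))"
  proof eventually_elim
    case (elim t)
    then have "poly p (circ c r t) \<noteq> 0" using p by auto
    then show ?case by (simp add: ln_cmod_poly g_def)
  qed
  have m: "(\<lambda>t. ln (cmod (poly p (circ c r t)))) \<in> borel_measurable unit_interval"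
  proof -
    have "poly p \<in> borel_measurable borel" by (intro borel_measurable_continuous_onI continuous_intros)
    then show ?thesis by measurable
  qed
  show "integrable unit_interval (\<lambda>t. ln (cmod (poly p (circ c r t))))"
    using integrable_cong_AE[THEN iffD1, OF _ m ae g(1)] g(1) by blast
  have "(LINT t|unit_interval. ln (cmod (poly p (circ c r t)))) = (LINT t|unit_interval. g t)"
    by (rule integral_cong_AE[OF m borel_measurable_integrable[OF g(1)]])
       (use ae in eventually_elim, simp)
  then show "(LINT t|unit_interval. ln (cmod (poly p (circ c r t)))) =
           ln (cmod (lead_coeff p)) + (\<Sum>x\<in>#proots p. ln (max r (cmod (x - c))))"
    by (simp add: g)
qed

subsection \<open>Higher derivatives of a polynomial given by its roots\<close>

lemma coeff_0_higher_pderiv: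
  fixes p :: "'a :: {idom, semiring_char_0} poly"
  shows "coeff ((pderiv ^^ k) p) 0 = fact k * coeff p k"
  by (induction k arbitrary: p) (simp_all add: funpow_swap1 funpow_Suc_right coeff_pderiv del: funpow.simps)

lemma higher_pderiv_pcompose_shift:
  "(pderiv ^^ k) (p \<circ>\<^sub>p [:z, 1:]) = ((pderiv ^^ k) p) \<circ>\<^sub>p [:z, 1:]"
  by (induction k) (simp_all add: pderiv_pcompose pderiv_pCons)

text \<open>Taylor expansion at z: differentiation commutes with the shift, so everything is read
  off at 0.\<close>

lemma poly_higher_pderiv:
  fixes p :: "'a :: {idom, semiring_char_0} poly"
  shows "poly ((pderiv ^^ k) p) z = fact k * coeff (p \<circ>\<^sub>p [:z, 1:]) k"
proof -
  have "poly ((pderiv ^^ k) p) z = coeff (((pderiv ^^ k) p) \<circ>\<^sub>p [:z, 1:]) 0"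
    by (simp add: poly_0_coeff_0[symmetric] poly_pcompose)
  also have "\<dots> = fact k * coeff (p \<circ>\<^sub>p [:z, 1:]) k"
    by (simp add: higher_pderiv_pcompose_shift[symmetric] coeff_0_higher_pderiv)
  finally show ?thesis .
qed

section \<open>Polynomials with prescribed roots\<close>

definition root_poly :: "nat \<Rightarrow> (nat \<Rightarrow> complex) \<Rightarrow> complex poly" where
  "root_poly n x = (\<Prod>j=1..n. [:- x j, 1:])"

lemma poly_root_poly: "poly (root_poly n x) z = (\<Prod>j=1..n. z - x j)"
  by (simp add: root_poly_def poly_prod)

lemma root_poly_shift: "root_poly n x \<circ>\<^sub>p [:z, 1:] = (\<Prod>j=1..n. [:z - x j, 1:])"
  by (simp add: root_poly_def pcompose_prod pcompose_pCons)

text \<open>Pulling z - x_j out of each shifted factor leaves the generating polynomial of the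
  elementary symmetric functions of the numbers 1/(z - x_j).\<close>

lemma higher_pderiv_root_poly:
  assumes "\<And>j. j \<in> {1..n} \<Longrightarrow> z \<noteq> x j"
  shows "poly ((pderiv ^^ k) (root_poly n x)) z =
           fact k * poly (root_poly n x) z * coeff (\<Prod>j=1..n. [:1, 1 / (z - x j):]) k"
proof -
  have "(\<Prod>j=1..n. [:z - x j, 1:]) = (\<Prod>j=1..n. [:z - x j:] * [:1, 1 / (z - x j):])"
    using assms by (intro prod.cong) auto
  also have "\<dots> = (\<Prod>j=1..n. [:z - x j:]) * (\<Prod>j=1..n. [:1, 1 / (z - x j):])"
    by (rule prod.distrib)
  also have "(\<Prod>j=1..n. [:z - x j:]) = [:poly (root_poly n x) z:]"
    unfolding poly_root_poly by (induction n) (auto simp: mult.commute)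
  finally show ?thesis unfolding poly_higher_pderiv root_poly_shift by simp
qed

text \<open>The recurrence adding one factor, together with m^l (m + 1) <= (m + 1)^(l+1). For fixed
  k this is polynomial in the number of factors, so its logarithm is negligible after division by
  n.\<close>

lemma norm_coeff_prod_linear_le:
  fixes y :: "'a \<Rightarrow> complex"
  assumes "finite I" "M \<ge> 0" "\<And>j. j \<in> I \<Longrightarrow> cmod (y j) \<le> M"
  shows "cmod (coeff (\<Prod>j\<in>I. [:1, y j:]) k) \<le> (real (card I) * M) ^ k"
  using assms(1,3)
proof (induction I arbitrary: k rule: finite_induct)
  case (insert i I)
  show ?case
  proof (cases k)
    case (Suc l)
    define m where "m = real (card I)"
    have "cmod (coeff (\<Prod>j\<in>insert i I. [:1, y j:]) k) =
          cmod (coeff (\<Prod>j\<in>I. [:1, y j:]) (Suc l) + y i * coeff (\<Prod>j\<in>I. [:1, y j:]) l)"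
      using insert Suc by simp
    also have "\<dots> \<le> (m * M) ^ Suc l + M * (m * M) ^ l"
    proof (intro order.trans[OF norm_triangle_ineq] add_mono)
      show "cmod (coeff (\<Prod>j\<in>I. [:1, y j:]) (Suc l)) \<le> (m * M) ^ Suc l"
        unfolding m_def by (rule insert.IH) (use insert.prems in auto)
      have "cmod (coeff (\<Prod>j\<in>I. [:1, y j:]) l) \<le> (m * M) ^ l"
        unfolding m_def by (rule insert.IH) (use insert.prems in auto)
      then show "cmod (y i * coeff (\<Prod>j\<in>I. [:1, y j:]) l) \<le> M * (m * M) ^ l"
        unfolding norm_mult using insert.prems assms(2) by (intro mult_mono) auto
    qed
    also have "\<dots> = m ^ l * (m + 1) * M ^ Suc l"
      by (simp add: power_mult_distrib algebra_simps)
    also have "\<dots> \<le> (m + 1) ^ l * (m + 1) * M ^ Suc l"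
      using assms by (intro mult_right_mono power_mono) (auto simp: m_def)
    also have "\<dots> = ((m + 1) * M) ^ Suc l" by (simp add: power_mult_distrib)
    finally show ?thesis using insert Suc by (simp add: m_def add.commute)
  qed (simp add: coeff_prod_linear_0)
qed (auto simp: coeff_pCons split: nat.splits)

text \<open>The coefficients are dominated by those of the product of the |w_j| + X, which are
  nonnegative and sum to its value at X = 1.\<close>

lemma norm_coeff_prod_monic_le:
  fixes w :: "'a \<Rightarrow> complex"
  shows "cmod (coeff (\<Prod>j\<in>I. [:w j, 1:]) k) \<le> (\<Prod>j\<in>I. 1 + cmod (w j))"
proof (induction I arbitrary: k rule: infinite_finite_induct)
  case (insert i I)
  define q where "q = (\<Prod>j\<in>I. [:w j, 1:])"
  define A where "A = (\<Prod>j\<in>I. 1 + cmod (w j))"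
  have q: "cmod (coeff q l) \<le> A" for l using insert by (simp add: q_def A_def)
  have "0 \<le> A" unfolding A_def by (intro prod_nonneg) auto
  have "coeff (\<Prod>j\<in>insert i I. [:w j, 1:]) k = w i * coeff q k + coeff (pCons 0 q) k"
    using insert by (simp add: q_def)
  also have "cmod \<dots> \<le> cmod (w i) * A + A"
    using q \<open>0 \<le> A\<close>
    by (intro order.trans[OF norm_triangle_ineq] add_mono)
       (auto simp: norm_mult coeff_pCons intro!: mult_mono split: nat.splits)
  also have "\<dots> = (\<Prod>j\<in>insert i I. 1 + cmod (w j))"
    using insert by (simp add: A_def algebra_simps)
  finally show ?case .
qed (auto simp: coeff_pCons split: nat.splits)

lemma degree_root_poly: "degree (root_poly n x) = n"
  and lead_coeff_root_poly: "lead_coeff (root_poly n x) = 1"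
proof -
  show "degree (root_poly n x) = n"
    unfolding root_poly_def by (subst degree_prod_eq_sum_degree) auto
  show "lead_coeff (root_poly n x) = 1"
    unfolding root_poly_def by (simp add: lead_coeff_prod)
qed

lemma root_poly_nonzero: "root_poly n x \<noteq> 0"
  using lead_coeff_root_poly[of n x] by auto

lemma proots_root_poly: "proots (root_poly n x) = image_mset x (mset_set {1..n})"
proof -
  have "proots (root_poly n x) = (\<Sum>j=1..n. {#x j#})"
    unfolding root_poly_def by (subst proots_prod) auto
  also have "\<dots> = image_mset x (mset_set {1..n})"
    by (induction n) (auto simp: add.commute atLeastAtMostSuc_conv)
  finally show ?thesis .
qed

text \<open>The leading coefficient is n(n-1)...(n-k+1). The bound 1 makes its logarithm
  nonnegative, and the bound n^k keeps that logarithm small.\<close>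

lemma higher_pderiv_root_poly_degree:
  assumes "k \<le> n"
  shows "degree ((pderiv ^^ k) (root_poly n x)) = n - k"
    and "1 \<le> cmod (lead_coeff ((pderiv ^^ k) (root_poly n x)))"
    and "cmod (lead_coeff ((pderiv ^^ k) (root_poly n x))) \<le> real n ^ k"
proof -
  define p where "p k = (pderiv ^^ k) (root_poly n x)" for k
  have "degree (p k) = n - k \<and> 1 \<le> cmod (lead_coeff (p k)) \<and> cmod (lead_coeff (p k)) \<le> real n ^ k"
    using assms
  proof (induction k)
    case 0
    show ?case by (simp add: p_def degree_root_poly lead_coeff_root_poly[unfolded degree_root_poly])
  next
    case (Suc k)
    then have IH: "degree (p k) = n - k" "1 \<le> cmod (lead_coeff (p k))" "cmod (lead_coeff (p k)) \<le> real n ^ k"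
      by auto
    have S: "p (Suc k) = pderiv (p k)" by (simp add: p_def)
    have d: "degree (p (Suc k)) = n - Suc k" unfolding S degree_pderiv using IH by simp
    have "lead_coeff (p (Suc k)) = of_nat (Suc (n - Suc k)) * coeff (p k) (Suc (n - Suc k))"
      unfolding d unfolding S coeff_pderiv ..
    also have "Suc (n - Suc k) = n - k" using Suc.prems by simp
    finally have l: "cmod (lead_coeff (p (Suc k))) = real (n - k) * cmod (lead_coeff (p k))"
      by (simp add: norm_mult IH)
    have "1 * 1 \<le> real (n - k) * cmod (lead_coeff (p k))"
      using IH Suc.prems by (intro mult_mono) auto
    moreover have "real (n - k) * cmod (lead_coeff (p k)) \<le> real n * real n ^ k"
      using IH by (intro mult_mono) auto
    ultimately show ?case unfolding l using d by (simp del: of_nat_diff)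
  qed
  then show "degree ((pderiv ^^ k) (root_poly n x)) = n - k"
    and "1 \<le> cmod (lead_coeff ((pderiv ^^ k) (root_poly n x)))"
    and "cmod (lead_coeff ((pderiv ^^ k) (root_poly n x))) \<le> real n ^ k" by (auto simp: p_def)
qed

lemma higher_pderiv_root_poly_nonzero: "k \<le> n \<Longrightarrow> (pderiv ^^ k) (root_poly n x) \<noteq> 0"
  using higher_pderiv_root_poly_degree(2)[of k n x] by auto

subsection \<open>Uniform integrability of the logarithmic ratio\<close>

text \<open>The positive part of ln |z|, in the shape in which Jensen's formula on the unit circle
  produces it.\<close>

definition log_height :: "complex \<Rightarrow> real" where
  "log_height z = ln (max 1 (cmod z))"

lemma log_height_nonneg: "log_height z \<ge> 0"
  by (simp add: log_height_def)

lemma ln_add_cmod_le: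
  assumes "c \<ge> 0"
  shows "ln (c + cmod z) \<le> ln (c + 1) + log_height z"
proof (cases "c + cmod z = 0")
  case True
  then show ?thesis using assms log_height_nonneg[of z] by simp
next
  case False
  then have p: "c + cmod z > 0" using assms by (simp add: less_le add_nonneg_nonneg)
  have "c + cmod z \<le> (c + 1) * max 1 (cmod z)"
    using assms mult_left_mono[of 1 "cmod z" c] by (auto simp: max_def algebra_simps)
  then have "ln (c + cmod z) \<le> ln ((c + 1) * max 1 (cmod z))" using p by (intro ln_mono) auto
  also have "\<dots> = ln (c + 1) + log_height z"
    unfolding log_height_def using assms by (intro ln_mult_pos) auto
  finally show ?thesis .
qed

lemma sum_mset_nonneg:
  fixes f :: "'a \<Rightarrow> real"
  shows "(\<And>x. x \<in># A \<Longrightarrow> 0 \<le> f x) \<Longrightarrow> 0 \<le> (\<Sum>x\<in>#A. f x)"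
  by (induction A) auto

lemma sum_mset_sum: "(\<Sum>x\<in>#image_mset f (mset_set A). g x) = (\<Sum>i\<in>A. g (f i))"
  by (simp add: sum_unfold_sum_mset image_mset.compositionality o_def)

text \<open>Jensen's formula on the unit circle; the derivative is controlled there by its
  Taylor coefficients.\<close>
lemma log_height_roots_higher_pderiv:
  assumes k: "k \<le> n"
  shows "(\<Sum>x\<in>#proots ((pderiv ^^ k) (root_poly n x)). log_height x) \<le>
           ln (fact k) + (\<Sum>j=1..n. ln 3 + log_height (x j))"
proof -
  define p where "p = (pderiv ^^ k) (root_poly n x)"
  define B where "B = ln (fact k) + (\<Sum>j=1..n. ln (2 + cmod (x j)))"
  have B0: "B \<ge> 0" unfolding B_def by (intro add_nonneg_nonneg sum_nonneg ln_ge_zero) auto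
  have p: "p \<noteq> 0" unfolding p_def by (rule higher_pderiv_root_poly_nonzero[OF k])
  have lead: "1 \<le> cmod (lead_coeff p)" unfolding p_def by (rule higher_pderiv_root_poly_degree[OF k])
  have le: "ln (cmod (poly p z)) \<le> B" if z: "cmod z = 1" for z
  proof (cases "poly p z = 0")
    case False
    have "cmod (poly p z) = fact k * cmod (coeff (\<Prod>j=1..n. [:z - x j, 1:]) k)"
      unfolding p_def poly_higher_pderiv root_poly_shift by (simp add: norm_mult)
    also have "\<dots> \<le> fact k * (\<Prod>j=1..n. 1 + cmod (z - x j))"
      by (intro mult_left_mono norm_coeff_prod_monic_le) auto
    also have "\<dots> \<le> fact k * (\<Prod>j=1..n. 2 + cmod (x j))"
    proof (intro mult_left_mono prod_mono conjI)
      fix j show "1 + cmod (z - x j) \<le> 2 + cmod (x j)"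
        using norm_triangle_ineq4[of z "x j"] z by simp
    qed auto
    finally have "ln (cmod (poly p z)) \<le> ln (fact k * (\<Prod>j=1..n. 2 + cmod (x j)))"
      using False by (intro ln_mono) auto
    also have "\<dots> = ln (fact k) + ln (\<Prod>j=1..n. 2 + cmod (x j))"
      by (intro ln_mult_pos prod_pos) (auto intro: add_pos_nonneg)
    also have "ln (\<Prod>j=1..n. 2 + cmod (x j)) = (\<Sum>j=1..n. ln (2 + cmod (x j)))"
    proof (rule ln_prod)
      fix j
      have "2 + cmod (x j) > 0" by (simp add: add_pos_nonneg)
      then show "2 + cmod (x j) \<noteq> 0" by linarith
    qed auto
    finally show ?thesis by (simp add: B_def)
  qed (use B0 in simp)
  have "(\<Sum>y\<in>#proots p. log_height y) \<le> ln (cmod (lead_coeff p)) + (\<Sum>y\<in>#proots p. log_height y)"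
    using lead by simp
  also have "\<dots> = (LINT t|unit_interval. ln (cmod (poly p (circ 0 1 t))))"
    using Jensen_poly(2)[OF p, of 1 0] by (simp add: log_height_def)
  also have "\<dots> \<le> (LINT t|unit_interval. B)"
    by (intro integral_mono Jensen_poly(1)[OF p] le) (auto simp: circ_def)
  also have "\<dots> = B" by (simp add: UI.prob_space)
  also have "\<dots> \<le> ln (fact k) + (\<Sum>j=1..n. ln 3 + log_height (x j))"
    unfolding B_def using ln_add_cmod_le[of 2] by (intro add_left_mono sum_mono) auto
  finally show ?thesis by (simp add: p_def)
qed

text \<open>Up to the leading coefficient, the difference of the logarithmic potentials of the two
  root multisets. Both are divided by n, although the derivative has only n - k roots.\<close>

definition log_ratio :: "nat \<Rightarrow> nat \<Rightarrow> (nat \<Rightarrow> complex) \<Rightarrow> complex \<Rightarrow> real" where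
  "log_ratio k n x z =
     (ln (cmod (poly ((pderiv ^^ k) (root_poly n x)) z)) - ln (cmod (poly (root_poly n x) z))) / real n"

text \<open>Each root costs a constant, its height and its \<open>log_tail\<close>. On a bounded set
  of z only the last sum is unbounded, and its circle mean is at most the number of roots times
  \<delta>/r.\<close>

lemma abs_ln_cmod_poly_le:
  fixes p :: "complex poly"
  assumes \<delta>: "0 < \<delta>" "\<delta> < 1" and z: "cmod z \<le> R" and lead: "1 \<le> cmod (lead_coeff p)"
  shows "\<bar>ln (cmod (poly p z))\<bar> \<le> ln (cmod (lead_coeff p)) +
     real (size (proots p)) * (ln (1 + R) + ln 2 + ln (1 / \<delta>)) +
     (\<Sum>x\<in>#proots p. log_height x) + (\<Sum>x\<in>#proots p. log_tail \<delta> (z - x))"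
proof -
  have R: "R \<ge> 0" using z norm_ge_zero order.trans by blast
  define h where "h x = ln (1 + R) + ln 2 + ln (1 / \<delta>) + log_height x + log_tail \<delta> (z - x)" for x
  have h: "\<bar>ln (cmod (z - x))\<bar> \<le> h x" for x
  proof -
    have "ln (1 + cmod z) \<le> ln (1 + R)" using z by (intro ln_mono) (auto simp: add_pos_nonneg)
    then show ?thesis
      using abs_ln_cmod_diff_le[OF \<delta>, of z x] ln_add_cmod_le[of 1 x] by (simp add: h_def)
  qed
  have h0: "h x \<ge> 0" for x using h[of x] by linarith
  have s0: "(\<Sum>x\<in>#A. h x) \<ge> 0" for A by (intro sum_mset_nonneg) (auto simp: h0)
  have "\<bar>ln (cmod (poly p z))\<bar> \<le> ln (cmod (lead_coeff p)) + (\<Sum>x\<in>#proots p. h x)"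
  proof (cases "poly p z = 0")
    \<comment> \<open>At a root the left side is 0 by \<open>ln 0 = 0\<close>, so the bound needs
      only a nonnegative right side.\<close>
    case True
    then show ?thesis using lead s0 by simp
  next
    case False
    have "\<bar>\<Sum>x\<in>#A. ln (cmod (z - x))\<bar> \<le> (\<Sum>x\<in>#A. h x)" for A
    proof (induction A)
      case (add x A)
      then show ?case using h[of x] by simp
    qed simp
    from this[of "proots p"] have "\<bar>\<Sum>x\<in>#proots p. ln (cmod (z - x))\<bar> \<le> (\<Sum>x\<in>#proots p. h x)" .
    moreover have "0 \<le> ln (cmod (lead_coeff p))" using lead by simp
    ultimately show ?thesis unfolding ln_cmod_poly[OF False] by linarith
  qed
  also have "(\<Sum>x\<in>#A. h x) = real (size A) * (ln (1 + R) + ln 2 + ln (1 / \<delta>)) +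
     (\<Sum>x\<in>#A. log_height x) + (\<Sum>x\<in>#A. log_tail \<delta> (z - x))" for A
    by (induction A) (simp_all add: h_def algebra_simps)
  finally show ?thesis by simp
qed

text \<open>Splitting the mean of \<open>|f|\<close> according to whether \<open>|f| > \<epsilon>\<close>.\<close>
lemma mean_abs_le:
  fixes f T :: "real \<Rightarrow> real"
  assumes f: "integrable unit_interval f" and T: "integrable unit_interval T" "\<And>t. T t \<ge> 0"
    and K: "K \<ge> 0" and \<epsilon>: "\<epsilon> \<ge> 0" and le: "\<And>t. \<bar>f t\<bar> \<le> K + T t"
  shows "(LINT t|unit_interval. \<bar>f t\<bar>) \<le>
     \<epsilon> + K * measure unit_interval {t\<in>space unit_interval. \<bar>f t\<bar> > \<epsilon>} + (LINT t|unit_interval. T t)"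
proof -
  define S where "S = {t\<in>space unit_interval. \<bar>f t\<bar> > \<epsilon>}"
  have [measurable]: "f \<in> borel_measurable unit_interval" using f by simp
  have S: "S \<in> sets unit_interval" unfolding S_def by measurable
  have i: "integrable unit_interval (\<lambda>t. K * indicator S t :: real)"
    using S by (intro integrable_mult_right) (auto simp: integrable_indicator_iff UI.emeasure_eq_measure)
  have "(LINT t|unit_interval. \<bar>f t\<bar>) \<le> (LINT t|unit_interval. \<epsilon> + K * indicator S t + T t)"
  proof (rule integral_mono)
    fix t assume t: "t \<in> space unit_interval"
    show "\<bar>f t\<bar> \<le> \<epsilon> + K * indicator S t + T t"
      using le[of t] T(2)[of t] \<epsilon> t by (cases "t \<in> S") (auto simp: S_def)
  qed (use f T i in auto)
  also have "\<dots> = \<epsilon> + K * measure unit_interval S + (LINT t|unit_interval. T t)"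
    using T i S by (simp add: UI.prob_space)
  finally show ?thesis by (simp add: S_def)
qed

text \<open>Uniform integrability for arbitrary roots of bounded mean height: the factor before the
  measure does not depend on n or on the roots, and the remaining term is small with
  \<open>\<delta>\<close>. Convergence in measure of \<open>log_ratio\<close> therefore yields
  convergence of its mean modulus.\<close>

lemma mean_log_ratio_le:
  assumes k: "k \<le> n" and n: "n > 0" and r: "r > 0" and c: "cmod c + r \<le> R"
    and x: "(\<Sum>j=1..n. log_height (x j)) \<le> C * real n" and \<delta>: "0 < \<delta>" "\<delta> < 1" and \<epsilon>: "\<epsilon> \<ge> 0"
  shows "integrable unit_interval (\<lambda>t. log_ratio k n x (circ c r t))"
    and "(LINT t|unit_interval. \<bar>log_ratio k n x (circ c r t)\<bar>) \<le>
       \<epsilon> + (real k + 2 * (ln (1 + R) + ln 2 + ln (1 / \<delta>)) + ln (fact k) + ln 3 + 2 * C) *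
           measure unit_interval {t\<in>space unit_interval. \<bar>log_ratio k n x (circ c r t)\<bar> > \<epsilon>} +
       2 * (\<delta> / r)"
proof -
  define p where "p = root_poly n x"
  define q where "q = (pderiv ^^ k) p"
  have p: "p \<noteq> 0" by (simp add: p_def root_poly_nonzero)
  have q: "q \<noteq> 0" by (simp add: p_def q_def higher_pderiv_root_poly_nonzero k)
  have G: "log_ratio k n x z = (ln (cmod (poly q z)) - ln (cmod (poly p z))) / real n" for z
    by (simp add: log_ratio_def p_def q_def)
  show int: "integrable unit_interval (\<lambda>t. log_ratio k n x (circ c r t))"
    unfolding G using Jensen_poly(1)[OF p r] Jensen_poly(1)[OF q r] by auto
  define T where "T A t = (\<Sum>y\<in>#A. log_tail \<delta> (circ c r t - y))" for A t
  have T: "integrable unit_interval (T A)" "T A t \<ge> 0"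
    "(LINT t|unit_interval. T A t) \<le> real (size A) * (\<delta> / r)" for A t
  proof -
    note S = integral_sum_mset[of unit_interval "\<lambda>y t. log_tail \<delta> (circ c r t - y)",
      OF log_tail_mean(1)[OF r \<delta>(1)]]
    show "integrable unit_interval (T A)" unfolding T_def by (rule S)
    show "T A t \<ge> 0" unfolding T_def by (intro sum_mset_nonneg) (auto simp: log_tail_nonneg)
    have "(LINT t|unit_interval. T A t) \<le> (\<Sum>y\<in>#A. \<delta> / r)"
      unfolding T_def S(2) by (intro sum_mset_mono log_tail_mean r \<delta>)
    then show "(LINT t|unit_interval. T A t) \<le> real (size A) * (\<delta> / r)" by simp
  qed
  define U where "U t = (T (proots q) t + T (proots p) t) / real n" for t
  define \<Lambda> where "\<Lambda> = ln (1 + R) + ln 2 + ln (1 / \<delta>)"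
  \<comment> \<open>The term \<open>real k\<close> bounds the leading coefficient of the derivative,
    by ln n <= n. Each of the two polynomials contributes one \<open>\<Lambda>\<close> and one
    \<open>C\<close>; \<open>ln (fact k) + ln 3\<close> comes from the heights of the roots of the
    derivative.\<close>
  define K where "K = real k + 2 * \<Lambda> + ln (fact k) + ln 3 + 2 * C"
  have R: "R \<ge> 0" using c r norm_ge_zero[of c] by linarith
  have \<Lambda>: "\<Lambda> \<ge> 0" unfolding \<Lambda>_def using R \<delta> by (intro add_nonneg_nonneg ln_ge_zero) auto
  have size: "size (proots p) = n" "size (proots q) = n - k"
    unfolding size_proots_complex by (simp_all add: p_def q_def degree_root_poly higher_pderiv_root_poly_degree k)
  have sump: "(\<Sum>y\<in>#proots p. log_height y) = (\<Sum>j=1..n. log_height (x j))"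
    by (simp add: p_def proots_root_poly sum_mset_sum)
  then have sump0: "0 \<le> (\<Sum>j=1..n. log_height (x j))"
    by (intro sum_nonneg) (auto simp: log_height_nonneg)
  then have C0: "C \<ge> 0" using x n by (metis mult_less_0_iff not_less of_nat_0_less_iff order.trans)
  have le: "\<bar>log_ratio k n x (circ c r t)\<bar> \<le> K + U t" for t
  proof -
    define z where "z = circ c r t"
    have z: "cmod z \<le> R"
      using norm_triangle_ineq[of c "of_real r * cis (2 * pi * t)"] c r by (simp add: z_def circ_def norm_mult)
    have lead_q: "1 \<le> cmod (lead_coeff q)" "cmod (lead_coeff q) \<le> real n ^ k"
      unfolding q_def p_def by (rule higher_pderiv_root_poly_degree[OF k])+
    have "ln (cmod (lead_coeff q)) \<le> ln (real n ^ k)" using lead_q by (intro ln_mono) auto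
    also have "\<dots> = real k * ln (real n)" using n by (simp add: ln_realpow)
    also have "\<dots> \<le> real k * real n" using n ln_le_minus_one[of "real n"] by (intro mult_left_mono) auto
    finally have lq: "ln (cmod (lead_coeff q)) \<le> real k * real n" .
    have "\<bar>ln (cmod (poly q z))\<bar> \<le> real k * real n + real (n - k) * \<Lambda> +
        (ln (fact k) + (\<Sum>j=1..n. ln 3 + log_height (x j))) + T (proots q) t"
      using abs_ln_cmod_poly_le[OF \<delta> z lead_q(1)] lq
        log_height_roots_higher_pderiv[OF k, of x, folded p_def, folded q_def]
      unfolding T_def z_def size \<Lambda>_def by linarith
    also have "real (n - k) * \<Lambda> \<le> real n * \<Lambda>" using \<Lambda> by (intro mult_right_mono) auto
    also have "(\<Sum>j=1..n. ln 3 + log_height (x j)) \<le> ln 3 * real n + C * real n"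
      using x by (simp add: sum.distrib)
    also have "ln (fact k) \<le> ln (fact k) * real n"
      using n mult_left_mono[of 1 "real n" "ln (fact k)"] by (simp add: ln_ge_zero)
    finally have 1: "\<bar>ln (cmod (poly q z))\<bar> \<le> real k * real n + real n * \<Lambda> +
        (ln (fact k) * real n + (ln 3 * real n + C * real n)) + T (proots q) t" by simp
    have lead_p: "lead_coeff p = 1" unfolding p_def by (rule lead_coeff_root_poly)
    have "\<bar>ln (cmod (poly p z))\<bar> \<le> real n * \<Lambda> + C * real n + T (proots p) t"
      using abs_ln_cmod_poly_le[OF \<delta> z, of p] x
      unfolding lead_p size sump T_def z_def \<Lambda>_def by simp
    with 1 have "\<bar>ln (cmod (poly q z)) - ln (cmod (poly p z))\<bar> \<le>
        K * real n + (T (proots q) t + T (proots p) t)"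
      unfolding K_def by (simp add: algebra_simps)
    then have "\<bar>ln (cmod (poly q z)) - ln (cmod (poly p z))\<bar> / real n \<le>
        (K * real n + (T (proots q) t + T (proots p) t)) / real n"
      by (rule divide_right_mono) simp
    also have "\<dots> = K + U t" using n by (simp add: U_def add_divide_distrib)
    finally show ?thesis unfolding G z_def using n by (simp add: abs_divide)
  qed
  have "(LINT t|unit_interval. \<bar>log_ratio k n x (circ c r t)\<bar>) \<le>
     \<epsilon> + K * measure unit_interval {t\<in>space unit_interval. \<bar>log_ratio k n x (circ c r t)\<bar> > \<epsilon>} +
     (LINT t|unit_interval. U t)"
  proof (rule mean_abs_le[OF int _ _ _ \<epsilon> le])
    show "integrable unit_interval U" unfolding U_def using T by auto
    show "U t \<ge> 0" for t unfolding U_def using T by auto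
    show "K \<ge> 0" unfolding K_def using \<Lambda> C0 by (intro add_nonneg_nonneg ln_ge_zero) auto
  qed
  also have "(LINT t|unit_interval. U t) \<le> 2 * (\<delta> / r)"
  proof -
    have "(LINT t|unit_interval. U t) =
        ((LINT t|unit_interval. T (proots q) t) + (LINT t|unit_interval. T (proots p) t)) / real n"
      unfolding U_def using T by simp
    also have "\<dots> \<le> (real n * (\<delta> / r) + real n * (\<delta> / r)) / real n"
    proof (intro divide_right_mono add_mono)
      have "real (n - k) * (\<delta> / r) \<le> real n * (\<delta> / r)" using \<delta> r by (intro mult_right_mono) auto
      then show "(LINT t|unit_interval. T (proots q) t) \<le> real n * (\<delta> / r)"
        using T(3)[of "proots q"] unfolding size by linarith
      show "(LINT t|unit_interval. T (proots p) t) \<le> real n * (\<delta> / r)"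
        using T(3)[of "proots p"] unfolding size .
    qed simp
    also have "\<dots> = 2 * (\<delta> / r)" using n by (simp add: field_simps)
    finally show ?thesis .
  qed
  finally show "(LINT t|unit_interval. \<bar>log_ratio k n x (circ c r t)\<bar>) \<le>
       \<epsilon> + (real k + 2 * (ln (1 + R) + ln 2 + ln (1 / \<delta>)) + ln (fact k) + ln 3 + 2 * C) *
           measure unit_interval {t\<in>space unit_interval. \<bar>log_ratio k n x (circ c r t)\<bar> > \<epsilon>} +
       2 * (\<delta> / r)"
    by (simp add: K_def \<Lambda>_def)
qed

subsection \<open>Logarithmic ratios for two-valued root arrays\<close>

lemma pavg_integral:
  assumes "\<And>S. S \<subseteq> B \<Longrightarrow> integrable M (f S)"
  shows "integrable M (\<lambda>t. pavg B (\<lambda>S. f S t))"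
    and "pavg B (\<lambda>S. LINT t|M. f S t) = (LINT t|M. pavg B (\<lambda>S. f S t))"
  unfolding pavg_def using assms by (auto intro!: integrable_divide Bochner_Integration.integrable_sum)

text \<open>Markov's inequality for the heights.\<close>

lemma card_log_height_gt:
  fixes x :: "nat \<Rightarrow> complex"
  assumes "(\<Sum>i=1..n. log_height (x i)) \<le> D" and "H > 0"
  shows "real (card {i\<in>{1..n}. cmod (x i) > exp H}) * H \<le> D"
proof -
  have "real (card {i\<in>{1..n}. cmod (x i) > exp H}) * H = (\<Sum>i\<in>{i\<in>{1..n}. cmod (x i) > exp H}. H)"
    by simp
  also have "\<dots> \<le> (\<Sum>i\<in>{i\<in>{1..n}. cmod (x i) > exp H}. log_height (x i))"
  proof (rule sum_mono)
    fix i assume "i \<in> {i\<in>{1..n}. cmod (x i) > exp H}"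
    then have "ln (exp H) \<le> ln (max 1 (cmod (x i)))" by (intro ln_mono) auto
    then show "H \<le> log_height (x i)" by (simp add: log_height_def)
  qed
  also have "\<dots> \<le> (\<Sum>i=1..n. log_height (x i))"
    by (rule sum_mono2) (auto simp: log_height_nonneg)
  finally show ?thesis using assms by simp
qed

text \<open>The deterministic hypotheses in quantitative form. \<open>separated\<close> is Markov's
  inequality applied to the o(n^2) condition: an index with gap below exp(-\<epsilon>n) contributes
  more than \<epsilon>n to the sum.\<close>

locale array_pair =
  fixes a b :: "nat \<Rightarrow> nat \<Rightarrow> complex" and C :: real
  assumes height_a: "\<And>n. n \<ge> 1 \<Longrightarrow> (\<Sum>i=1..n. log_height (a n i)) \<le> C * real n"
    and height_b: "\<And>n. n \<ge> 1 \<Longrightarrow> (\<Sum>i=1..n. log_height (b n i)) \<le> C * real n"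
    and separated: "\<And>\<epsilon> \<theta>. \<epsilon> > 0 \<Longrightarrow> \<theta> > 0 \<Longrightarrow> \<forall>\<^sub>F n in sequentially.
       real (card {i\<in>{1..n}. cmod (a n i - b n i) < exp (- (\<epsilon> * real n))}) \<le> \<theta> * real n"
begin

definition choice :: "nat \<Rightarrow> nat set \<Rightarrow> nat \<Rightarrow> complex" where
  "choice n S i = (if i \<in> S then a n i else b n i)"

abbreviation choice_roots :: "nat \<Rightarrow> nat \<Rightarrow> nat set \<Rightarrow> complex multiset" where
  "choice_roots k n S \<equiv> proots ((pderiv ^^ k) (root_poly n (choice n S)))"

lemma C_nonneg: "C \<ge> 0"
  using height_a[of 1] log_height_nonneg[of "a 1 1"] by simp

lemma height_choice:
  assumes "n \<ge> 1"
  shows "(\<Sum>i=1..n. log_height (choice n S i)) \<le> (2 * C) * real n"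
proof -
  have "(\<Sum>i=1..n. log_height (choice n S i)) \<le> (\<Sum>i=1..n. log_height (a n i) + log_height (b n i))"
    by (intro sum_mono) (auto simp: choice_def log_height_nonneg)
  also have "\<dots> \<le> (2 * C) * real n"
    using height_a[OF assms] height_b[OF assms] by (simp add: sum.distrib)
  finally show ?thesis .
qed

text \<open>Away from the array the reciprocals are at most exp(en), so the symmetric polynomial is
  at most (n exp(en))^k for every choice. For the lower bound, the two reciprocals at an index
  differ by (a - b)/((z - a)(z - b)), which is at least exp(-en) up to a constant for half of the
  indices, and anticoncentration applies. The allowed distance \<open>e\<close> does not depend on
  \<open>\<eta>\<close>.\<close>

lemma log_ratio_small_pointwise:
  assumes \<epsilon>: "\<epsilon> > 0" and \<eta>: "\<eta> > 0" and R: "R \<ge> 0"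
  shows "\<exists>e>0. \<forall>\<^sub>F n in sequentially. \<forall>z. cmod z \<le> R \<longrightarrow>
     (\<forall>i\<in>{1..n}. exp (- (e * real n)) \<le> cmod (z - a n i) \<and> exp (- (e * real n)) \<le> cmod (z - b n i)) \<longrightarrow>
     pavg {1..n} (\<lambda>S. of_bool (\<bar>log_ratio k n (choice n S) z\<bar> > \<epsilon>)) \<le> \<eta>"
proof -
  \<comment> \<open>Both bounds cost k e n in the exponent, which may use half of \<epsilon>n; the
    other half absorbs the terms of order ln n.\<close>
  define e where "e = \<epsilon> / (2 * (real k + 1))"
  have e: "e > 0" "real k * e \<le> \<epsilon> / 2"
    using \<epsilon> by (auto simp: e_def field_simps)
  obtain N0 where N0: "\<And>(B :: nat set) p q \<tau> C. finite B \<Longrightarrow> card B \<ge> N0 \<Longrightarrow> \<tau> > 0 \<Longrightarrow>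
           (\<forall>i\<in>B. cmod (p i - q i) \<ge> \<tau>) \<Longrightarrow>
           pavg B (\<lambda>S. of_bool (cmod (coeff (C * (\<Prod>i\<in>B. [:1, if i \<in> S then p i else q i:])) k)
              < cmod (coeff C 0) * (\<tau> / 8) ^ k)) \<le> \<eta>"
    using coeff_prod_anticoncentration[OF \<eta>] by blast
  \<comment> \<open>At most n/8 entries of each array exceed exp H in modulus. Together with the n/4
    indices of small gap, this leaves at least n/2 good indices.\<close>
  define H where "H = 8 * C + 1"
  have H: "H > 0" using C_nonneg by (simp add: H_def)
  define Q where "Q = exp H"
  have Q: "Q > 0" by (simp add: Q_def)
  \<comment> \<open>Chosen so that \<open>\<tau> / 8 = E / W\<close> below.\<close>
  define W where "W = 8 * (R + Q)\<^sup>2"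
  have W: "W > 0" using Q R by (simp add: W_def)
  have ev: "\<forall>\<^sub>F n in sequentially. (ln (fact k) + real k * ln (real n) + real k * \<bar>ln W\<bar>) / real n < \<epsilon> / 2"
  proof (rule order_tendstoD)
    show "(\<lambda>n. (ln (fact k) + real k * ln (real n) + real k * \<bar>ln W\<bar>) / real n) \<longlonglongrightarrow> 0"
      by real_asymp
  qed (use \<epsilon> in simp)
  have "\<forall>\<^sub>F n in sequentially. \<forall>z. cmod z \<le> R \<longrightarrow>
     (\<forall>i\<in>{1..n}. exp (- (e * real n)) \<le> cmod (z - a n i) \<and> exp (- (e * real n)) \<le> cmod (z - b n i)) \<longrightarrow>
     pavg {1..n} (\<lambda>S. of_bool (\<bar>log_ratio k n (choice n S) z\<bar> > \<epsilon>)) \<le> \<eta>"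
    using separated[OF e(1), of "1/4", simplified] ev eventually_ge_at_top[of "2 * N0 + 1"]
  proof eventually_elim
    case (elim n)
    show ?case
    proof (intro allI impI)
      fix z assume z: "cmod z \<le> R" and
        zab: "\<forall>i\<in>{1..n}. exp (- (e * real n)) \<le> cmod (z - a n i) \<and> exp (- (e * real n)) \<le> cmod (z - b n i)"
      have n: "n \<ge> 1" using elim by simp
      define E where "E = exp (- (e * real n))"
      define \<tau> where "\<tau> = E / (R + Q)\<^sup>2"
      have \<tau>: "\<tau> > 0" using Q R by (simp add: \<tau>_def E_def)
      define B where "B = {i\<in>{1..n}. cmod (a n i - b n i) \<ge> E \<and> cmod (a n i) \<le> Q \<and> cmod (b n i) \<le> Q}"
      define p where "p i = 1 / (z - a n i)" for i
      define q where "q i = 1 / (z - b n i)" for i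
      have cardB: "card B \<ge> N0"
      proof -
        define X where "X = {i\<in>{1..n}. cmod (a n i - b n i) < E}"
        define Y where "Y = {i\<in>{1..n}. cmod (a n i) > Q}"
        define Z where "Z = {i\<in>{1..n}. cmod (b n i) > Q}"
        have "{1..n} \<subseteq> B \<union> (X \<union> (Y \<union> Z))" by (auto simp: B_def X_def Y_def Z_def)
        then have "card {1..n} \<le> card (B \<union> (X \<union> (Y \<union> Z)))"
          by (intro card_mono) (auto simp: B_def X_def Y_def Z_def)
        also have "\<dots> \<le> card B + (card X + (card Y + card Z))"
          by (meson add_left_mono card_Un_le order.trans)
        finally have 1: "real n \<le> real (card B) + (real (card X) + (real (card Y) + real (card Z)))"
          by (simp flip: of_nat_add)
        have 2: "real (card X) \<le> real n / 4"
          using elim(1) by (simp add: X_def E_def)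
        have "y \<le> real n / 8" if "y * H \<le> C * real n" for y
        proof -
          have "C * real n \<le> (real n / 8) * H" by (simp add: H_def algebra_simps)
          then have "y * H \<le> (real n / 8) * H" using that by simp
          then show ?thesis using H by simp
        qed
        then have 3: "real (card Y) \<le> real n / 8" "real (card Z) \<le> real n / 8"
          using card_log_height_gt[OF height_a[OF n] H] card_log_height_gt[OF height_b[OF n] H]
          unfolding Y_def Z_def Q_def by blast+
        have "real N0 \<le> real n / 2" using elim(3) by linarith
        then show ?thesis using 1 2 3 by simp
      qed
      have pq: "cmod (p i - q i) \<ge> \<tau>" if i: "i \<in> B" for i
      proof -
        have "cmod (z - a n i) \<ge> E" "cmod (z - b n i) \<ge> E" using zab i by (auto simp: B_def E_def)
        moreover have "E > 0" by (simp add: E_def)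
        ultimately have nz: "cmod (z - a n i) > 0" "cmod (z - b n i) > 0" by linarith+
        then have "p i - q i = (a n i - b n i) / ((z - a n i) * (z - b n i))"
          by (simp add: p_def q_def divide_simps)
        then have "cmod (p i - q i) = cmod (a n i - b n i) / (cmod (z - a n i) * cmod (z - b n i))"
          by (simp add: norm_divide norm_mult)
        moreover have "cmod (z - a n i) \<le> R + Q" "cmod (z - b n i) \<le> R + Q"
          using norm_triangle_ineq4[of z "a n i"] norm_triangle_ineq4[of z "b n i"] z i by (auto simp: B_def)
        then have "cmod (z - a n i) * cmod (z - b n i) \<le> (R + Q)\<^sup>2"
          unfolding power2_eq_square using Q R by (intro mult_mono) auto
        then have "E / (R + Q)\<^sup>2 \<le> cmod (a n i - b n i) / (cmod (z - a n i) * cmod (z - b n i))"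
          using i nz by (intro frac_le) (auto simp: B_def)
        ultimately show ?thesis by (simp add: \<tau>_def)
      qed
      define L where "L S = coeff (\<Prod>i=1..n. [:1, 1 / (z - choice n S i):]) k" for S
      have small: "\<bar>log_ratio k n (choice n S) z\<bar> \<le> \<epsilon>" if S: "\<not> cmod (L S) < (\<tau> / 8) ^ k" for S
      proof -
        have far: "E \<le> cmod (z - choice n S i)" if "i \<in> {1..n}" for i
          using zab that by (auto simp: choice_def E_def)
        have E0: "E > 0" by (simp add: E_def)
        have ne: "z \<noteq> choice n S i" if i: "i \<in> {1..n}" for i
        proof
          assume "z = choice n S i"
          then show False using far[OF i] E0 by simp
        qed
        have P0: "poly (root_poly n (choice n S)) z \<noteq> 0" using ne by (auto simp: poly_root_poly)
        have L0: "0 < (\<tau> / 8) ^ k" "(\<tau> / 8) ^ k \<le> cmod (L S)" using S \<tau> by auto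
        then have Lp: "cmod (L S) > 0" by linarith
        have "ln (cmod (poly ((pderiv ^^ k) (root_poly n (choice n S))) z)) =
              ln (fact k) + ln (cmod (poly (root_poly n (choice n S)) z)) + ln (cmod (L S))"
          using higher_pderiv_root_poly[of n z "choice n S" k, OF ne] P0 Lp
          by (simp add: L_def norm_mult ln_mult)
        then have lr: "log_ratio k n (choice n S) z = (ln (fact k) + ln (cmod (L S))) / real n"
          by (simp add: log_ratio_def)
        have "cmod (L S) \<le> (real (card {1..n}) * (1 / E)) ^ k"
          unfolding L_def
        proof (intro norm_coeff_prod_linear_le)
          fix i assume i: "i \<in> {1..n}"
          show "cmod (1 / (z - choice n S i)) \<le> 1 / E"
            using far[OF i] E0 unfolding norm_divide by (intro frac_le) auto
        qed (use E0 in auto)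
        then have "ln (cmod (L S)) \<le> ln ((real n * (1 / E)) ^ k)" using Lp by (intro ln_mono) auto
        also have "\<dots> = real k * (ln (real n) + e * real n)"
          using n E0 by (simp add: ln_realpow ln_div E_def)
        finally have up: "ln (cmod (L S)) \<le> real k * ln (real n) + real k * e * real n"
          by (simp add: algebra_simps)
        have "ln (\<tau> / 8) = - (e * real n) - ln W"
          using Q R unfolding \<tau>_def W_def E_def by (simp add: ln_div ln_mult)
        then have "real k * (- (e * real n) - ln W) = ln ((\<tau> / 8) ^ k)"
          using \<tau> by (simp add: ln_realpow)
        also have "\<dots> \<le> ln (cmod (L S))" using L0 by (intro ln_mono) auto
        finally have lo: "- (real k * e * real n) - real k * ln W \<le> ln (cmod (L S))"
          by (simp add: algebra_simps)
        have W': "real k * ln W \<le> real k * \<bar>ln W\<bar>" "0 \<le> real k * \<bar>ln W\<bar>" by (auto intro: mult_left_mono)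
        have ken: "real k * e * real n \<le> \<epsilon> / 2 * real n" using e by (intro mult_right_mono) auto
        have nn: "0 \<le> ln (fact k :: real)" "0 \<le> real k * ln (real n)" using n by (auto simp: ln_ge_zero)
        have sm: "ln (fact k) + real k * ln (real n) + real k * \<bar>ln W\<bar> \<le> \<epsilon> / 2 * real n"
          using elim(2) n by (simp add: field_simps)
        have "\<bar>ln (fact k) + ln (cmod (L S))\<bar> \<le> \<epsilon> * real n"
          using up lo W' ken nn sm by linarith
        then show ?thesis unfolding lr using n by (simp add: abs_divide divide_le_eq)
      qed
      \<comment> \<open>Coins at bad indices are frozen. Their factors form the cofactor, whose
        constant coefficient is 1.\<close>
      define D where "D = {1..n} - B"
      have DB: "{1..n} = D \<union> B" "D \<inter> B = {}" "finite D" "finite B"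
        by (auto simp: D_def B_def)
      have "pavg {1..n} (\<lambda>S. of_bool (\<bar>log_ratio k n (choice n S) z\<bar> > \<epsilon>)) \<le>
            pavg {1..n} (\<lambda>S. of_bool (cmod (L S) < (\<tau> / 8) ^ k))"
        using small by (intro pavg_mono) (auto simp: not_le[symmetric])
      also have "\<dots> = pavg D (\<lambda>S. pavg B (\<lambda>T. of_bool (cmod (L (S \<union> T)) < (\<tau> / 8) ^ k)))"
        unfolding DB(1) by (rule pavg_Un) (use DB in auto)
      also have "\<dots> \<le> \<eta>"
      proof (rule pavg_le_const[OF DB(3)])
        fix S assume S: "S \<subseteq> D"
        define c where "c = (\<Prod>i\<in>D. [:1, 1 / (z - choice n S i):])"
        have "L (S \<union> T) = coeff (c * (\<Prod>i\<in>B. [:1, if i \<in> T then p i else q i:])) k" if T: "T \<subseteq> B" for T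
        proof -
          have "(\<Prod>i=1..n. [:1, 1 / (z - choice n (S \<union> T) i):]) =
            (\<Prod>i\<in>D. [:1, 1 / (z - choice n (S \<union> T) i):]) * (\<Prod>i\<in>B. [:1, 1 / (z - choice n (S \<union> T) i):])"
            unfolding DB(1) by (rule prod.union_disjoint) (use DB in auto)
          also have "(\<Prod>i\<in>D. [:1, 1 / (z - choice n (S \<union> T) i):]) = c"
            unfolding c_def using DB T by (intro prod.cong) (auto simp: choice_def)
          also have "(\<Prod>i\<in>B. [:1, 1 / (z - choice n (S \<union> T) i):]) = (\<Prod>i\<in>B. [:1, if i \<in> T then p i else q i:])"
            using DB S by (intro prod.cong) (auto simp: choice_def p_def q_def)
          finally show ?thesis unfolding L_def by simp
        qed
        then have "pavg B (\<lambda>T. of_bool (cmod (L (S \<union> T)) < (\<tau> / 8) ^ k)) =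
            pavg B (\<lambda>T. of_bool (cmod (coeff (c * (\<Prod>i\<in>B. [:1, if i \<in> T then p i else q i:])) k)
              < cmod (coeff c 0) * (\<tau> / 8) ^ k))"
          by (intro pavg_cong) (simp add: c_def coeff_prod_linear_0)
        also have "\<dots> \<le> \<eta>" using DB cardB \<tau> pq by (intro N0) auto
        finally show "pavg B (\<lambda>T. of_bool (cmod (L (S \<union> T)) < (\<tau> / 8) ^ k)) \<le> \<eta>" .
      qed
      finally show "pavg {1..n} (\<lambda>S. of_bool (\<bar>log_ratio k n (choice n S) z\<bar> > \<epsilon>)) \<le> \<eta>" .
    qed
  qed
  then show ?thesis using e(1) by blast
qed

text \<open>Exchange the coin average with the circle integral. For t outside exponentially small
  neighbourhoods of the array the coin average of the event of a large ratio is small by the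
  pointwise estimate, and those neighbourhoods have negligible total measure. Uniformity in the
  centre is kept for the later integration over c.\<close>

lemma mean_log_ratio_small:
  assumes \<epsilon>: "\<epsilon> > 0" and r: "r > 0" and R: "R \<ge> 0"
  shows "\<forall>\<^sub>F n in sequentially. \<forall>c. cmod c \<le> R \<longrightarrow>
     pavg {1..n} (\<lambda>S. LINT t|unit_interval. \<bar>log_ratio k n (choice n S) (circ c r t)\<bar>) \<le> \<epsilon>"
proof -
  \<comment> \<open>The order of choices matters: \<open>\<delta>\<close> fixes \<open>K\<close>,
    and only then is the probability \<open>\<eta>\<close> chosen small against
    \<open>K\<close>.\<close>
  define \<delta> where "\<delta> = min (1 / 2) (\<epsilon> * r / 8)"
  have \<delta>: "0 < \<delta>" "\<delta> < 1" "2 * (\<delta> / r) \<le> \<epsilon> / 4"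
    using \<epsilon> r by (auto simp: \<delta>_def field_simps min_def)
  define K where "K = real k + 2 * (ln (1 + (R + r)) + ln 2 + ln (1 / \<delta>)) + ln (fact k) + ln 3 + 2 * (2 * C)"
  have K: "K \<ge> 0" unfolding K_def using R r \<delta> C_nonneg
    by (intro add_nonneg_nonneg mult_nonneg_nonneg ln_ge_zero) auto
  \<comment> \<open>The factor 2 in \<open>2 * \<eta>\<close> pays once for the neighbourhoods of
    the array and once for the unlucky coins.\<close>
  define \<eta> where "\<eta> = \<epsilon> / (8 * (K + 1))"
  have \<eta>: "\<eta> > 0" "K * (2 * \<eta>) \<le> \<epsilon> / 4" using K \<epsilon> by (auto simp: \<eta>_def field_simps)
  obtain e where e: "e > 0" and ev: "\<forall>\<^sub>F n in sequentially. \<forall>z. cmod z \<le> R + r \<longrightarrow>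
     (\<forall>i\<in>{1..n}. exp (- (e * real n)) \<le> cmod (z - a n i) \<and> exp (- (e * real n)) \<le> cmod (z - b n i)) \<longrightarrow>
     pavg {1..n} (\<lambda>S. of_bool (\<bar>log_ratio k n (choice n S) z\<bar> > \<epsilon> / 4)) \<le> \<eta>"
    using log_ratio_small_pointwise[of "\<epsilon> / 4" \<eta> "R + r" k] \<epsilon> \<eta> R r by auto
  have ev2: "\<forall>\<^sub>F n in sequentially. real n * (8 * exp (- (e * real n)) / r) < \<eta>"
  proof (rule order_tendstoD)
    show "(\<lambda>n. real n * (8 * exp (- (e * real n)) / r)) \<longlonglongrightarrow> 0"
      using e r by real_asymp
  qed (use \<eta> in simp)
  show ?thesis
    using ev ev2 eventually_ge_at_top[of "k + 1"]
  proof eventually_elim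
    case (elim n)
    show ?case
    proof (intro allI impI)
      fix c :: complex assume c: "cmod c \<le> R"
      have n: "n \<ge> 1" "k \<le> n" using elim by auto
      define E where "E = exp (- (e * real n))"
      have E: "E > 0" by (simp add: E_def)
      define G where "G S t = log_ratio k n (choice n S) (circ c r t)" for S t
      define A where "A S = {t\<in>space unit_interval. \<bar>G S t\<bar> > \<epsilon> / 4}" for S
      note M = mean_log_ratio_le[OF n(2) _ r _ height_choice[OF n(1)] \<delta>(1,2), of c "R + r" "\<epsilon> / 4",
          folded K_def, folded G_def, folded A_def]
      have G: "integrable unit_interval (G S)" for S
        using n c \<epsilon> by (intro M(1)) auto
      have A: "A S \<in> sets unit_interval" for S
      proof -
        have [measurable]: "G S \<in> borel_measurable unit_interval" using G by simp
        show ?thesis unfolding A_def by measurable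
      qed
      have iA: "integrable unit_interval (indicator (A S) :: real \<Rightarrow> real)" for S
        using A by (auto simp: integrable_indicator_iff UI.emeasure_eq_measure)
      define Bd where "Bd x = {t\<in>space unit_interval. cmod (circ c r t - x) < E}" for x
      \<comment> \<open>2n arcs of measure at most 4E/r each; the exponential decay of
        \<open>E\<close> beats the number of arcs.\<close>
      define Bad where "Bad = (\<Union>i\<in>{1..n}. Bd (a n i) \<union> Bd (b n i))"
      have Bd: "Bd x \<in> sets unit_interval" for x unfolding Bd_def by measurable
      have Bad: "Bad \<in> sets unit_interval" unfolding Bad_def using Bd by auto
      have iBad: "integrable unit_interval (indicator Bad :: real \<Rightarrow> real)"
        using Bad by (auto simp: integrable_indicator_iff UI.emeasure_eq_measure)
      have "measure unit_interval Bad \<le> (\<Sum>i=1..n. measure unit_interval (Bd (a n i) \<union> Bd (b n i)))"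
        unfolding Bad_def by (intro UI.finite_measure_subadditive_finite) (use Bd in auto)
      also have "\<dots> \<le> (\<Sum>i=1..n. measure unit_interval (Bd (a n i)) + measure unit_interval (Bd (b n i)))"
        using Bd by (intro sum_mono measure_Un_le) auto
      also have "\<dots> \<le> (\<Sum>i=1..n. 4 * E / r + 4 * E / r)"
        unfolding Bd_def by (intro sum_mono add_mono measure_circ_near r E)
      also have "\<dots> = real n * (8 * E / r)" by simp
      also have "\<dots> \<le> \<eta>" using elim(2) by (simp add: E_def)
      finally have mBad: "measure unit_interval Bad \<le> \<eta>" .
      have "pavg {1..n} (\<lambda>S. measure unit_interval (A S)) =
            pavg {1..n} (\<lambda>S. LINT t|unit_interval. indicator (A S) t)"
        using A by simp
      also have "\<dots> = (LINT t|unit_interval. pavg {1..n} (\<lambda>S. indicator (A S) t))"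
        by (rule pavg_integral(2)) (rule iA)
      also have "\<dots> \<le> (LINT t|unit_interval. indicator Bad t + \<eta>)"
      proof (rule integral_mono)
        show "integrable unit_interval (\<lambda>t. pavg {1..n} (\<lambda>S. indicator (A S) t :: real))"
          by (rule pavg_integral(1)) (rule iA)
        fix t assume t: "t \<in> space unit_interval"
        show "pavg {1..n} (\<lambda>S. indicator (A S) t) \<le> indicator Bad t + \<eta>"
        proof (cases "t \<in> Bad")
          case True
          then show ?thesis using \<eta> by (intro pavg_le_const) (auto simp: indicator_def)
        next
          case False
          have "cmod (circ c r t) \<le> R + r"
            using norm_triangle_ineq[of c "of_real r * cis (2 * pi * t)"] c r by (simp add: circ_def norm_mult)
          moreover have "\<forall>i\<in>{1..n}. E \<le> cmod (circ c r t - a n i) \<and> E \<le> cmod (circ c r t - b n i)"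
            using False t by (auto simp: Bad_def Bd_def)
          ultimately have "pavg {1..n} (\<lambda>S. of_bool (\<bar>G S t\<bar> > \<epsilon> / 4)) \<le> \<eta>"
            using elim(1) unfolding G_def E_def by blast
          moreover have "pavg {1..n} (\<lambda>S. indicator (A S) t :: real) = pavg {1..n} (\<lambda>S. of_bool (\<bar>G S t\<bar> > \<epsilon> / 4))"
            using t by (intro pavg_cong) (auto simp: A_def)
          ultimately show ?thesis using False by simp
        qed
      qed (use iBad in auto)
      also have "\<dots> = measure unit_interval Bad + \<eta>"
        using iBad Bad by (simp add: UI.prob_space)
      finally have pA: "pavg {1..n} (\<lambda>S. measure unit_interval (A S)) \<le> 2 * \<eta>" using mBad by simp
      have "pavg {1..n} (\<lambda>S. LINT t|unit_interval. \<bar>G S t\<bar>) \<le>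
            pavg {1..n} (\<lambda>S. (\<epsilon> / 4 + 2 * (\<delta> / r)) + K * measure unit_interval (A S))"
      proof (rule pavg_mono)
        fix S
        show "(LINT t|unit_interval. \<bar>G S t\<bar>) \<le> (\<epsilon> / 4 + 2 * (\<delta> / r)) + K * measure unit_interval (A S)"
          using M(2)[of S] n c \<epsilon> by simp
      qed
      also have "\<dots> = (\<epsilon> / 4 + 2 * (\<delta> / r)) + K * pavg {1..n} (\<lambda>S. measure unit_interval (A S))"
        by (simp add: pavg_add pavg_cmult)
      also have "\<dots> \<le> (\<epsilon> / 4 + \<epsilon> / 4) + K * (2 * \<eta>)"
        using pA K \<delta> by (intro add_mono mult_left_mono) auto
      also have "\<dots> \<le> \<epsilon>" using \<eta> \<epsilon> by simp
      finally show "pavg {1..n} (\<lambda>S. LINT t|unit_interval. \<bar>log_ratio k n (choice n S) (circ c r t)\<bar>) \<le> \<epsilon>"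
        unfolding G_def .
    qed
  qed
qed

end

subsection \<open>The annular kernel\<close>

definition mavg :: "'a multiset \<Rightarrow> ('a \<Rightarrow> real) \<Rightarrow> real" where
  "mavg A f = (\<Sum>x\<in>#A. f x) / real (size A)"

text \<open>Constant ln 2 on the disc of radius \<open>\<rho>\<close>, decreasing with |w| beyond
  it, and 0 from radius \<open>2 * \<rho>\<close> on.\<close>

definition kern :: "real \<Rightarrow> complex \<Rightarrow> real" where
  "kern \<rho> w = ln (max (2 * \<rho>) (cmod w)) - ln (max \<rho> (cmod w))"

lemma kern_bounds:
  assumes "\<rho> > 0"
  shows "0 \<le> kern \<rho> w" "kern \<rho> w \<le> ln 2"
proof -
  have p: "max \<rho> (cmod w) > 0" using assms by auto
  have "ln (max \<rho> (cmod w)) \<le> ln (max (2 * \<rho>) (cmod w))"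
    using assms by (intro ln_mono) auto
  then show "0 \<le> kern \<rho> w" by (simp add: kern_def)
  have "ln (max (2 * \<rho>) (cmod w)) \<le> ln (2 * max \<rho> (cmod w))"
    using assms by (intro ln_mono) (auto simp: max_def)
  also have "\<dots> = ln 2 + ln (max \<rho> (cmod w))" using p by (intro ln_mult_pos) auto
  finally show "kern \<rho> w \<le> ln 2" by (simp add: kern_def)
qed

text \<open>Subtracting Jensen's formula at the two radii removes the leading coefficient.\<close>

lemma sum_kern_Jensen:
  fixes p :: "complex poly"
  assumes p: "p \<noteq> 0" and \<rho>: "\<rho> > 0"
  shows "(\<Sum>x\<in>#proots p. kern \<rho> (x - c)) =
     (LINT t|unit_interval. ln (cmod (poly p (circ c (2 * \<rho>) t)))) -
     (LINT t|unit_interval. ln (cmod (poly p (circ c \<rho> t))))"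
proof -
  have "(\<Sum>x\<in>#A. kern \<rho> (x - c)) =
      (\<Sum>x\<in>#A. ln (max (2 * \<rho>) (cmod (x - c)))) - (\<Sum>x\<in>#A. ln (max \<rho> (cmod (x - c))))" for A
    by (induction A) (simp_all add: kern_def)
  then show ?thesis
    using Jensen_poly(2)[OF p \<rho>, of c] Jensen_poly(2)[OF p, of "2 * \<rho>" c] \<rho> by simp
qed

text \<open>Subtract the kernel formulas of the derivative and of the polynomial. Normalising by n -
  k instead of n costs the last term, since a kernel average is at most ln 2.\<close>

lemma mavg_kern_diff_le:
  fixes x :: "nat \<Rightarrow> complex" and c :: complex
  assumes k: "k < n" and \<rho>: "\<rho> > 0"
  defines "G \<equiv> log_ratio k n x"
  shows "\<bar>mavg (proots ((pderiv ^^ k) (root_poly n x))) (\<lambda>y. kern \<rho> (y - c)) -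
          mavg (proots (root_poly n x)) (\<lambda>y. kern \<rho> (y - c))\<bar> \<le>
     (LINT t|unit_interval. \<bar>G (circ c (2 * \<rho>) t)\<bar>) + (LINT t|unit_interval. \<bar>G (circ c \<rho> t)\<bar>) +
     real k * ln 2 / real n"
proof -
  define p where "p = root_poly n x"
  define q where "q = (pderiv ^^ k) p"
  have p: "p \<noteq> 0" by (simp add: p_def root_poly_nonzero)
  have q: "q \<noteq> 0" using k by (simp add: p_def q_def higher_pderiv_root_poly_nonzero)
  have size: "size (proots p) = n" "size (proots q) = n - k"
    unfolding size_proots_complex using k
    by (simp_all add: p_def q_def degree_root_poly higher_pderiv_root_poly_degree)
  have G: "G z = (ln (cmod (poly q z)) - ln (cmod (poly p z))) / real n" for z
    by (simp add: log_ratio_def p_def q_def G_def)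
  have iG: "integrable unit_interval (\<lambda>t. G (circ c r t))" if "r > 0" for r
    unfolding G using Jensen_poly(1)[OF p that] Jensen_poly(1)[OF q that] by auto
  define m where "m r = (LINT t|unit_interval. G (circ c r t))" for r
  have m: "m r = ((LINT t|unit_interval. ln (cmod (poly q (circ c r t)))) -
                  (LINT t|unit_interval. ln (cmod (poly p (circ c r t))))) / real n" if "r > 0" for r
    unfolding m_def G using Jensen_poly(1)[OF p that] Jensen_poly(1)[OF q that] by auto
  define A where "A = (\<Sum>y\<in>#proots q. kern \<rho> (y - c))"
  define B where "B = (\<Sum>y\<in>#proots p. kern \<rho> (y - c))"
  have AB: "A - B = real n * (m (2 * \<rho>) - m \<rho>)"
    using k \<rho> by (simp add: A_def B_def sum_kern_Jensen[OF p] sum_kern_Jensen[OF q] m field_simps)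
  have A0: "0 \<le> A" unfolding A_def by (intro sum_mset_nonneg kern_bounds \<rho>)
  have "A \<le> (\<Sum>y\<in>#proots q. ln 2)" unfolding A_def by (intro sum_mset_mono kern_bounds \<rho>)
  then have A1: "A \<le> real (n - k) * ln 2" by (simp add: size)
  have nk: "real (n - k) > 0" "real n > 0" "real (n - k) = real n - real k" using k by auto
  have "mavg (proots q) (\<lambda>y. kern \<rho> (y - c)) - mavg (proots p) (\<lambda>y. kern \<rho> (y - c)) =
        A / real (n - k) - B / real n"
    by (simp add: mavg_def size A_def B_def)
  \<comment> \<open>Uses 1/(n-k) = 1/n + k/(n(n-k)).\<close>
  also have "\<dots> = (A - B) / real n + (A / real (n - k)) * real k / real n"
  proof -
    have "real k = real n - real (n - k)" using nk by simp
    then have "(A / real (n - k)) * real k / real n = A / real (n - k) - A / real n"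
      using nk(1,2) by (simp only:) (simp add: field_simps del: of_nat_diff)
    then show ?thesis by (simp add: diff_divide_distrib)
  qed
  also have "(A - B) / real n = m (2 * \<rho>) - m \<rho>" unfolding AB using nk by simp
  finally have eq: "mavg (proots q) (\<lambda>y. kern \<rho> (y - c)) - mavg (proots p) (\<lambda>y. kern \<rho> (y - c)) =
    (m (2 * \<rho>) - m \<rho>) + (A / real (n - k)) * real k / real n" .
  have "A / real (n - k) \<le> ln 2" using A1 nk by (simp add: divide_le_eq mult.commute)
  then have "(A / real (n - k)) * real k / real n \<le> ln 2 * real k / real n"
    by (intro divide_right_mono mult_right_mono) auto
  moreover have "0 \<le> (A / real (n - k)) * real k / real n" using A0 by simp
  moreover have "\<bar>m r\<bar> \<le> (LINT t|unit_interval. \<bar>G (circ c r t)\<bar>)" for r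
    unfolding m_def by (rule integral_abs_bound)
  from this[of "2 * \<rho>"] this[of \<rho>]
  have "\<bar>m (2 * \<rho>) - m \<rho>\<bar> \<le> (LINT t|unit_interval. \<bar>G (circ c (2 * \<rho>) t)\<bar>) + (LINT t|unit_interval. \<bar>G (circ c \<rho> t)\<bar>)"
    by linarith
  moreover have "\<bar>u + v\<bar> \<le> U + V" if "\<bar>u\<bar> \<le> U" "0 \<le> v" "v \<le> V" for u v U V :: real
    using that by linarith
  ultimately show ?thesis
    unfolding p_def[symmetric] q_def[symmetric] eq mult.commute[of "real k" "ln 2"] by blast
qed

context array_pair
begin

lemma mavg_kern_close:
  assumes \<epsilon>: "\<epsilon> > 0" and \<rho>: "\<rho> > 0" and R: "R \<ge> 0"
  shows "\<forall>\<^sub>F n in sequentially. \<forall>c. cmod c \<le> R \<longrightarrow>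
     pavg {1..n} (\<lambda>S. \<bar>mavg (choice_roots k n S) (\<lambda>y. kern \<rho> (y - c)) -
          mavg (proots (root_poly n (choice n S))) (\<lambda>y. kern \<rho> (y - c))\<bar>) \<le> \<epsilon>"
proof -
  have \<epsilon>3: "\<epsilon> / 3 > 0" and \<rho>2: "2 * \<rho> > 0" using \<epsilon> \<rho> by auto
  have ev: "\<forall>\<^sub>F n in sequentially. real k * ln 2 / real n < \<epsilon> / 3"
  proof (rule order_tendstoD)
    show "(\<lambda>n. real k * ln 2 / real n) \<longlonglongrightarrow> 0" by real_asymp
  qed (use \<epsilon> in simp)
  show ?thesis
    using mean_log_ratio_small[OF \<epsilon>3 \<rho>2 R, of k] mean_log_ratio_small[OF \<epsilon>3 \<rho> R, of k] ev
      eventually_gt_at_top[of k]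
  proof eventually_elim
    case (elim n)
    show ?case
    proof (intro allI impI)
      fix c :: complex assume c: "cmod c \<le> R"
      have "pavg {1..n} (\<lambda>S. \<bar>mavg (choice_roots k n S) (\<lambda>y. kern \<rho> (y - c)) -
          mavg (proots (root_poly n (choice n S))) (\<lambda>y. kern \<rho> (y - c))\<bar>) \<le>
        pavg {1..n} (\<lambda>S. (LINT t|unit_interval. \<bar>log_ratio k n (choice n S) (circ c (2 * \<rho>) t)\<bar>) +
           (LINT t|unit_interval. \<bar>log_ratio k n (choice n S) (circ c \<rho> t)\<bar>) + real k * ln 2 / real n)"
        by (intro pavg_mono mavg_kern_diff_le elim \<rho>)
      also have "\<dots> \<le> \<epsilon> / 3 + \<epsilon> / 3 + \<epsilon> / 3"
        unfolding pavg_add using elim c by (intro add_mono) auto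
      finally show "pavg {1..n} (\<lambda>S. \<bar>mavg (choice_roots k n S) (\<lambda>y. kern \<rho> (y - c)) -
          mavg (proots (root_poly n (choice n S))) (\<lambda>y. kern \<rho> (y - c))\<bar>) \<le> \<epsilon>" by simp
    qed
  qed
qed

end

subsection \<open>Test functions\<close>

definition compact_supp :: "(complex \<Rightarrow> real) \<Rightarrow> bool" where
  "compact_supp f \<longleftrightarrow> continuous_on UNIV f \<and> (\<exists>R. \<forall>z. cmod z > R \<longrightarrow> f z = 0)"

lemma compact_supp_integrable:
  assumes "compact_supp f"
  shows "integrable lborel f"
proof -
  obtain R where f: "continuous_on UNIV f" and R: "\<And>z. cmod z > R \<Longrightarrow> f z = 0"
    using assms by (auto simp: compact_supp_def)
  have "integrable lborel (\<lambda>x. indicator (cball 0 R) x *\<^sub>R f x)"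
    by (rule borel_integrable_compact) (use f continuous_on_subset in auto)
  moreover have "(\<lambda>x. indicator (cball 0 R) x *\<^sub>R f x) = f"
    using R by (intro ext) (force simp: indicator_def)
  ultimately show ?thesis by simp
qed

lemma compact_supp_uniformly_continuous:
  assumes "compact_supp f" "\<delta> > 0"
  shows "\<exists>d>0. \<forall>x y. cmod (x - y) \<le> d \<longrightarrow> \<bar>f x - f y\<bar> \<le> \<delta>"
proof -
  obtain R where f: "continuous_on UNIV f" and R: "\<And>z. cmod z > R \<Longrightarrow> f z = 0"
    using assms by (auto simp: compact_supp_def)
  have "uniformly_continuous_on (cball 0 (R + 1)) f"
    by (rule compact_uniformly_continuous) (use f continuous_on_subset in auto)
  then obtain d where d: "d > 0" "\<And>x y. x \<in> cball 0 (R + 1) \<Longrightarrow> y \<in> cball 0 (R + 1) \<Longrightarrow> dist y x < d \<Longrightarrow> dist (f y) (f x) < \<delta>"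
    unfolding uniformly_continuous_on_def using assms(2) by meson
  show ?thesis
  \<comment> \<open>The cap 1 ensures that if one point lies outside radius \<open>R + 1\<close>,
    then both lie outside radius \<open>R\<close>, where f vanishes.\<close>
  proof (intro exI[of _ "min (d / 2) 1"] conjI allI impI)
    fix x y assume xy: "cmod (x - y) \<le> min (d / 2) 1"
    show "\<bar>f x - f y\<bar> \<le> \<delta>"
    proof (cases "cmod x \<le> R + 1 \<and> cmod y \<le> R + 1")
      case True
      then have "dist (f x) (f y) < \<delta>"
        using xy d(1) by (intro d(2)) (auto simp: dist_norm)
      then show ?thesis by (simp add: dist_real_def)
    next
      case False
      have "cmod x > R" "cmod y > R"
        using False xy norm_triangle_ineq2[of x y] norm_triangle_ineq3[of x y] by auto
      then show ?thesis using R assms(2) by simp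
    qed
  qed (use d in auto)
qed

lemma compact_supp_bounded:
  assumes "compact_supp f"
  shows "\<exists>F. \<forall>x. \<bar>f x\<bar> \<le> F"
proof -
  obtain R where f: "continuous_on UNIV f" and R: "\<And>z. cmod z > R \<Longrightarrow> f z = 0"
    using assms by (auto simp: compact_supp_def)
  have "compact (f ` cball 0 R)"
    by (rule compact_continuous_image) (use f continuous_on_subset in auto)
  then have "bounded (f ` cball 0 R)" by (rule compact_imp_bounded)
  then obtain F where F: "\<And>x. cmod x \<le> R \<Longrightarrow> \<bar>f x\<bar> \<le> F"
    by (force simp: bounded_iff)
  show ?thesis
  proof (intro exI allI)
    fix x show "\<bar>f x\<bar> \<le> max F 0"
      using F[of x] R[of x] by (cases "cmod x \<le> R") auto
  qed
qed

lemma continuous_kern: "\<rho> > 0 \<Longrightarrow> continuous_on A (kern \<rho>)"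
  unfolding kern_def by (intro continuous_intros) auto

lemma kern_eq_0: "\<rho> > 0 \<Longrightarrow> cmod w \<ge> 2 * \<rho> \<Longrightarrow> kern \<rho> w = 0"
  by (simp add: kern_def max_def)

lemma kern_minus: "kern \<rho> (- w) = kern \<rho> w"
  by (simp add: kern_def)

lemma kern_commute: "kern \<rho> (x - y) = kern \<rho> (y - x)"
  using kern_minus[of \<rho> "x - y"] by simp

text \<open>Above \<open>\<rho>\<close> the logarithm has slope at most 1/\<rho>, and the kernel has
  two such terms. This extends convergence from a dense set of centres to all centres.\<close>

lemma kern_Lipschitz:
  assumes "\<rho> > 0"
  shows "\<bar>kern \<rho> x - kern \<rho> y\<bar> \<le> 2 / \<rho> * cmod (x - y)"
proof -
  have *: "\<bar>ln (max r s) - ln (max r t)\<bar> \<le> \<bar>s - t\<bar> / \<rho>" if r: "r \<ge> \<rho>" for r s t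
  proof -
    have le: "ln (max r s) - ln (max r t) \<le> \<bar>s - t\<bar> / \<rho>" for s t
    proof -
      have p: "max r s > 0" "max r t \<ge> \<rho>" using r assms by auto
      have "ln (max r s) - ln (max r t) \<le> (max r s - max r t) / max r t"
        using p assms by (intro ln_diff_le) auto
      also have "\<dots> \<le> \<bar>s - t\<bar> / max r t"
        using p assms by (intro divide_right_mono) (auto simp: max_def)
      also have "\<dots> \<le> \<bar>s - t\<bar> / \<rho>"
        using p assms by (intro divide_left_mono) auto
      finally show ?thesis .
    qed
    show ?thesis using le[of s t] le[of t s] by (simp add: abs_le_iff abs_minus_commute)
  qed
  have "kern \<rho> x - kern \<rho> y = (ln (max (2 * \<rho>) (cmod x)) - ln (max (2 * \<rho>) (cmod y))) -
      (ln (max \<rho> (cmod x)) - ln (max \<rho> (cmod y)))" by (simp add: kern_def)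
  also have "\<bar>\<dots>\<bar> \<le> \<bar>ln (max (2 * \<rho>) (cmod x)) - ln (max (2 * \<rho>) (cmod y))\<bar> +
      \<bar>ln (max \<rho> (cmod x)) - ln (max \<rho> (cmod y))\<bar>" by (rule abs_triangle_ineq4)
  also have "\<dots> \<le> \<bar>cmod x - cmod y\<bar> / \<rho> + \<bar>cmod x - cmod y\<bar> / \<rho>"
    using assms by (intro add_mono *) auto
  also have "\<dots> = 2 / \<rho> * \<bar>cmod x - cmod y\<bar>" by simp
  also have "\<dots> \<le> 2 / \<rho> * cmod (x - y)"
    using assms norm_triangle_ineq3[of x y] by (intro mult_left_mono) auto
  finally show ?thesis .
qed

text \<open>The kernel alone provides the compact support in c, so f may also be a constant.\<close>

lemma compact_supp_mult_kern:
  assumes "continuous_on UNIV f" "\<rho> > 0"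
  shows "compact_supp (\<lambda>c. f c * kern \<rho> (x - c))"
  unfolding compact_supp_def
proof (intro conjI exI allI impI)
  show "continuous_on UNIV (\<lambda>c. f c * kern \<rho> (x - c))"
    by (intro continuous_intros assms(1) continuous_on_compose2[OF continuous_kern[OF assms(2), of UNIV]]) auto
  fix c assume "cmod c > cmod x + 2 * \<rho>"
  then have "cmod (x - c) \<ge> 2 * \<rho>" using norm_triangle_ineq2[of c x] by (simp add: norm_minus_commute)
  then show "f c * kern \<rho> (x - c) = 0" using kern_eq_0 assms(2) by simp
qed

section \<open>Convolution with the kernel\<close>

definition kern_mass :: "real \<Rightarrow> real" where
  "kern_mass \<rho> = (LINT c|lborel. kern \<rho> c)"

text \<open>The kernel is ln 2 on a disc of positive area.\<close>

lemma kern_mass_pos: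
  assumes "\<rho> > 0"
  shows "kern_mass \<rho> > 0"
proof -
  have i: "integrable lborel (kern \<rho>)"
    using compact_supp_integrable[OF compact_supp_mult_kern[of "\<lambda>_. 1" \<rho> 0]] assms
    by (simp add: kern_minus)
  have fin: "emeasure lborel (cball (0::complex) \<rho>) < \<infinity>"
    by (intro emeasure_bounded_finite) auto
  then have ii: "integrable lborel (indicator (cball (0::complex) \<rho>) :: complex \<Rightarrow> real)"
    by (auto simp: integrable_indicator_iff)
  have "0 < ln 2 * measure lborel (cball (0::complex) \<rho>)"
    using content_cball_pos[OF assms, of "0::complex"] by (simp add: measure_completion)
  also have "\<dots> = (LINT c|lborel. ln 2 * indicator (cball (0::complex) \<rho>) c)" by simp
  also have "\<dots> \<le> kern_mass \<rho>"
    unfolding kern_mass_def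
  proof (intro integral_mono i)
    fix c :: complex
    show "ln 2 * indicator (cball 0 \<rho>) c \<le> kern \<rho> c"
      using assms kern_bounds[OF assms, of c] by (auto simp: indicator_def kern_def max_def ln_mult)
  qed (use ii in auto)
  finally show ?thesis .
qed

lemma integral_kern_shift:
  assumes "\<rho> > 0"
  shows "(LINT c|lborel. kern \<rho> (x - c)) = kern_mass \<rho>"
proof -
  have m: "kern \<rho> \<in> borel_measurable borel"
    by (intro borel_measurable_continuous_onI continuous_kern assms)
  have "kern_mass \<rho> = (LINT c|distr lborel borel ((+) (- x)). kern \<rho> c)"
    by (simp add: kern_mass_def lborel_distr_plus)
  also have "\<dots> = (LINT c|lborel. kern \<rho> (- x + c))"
    by (subst integral_distr) (use m in auto)
  also have "\<dots> = (LINT c|lborel. kern \<rho> (x - c))"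
    by (simp add: kern_commute[of \<rho> x])
  finally show ?thesis ..
qed

lemma mavg_diff_le:
  assumes "\<And>x. \<bar>f x - g x\<bar> \<le> \<delta>" "\<delta> \<ge> 0"
  shows "\<bar>mavg A f - mavg A g\<bar> \<le> \<delta>"
proof (cases "A = {#}")
  case False
  have "\<bar>(\<Sum>x\<in>#A. f x) - (\<Sum>x\<in>#A. g x)\<bar> \<le> real (size A) * \<delta>" for A
  proof (induction A)
    case (add x A)
    then show ?case using assms(1)[of x] by (simp add: algebra_simps)
  qed simp
  from this[of A] False show ?thesis
    by (simp add: mavg_def divide_le_eq mult.commute nonempty_has_size flip: diff_divide_distrib)
qed (use assms in \<open>simp add: mavg_def\<close>)

lemma mavg_cmult: "mavg A (\<lambda>x. c * f x) = c * mavg A f"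
  by (simp add: mavg_def flip: sum_mset_distrib_left)

lemma kern_mavg_bounds:
  assumes "\<rho> > 0"
  shows "0 \<le> mavg A (\<lambda>y. kern \<rho> (y - c))" "mavg A (\<lambda>y. kern \<rho> (y - c)) \<le> ln 2"
proof -
  have "0 \<le> (\<Sum>y\<in>#A. kern \<rho> (y - c))" by (intro sum_mset_nonneg kern_bounds assms)
  moreover have "(\<Sum>y\<in>#A. kern \<rho> (y - c)) \<le> (\<Sum>y\<in>#A. ln 2)" by (intro sum_mset_mono kern_bounds assms)
  ultimately show "0 \<le> mavg A (\<lambda>y. kern \<rho> (y - c))" "mavg A (\<lambda>y. kern \<rho> (y - c)) \<le> ln 2"
    by (auto simp: mavg_def divide_le_eq mult.commute)
qed

lemma continuous_mavg_kern:
  assumes "\<rho> > 0"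
  shows "continuous_on UNIV (\<lambda>c. mavg A (\<lambda>y. kern \<rho> (y - c)))"
  unfolding mavg_def divide_inverse
proof (intro continuous_intros)
  show "continuous_on UNIV (\<lambda>c. \<Sum>y\<in>#A. kern \<rho> (y - c))"
    by (induction A)
       (auto intro!: continuous_intros continuous_on_compose2[OF continuous_kern[OF assms, of UNIV]])
qed

lemma kern_mavg_diff_integrable:
  assumes "\<rho> > 0"
  shows "integrable lborel (\<lambda>c. indicator (cball 0 R) c *
     \<bar>mavg A (\<lambda>y. kern \<rho> (y - c)) - mavg B (\<lambda>y. kern \<rho> (y - c))\<bar>)"
proof -
  have "continuous_on (cball 0 R) (\<lambda>c. \<bar>mavg A (\<lambda>y. kern \<rho> (y - c)) - mavg B (\<lambda>y. kern \<rho> (y - c))\<bar>)"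
    by (intro continuous_intros continuous_on_subset[OF continuous_mavg_kern[OF assms]]) auto
  from borel_integrable_compact[OF _ this] show ?thesis by simp
qed

text \<open>Up to \<open>\<delta>\<close>, \<open>f\<close> equals its convolution with the normalised kernel, and the average of
  a convolution is an integral of kernel averages.\<close>
lemma mavg_convolution_le:
  assumes f: "continuous_on UNIV f" and F: "\<And>x. \<bar>f x\<bar> \<le> F" and R: "\<And>z. cmod z > R \<Longrightarrow> f z = 0"
    and \<rho>: "\<rho> > 0" and \<delta>: "\<delta> \<ge> 0" and uc: "\<And>x y. cmod (x - y) \<le> 2 * \<rho> \<Longrightarrow> \<bar>f x - f y\<bar> \<le> \<delta>"
  shows "\<bar>mavg A f - mavg B f\<bar> \<le> 2 * \<delta> + F / kern_mass \<rho> *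
     (LINT c|lborel. indicator (cball 0 R) c *
        \<bar>mavg A (\<lambda>y. kern \<rho> (y - c)) - mavg B (\<lambda>y. kern \<rho> (y - c))\<bar>)"
proof -
  define Z where "Z = kern_mass \<rho>"
  have Z: "Z > 0" unfolding Z_def by (rule kern_mass_pos[OF \<rho>])
  define h where "h x = (LINT c|lborel. f c * kern \<rho> (x - c))" for x
  have ih: "integrable lborel (\<lambda>c. f c * kern \<rho> (x - c))" for x
    by (rule compact_supp_integrable[OF compact_supp_mult_kern[OF f \<rho>]])
  have ik: "integrable lborel (\<lambda>c. a * kern \<rho> (x - c))" for a x
    by (rule compact_supp_integrable[OF compact_supp_mult_kern[OF _ \<rho>]]) auto
  have near: "\<bar>f x - h x / Z\<bar> \<le> \<delta>" for x
  proof -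
    have "h x - f x * Z = (LINT c|lborel. f c * kern \<rho> (x - c)) - (LINT c|lborel. f x * kern \<rho> (x - c))"
      by (simp add: h_def Z_def integral_kern_shift[OF \<rho>])
    also have "\<dots> = (LINT c|lborel. f c * kern \<rho> (x - c) - f x * kern \<rho> (x - c))"
      by (rule Bochner_Integration.integral_diff[symmetric]) (rule ih ik)+
    finally have "\<bar>h x - f x * Z\<bar> \<le> (LINT c|lborel. \<bar>f c * kern \<rho> (x - c) - f x * kern \<rho> (x - c)\<bar>)"
      by simp
    also have "\<dots> \<le> (LINT c|lborel. \<delta> * kern \<rho> (x - c))"
    proof (rule integral_mono)
      show "integrable lborel (\<lambda>c. \<bar>f c * kern \<rho> (x - c) - f x * kern \<rho> (x - c)\<bar>)"
        by (intro integrable_abs Bochner_Integration.integrable_diff ih ik)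
      fix c
      show "\<bar>f c * kern \<rho> (x - c) - f x * kern \<rho> (x - c)\<bar> \<le> \<delta> * kern \<rho> (x - c)"
      proof (cases "cmod (x - c) \<le> 2 * \<rho>")
        case True
        have "\<bar>f c - f x\<bar> * kern \<rho> (x - c) \<le> \<delta> * kern \<rho> (x - c)"
          using uc[OF True] kern_bounds[OF \<rho>] by (intro mult_right_mono) auto
        then show ?thesis
          using kern_bounds(1)[OF \<rho>, of "x - c"] by (simp add: abs_mult flip: left_diff_distrib)
      next
        case False
        then show ?thesis using kern_eq_0[OF \<rho>, of "x - c"] by simp
      qed
    qed (rule ik)
    also have "\<dots> = \<delta> * Z" by (simp add: Z_def integral_kern_shift[OF \<rho>])
    finally show ?thesis using Z by (simp add: field_simps abs_le_iff)
  qed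
  define k where "k A c = mavg A (\<lambda>y. kern \<rho> (y - c))" for A c
  have mh: "integrable lborel (\<lambda>c. f c * k A c)" "mavg A h = (LINT c|lborel. f c * k A c)" for A
  proof -
    note S = integral_sum_mset[of lborel "\<lambda>y c. f c * kern \<rho> (y - c)", OF ih]
    have e: "f c * k A c = (\<Sum>y\<in>#A. f c * kern \<rho> (y - c)) / real (size A)" for c
      by (simp add: k_def mavg_def sum_mset_distrib_left)
    show "integrable lborel (\<lambda>c. f c * k A c)" unfolding e using S(1) by auto
    show "mavg A h = (LINT c|lborel. f c * k A c)" unfolding e using S by (simp add: mavg_def h_def)
  qed
  define g where "g c = indicator (cball 0 R) c * \<bar>k A c - k B c\<bar>" for c
  have ig: "integrable lborel g"
    unfolding g_def k_def by (rule kern_mavg_diff_integrable[OF \<rho>])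
  have "mavg A h - mavg B h = (LINT c|lborel. f c * k A c - f c * k B c)"
    unfolding mh(2) by (rule Bochner_Integration.integral_diff[symmetric]) (rule mh)+
  then have "\<bar>mavg A h - mavg B h\<bar> \<le> (LINT c|lborel. \<bar>f c * k A c - f c * k B c\<bar>)" by simp
  also have "\<dots> \<le> (LINT c|lborel. F * g c)"
  proof (rule integral_mono)
    show "integrable lborel (\<lambda>c. \<bar>f c * k A c - f c * k B c\<bar>)"
      by (intro integrable_abs Bochner_Integration.integrable_diff mh)
    show "integrable lborel (\<lambda>c. F * g c)" using ig by simp
    fix c
    show "\<bar>f c * k A c - f c * k B c\<bar> \<le> F * g c"
    proof (cases "cmod c \<le> R")
      case True
      have "\<bar>f c\<bar> * \<bar>k A c - k B c\<bar> \<le> F * \<bar>k A c - k B c\<bar>" using F by (intro mult_right_mono) auto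
      then show ?thesis using True by (simp add: g_def abs_mult flip: right_diff_distrib)
    next
      case False
      then show ?thesis using R[of c] by (simp add: g_def)
    qed
  qed
  also have "\<dots> = F * (LINT c|lborel. g c)" by simp
  finally have "\<bar>mavg A h - mavg B h\<bar> / Z \<le> F * (LINT c|lborel. g c) / Z"
    using Z by (intro divide_right_mono) auto
  moreover have "\<bar>mavg A f - mavg A h / Z\<bar> \<le> \<delta>" for A
    using mavg_diff_le[of f "\<lambda>x. 1 / Z * h x" \<delta> A] near \<delta> unfolding mavg_cmult by simp
  from this[of A] this[of B] have "\<bar>mavg A f - mavg B f\<bar> \<le> 2 * \<delta> + \<bar>mavg A h / Z - mavg B h / Z\<bar>"
    by linarith
  moreover have "\<bar>mavg A h / Z - mavg B h / Z\<bar> = \<bar>mavg A h - mavg B h\<bar> / Z"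
    using Z by (simp add: abs_divide flip: diff_divide_distrib)
  ultimately have "\<bar>mavg A f - mavg B f\<bar> \<le> 2 * \<delta> + F * (LINT c|lborel. g c) / Z" by linarith
  then show ?thesis by (simp add: Z_def g_def k_def)
qed

subsection \<open>Weak convergence through compactly supported functions\<close>

text \<open>Besides f times a cutoff, the cutoff itself is a test function: if its integral is close
  to the nearly full value under \<open>\<mu>\<close>, little mass of \<open>\<nu>\<close> can
  escape to infinity. The two functions depend on \<open>\<mu>\<close>, f and
  \<open>\<epsilon>\<close> only, so they serve random measures too.\<close>

lemma weak_test_reduction:
  fixes f :: "complex \<Rightarrow> real"
  assumes \<mu>: "prob_space \<mu>" "sets \<mu> = sets borel"
    and f: "continuous_on UNIV f" "bounded (range f)" and \<epsilon>: "\<epsilon> > 0"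
  shows "\<exists>g h \<epsilon>'. compact_supp g \<and> compact_supp h \<and> \<epsilon>' > 0 \<and>
     (\<forall>\<nu>. prob_space \<nu> \<longrightarrow> sets \<nu> = sets borel \<longrightarrow>
        \<bar>(LINT x|\<nu>. g x) - (LINT x|\<mu>. g x)\<bar> < \<epsilon>' \<longrightarrow> \<bar>(LINT x|\<nu>. h x) - (LINT x|\<mu>. h x)\<bar> < \<epsilon>' \<longrightarrow>
        \<bar>(LINT x|\<nu>. f x) - (LINT x|\<mu>. f x)\<bar> < \<epsilon>)"
proof -
  interpret \<mu>: prob_space \<mu> by (rule \<mu>)
  obtain F where F: "\<And>x. \<bar>f x\<bar> \<le> F" using f(2) by (auto simp: bounded_iff)
  have F0: "F \<ge> 0" using F[of 0] by linarith
  \<comment> \<open>The final error is (1 + 3F)\<epsilon>': one \<epsilon>' for the truncated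
    integrals, F\<epsilon>' for the tail of \<open>\<mu>\<close> and 2F\<epsilon>' for the tail of
    \<open>\<nu>\<close>.\<close>
  define \<epsilon>' where "\<epsilon>' = \<epsilon> / (4 * (F + 1))"
  have \<epsilon>': "\<epsilon>' > 0" "(1 + 3 * F) * \<epsilon>' < \<epsilon>"
  proof -
    show "\<epsilon>' > 0" using \<epsilon> F0 by (simp add: \<epsilon>'_def)
    have "(1 + 3 * F) * \<epsilon> < (4 * (F + 1)) * \<epsilon>"
      using \<epsilon> F0 by (intro mult_strict_right_mono) auto
    then show "(1 + 3 * F) * \<epsilon>' < \<epsilon>"
      using F0 by (simp add: \<epsilon>'_def divide_less_eq mult.commute)
  qed
  define \<psi> where "\<psi> m z = max 0 (min 1 (real m + 1 - cmod z))" for m :: nat and z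
  have \<psi>c: "continuous_on UNIV (\<psi> m)" for m unfolding \<psi>_def by (intro continuous_intros)
  have \<psi>01: "0 \<le> \<psi> m z" "\<psi> m z \<le> 1" for m z by (auto simp: \<psi>_def)
  have \<psi>0: "\<psi> m z = 0" if "cmod z > real m + 1" for m z using that by (simp add: \<psi>_def)
  have meas: "g \<in> borel_measurable \<nu>" if "continuous_on UNIV g" "sets \<nu> = sets borel" for g :: "complex \<Rightarrow> real" and \<nu>
    using borel_measurable_continuous_onI[OF that(1)] that(2) by (metis measurable_cong_sets)
  have "(\<lambda>m. LINT z|\<mu>. \<psi> m z) \<longlonglongrightarrow> (LINT z|\<mu>. 1)"
  proof (rule integral_dominated_convergence[where w = "\<lambda>_. 1"])
    show "AE z in \<mu>. (\<lambda>m. \<psi> m z) \<longlonglongrightarrow> 1"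
    proof (rule AE_I2)
      fix z :: complex
      obtain M :: nat where M: "cmod z \<le> real M" using real_arch_simple by blast
      have "\<forall>\<^sub>F m in sequentially. \<psi> m z = 1"
        using eventually_ge_at_top[of M]
      proof eventually_elim
        case (elim m)
        then have "cmod z \<le> real m" using M by linarith
        then show ?case by (simp add: \<psi>_def)
      qed
      then show "(\<lambda>m. \<psi> m z) \<longlonglongrightarrow> 1" by (rule tendsto_eventually)
    qed
    show "AE z in \<mu>. norm (\<psi> m z) \<le> 1" for m using \<psi>01 by auto
  qed (auto intro: meas[OF \<psi>c \<mu>(2)])
  then have "(\<lambda>m. LINT z|\<mu>. \<psi> m z) \<longlonglongrightarrow> 1" by (simp add: \<mu>.prob_space)
  moreover have "1 - \<epsilon>' < 1" using \<epsilon>'(1) by simp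
  ultimately have "\<forall>\<^sub>F m in sequentially. (LINT z|\<mu>. \<psi> m z) > 1 - \<epsilon>'"
    by (rule order_tendstoD(1))
  then obtain m where m: "(LINT z|\<mu>. \<psi> m z) > 1 - \<epsilon>'"
    using eventually_happens'[OF sequentially_bot] by blast
  define g where "g z = f z * \<psi> m z" for z
  have "compact_supp g" "compact_supp (\<psi> m)"
    using \<psi>0[of m] \<psi>c[of m] f(1)
    by (auto simp: compact_supp_def g_def intro!: continuous_intros exI[of _ "real m + 1"])
  moreover have "\<bar>(LINT x|\<nu>. f x) - (LINT x|\<mu>. f x)\<bar> < \<epsilon>"
    if \<nu>: "prob_space \<nu>" "sets \<nu> = sets borel"
      and g: "\<bar>(LINT x|\<nu>. g x) - (LINT x|\<mu>. g x)\<bar> < \<epsilon>'"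
      and h: "\<bar>(LINT x|\<nu>. \<psi> m x) - (LINT x|\<mu>. \<psi> m x)\<bar> < \<epsilon>'" for \<nu>
  proof -
    have tail: "\<bar>(LINT x|\<kappa>. f x) - (LINT x|\<kappa>. g x)\<bar> \<le> F * (1 - (LINT x|\<kappa>. \<psi> m x))"
      if \<kappa>: "prob_space \<kappa>" "sets \<kappa> = sets borel" for \<kappa>
    proof -
      interpret \<kappa>: prob_space \<kappa> by (rule \<kappa>)
      have i: "integrable \<kappa> f" "integrable \<kappa> (\<psi> m)" "integrable \<kappa> g"
      proof -
        show "integrable \<kappa> f"
          by (rule \<kappa>.integrable_const_bound[of _ F]) (auto intro: F meas[OF f(1) \<kappa>(2)])
        show "integrable \<kappa> (\<psi> m)"
          by (rule \<kappa>.integrable_const_bound[of _ 1]) (use \<psi>01 in \<open>auto intro: meas[OF \<psi>c \<kappa>(2)]\<close>)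
        show "integrable \<kappa> g"
        proof (rule \<kappa>.integrable_const_bound[of _ F])
          have "\<bar>g z\<bar> \<le> F * 1" for z
            unfolding g_def abs_mult using F \<psi>01 F0 by (intro mult_mono) auto
          then show "AE z in \<kappa>. norm (g z) \<le> F" by simp
          show "g \<in> borel_measurable \<kappa>" unfolding g_def
            by (intro borel_measurable_times meas[OF f(1) \<kappa>(2)] meas[OF \<psi>c \<kappa>(2)])
        qed
      qed
      have "(LINT x|\<kappa>. f x) - (LINT x|\<kappa>. g x) = (LINT x|\<kappa>. f x - g x)"
        using i by simp
      also have "\<bar>\<dots>\<bar> \<le> (LINT x|\<kappa>. \<bar>f x - g x\<bar>)" by (rule integral_abs_bound)
      also have "\<dots> \<le> (LINT x|\<kappa>. F * (1 - \<psi> m x))"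
      proof (intro integral_mono)
        fix x
        have "f x - g x = f x * (1 - \<psi> m x)" by (simp add: g_def algebra_simps)
        then show "\<bar>f x - g x\<bar> \<le> F * (1 - \<psi> m x)"
          using F[of x] \<psi>01[of m x] by (simp add: abs_mult mult_right_mono)
      qed (use i in auto)
      also have "\<dots> = F * (1 - (LINT x|\<kappa>. \<psi> m x))" using i by (simp add: \<kappa>.prob_space)
      finally show ?thesis .
    qed
    have "F * (1 - (LINT x|\<nu>. \<psi> m x)) \<le> F * (2 * \<epsilon>')" "F * (1 - (LINT x|\<mu>. \<psi> m x)) \<le> F * \<epsilon>'"
      using m h F0 by (auto intro!: mult_left_mono)
    then have "\<bar>(LINT x|\<nu>. f x) - (LINT x|\<mu>. f x)\<bar> < \<epsilon>' + F * (2 * \<epsilon>') + F * \<epsilon>'"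
      using tail[OF \<nu>] tail[OF \<mu>] g by linarith
    also have "\<dots> = (1 + 3 * F) * \<epsilon>'" by (simp add: algebra_simps)
    also have "\<dots> < \<epsilon>" by (rule \<epsilon>')
    finally show ?thesis .
  qed
  ultimately show ?thesis using \<epsilon>'(1) by (intro exI[of _ g] exI[of _ "\<psi> m"] exI[of _ \<epsilon>']) auto
qed

section \<open>Integrals against uniform measures on multisets\<close>

lemma prob_space_uniform_mset_measure: "prob_space (uniform_mset_measure A)"
  unfolding uniform_mset_measure_def by (rule measure_pmf.prob_space_distr) simp

lemma sets_uniform_mset_measure: "sets (uniform_mset_measure A) = sets borel"
  by (simp add: uniform_mset_measure_def)

lemma sum_mset_count:
  fixes f :: "'a \<Rightarrow> real"
  shows "(\<Sum>x\<in>#A. f x) = (\<Sum>x\<in>set_mset A. real (count A x) * f x)"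
proof -
  \<comment> \<open>A fixed superset \<open>B\<close> keeps the range of summation constant during
    the induction on \<open>A\<close>.\<close>
  have "(\<Sum>x\<in>#A. f x) = (\<Sum>x\<in>B. real (count A x) * f x)" if "finite B" "set_mset A \<subseteq> B" for B
    using that(2)
  proof (induction A)
    case (add a A)
    have "(\<Sum>x\<in>B. real (count (add_mset a A) x) * f x) =
          (\<Sum>x\<in>B. real (count A x) * f x + (if x = a then f x else 0))"
      by (intro sum.cong) (auto simp: algebra_simps)
    also have "\<dots> = (\<Sum>x\<in>B. real (count A x) * f x) + f a"
      using add.prems that(1) by (simp add: sum.distrib)
    finally show ?case using add by simp
  qed simp
  then show ?thesis by simp
qed

lemma integral_uniform_mset_measure:
  fixes f :: "complex \<Rightarrow> real"
  assumes "A \<noteq> {#}" "f \<in> borel_measurable borel"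
  shows "(LINT x|uniform_mset_measure A. f x) = mavg A f"
proof -
  have "(LINT x|uniform_mset_measure A. f x) = (LINT x|measure_pmf (pmf_of_multiset A). f x)"
    unfolding uniform_mset_measure_def using assms by (subst integral_distr) auto
  also have "\<dots> = (\<Sum>x\<in>set_mset A. f x * pmf (pmf_of_multiset A) x)"
    using assms by (intro integral_measure_pmf_real) auto
  also have "\<dots> = mavg A f"
    using assms by (simp add: mavg_def sum_mset_count sum_divide_distrib mult.commute)
  finally show ?thesis .
qed

subsection \<open>Convergence in probability\<close>

text \<open>Outer probability tending to 0, expressed by measurable covers; the roots of the
  derivatives are thus never shown to depend measurably on the outcome.\<close>

definition vanishing :: "'w measure \<Rightarrow> (nat \<Rightarrow> 'w set) \<Rightarrow> bool" where
  "vanishing M E \<longleftrightarrow> (\<forall>\<theta>>0. \<forall>\<^sub>F n in sequentially. \<exists>B\<in>sets M. E n \<subseteq> B \<and> measure M B \<le> \<theta>)"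

lemma vanishing_mono:
  assumes "vanishing M E" "\<forall>\<^sub>F n in sequentially. F n \<subseteq> E n"
  shows "vanishing M F"
  unfolding vanishing_def
proof (intro allI impI)
  fix \<theta> :: real assume "\<theta> > 0"
  with assms(1) have "\<forall>\<^sub>F n in sequentially. \<exists>B\<in>sets M. E n \<subseteq> B \<and> measure M B \<le> \<theta>"
    by (auto simp: vanishing_def)
  with assms(2) show "\<forall>\<^sub>F n in sequentially. \<exists>B\<in>sets M. F n \<subseteq> B \<and> measure M B \<le> \<theta>"
    by eventually_elim blast
qed

lemma vanishing_Un:
  assumes "vanishing M E" "vanishing M F"
  shows "vanishing M (\<lambda>n. E n \<union> F n)"
  unfolding vanishing_def
proof (intro allI impI)
  fix \<theta> :: real assume "\<theta> > 0"
  then have "\<theta> / 2 > 0" by simp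
  with assms have "\<forall>\<^sub>F n in sequentially. \<exists>B\<in>sets M. E n \<subseteq> B \<and> measure M B \<le> \<theta> / 2"
    "\<forall>\<^sub>F n in sequentially. \<exists>B\<in>sets M. F n \<subseteq> B \<and> measure M B \<le> \<theta> / 2"
    unfolding vanishing_def by blast+
  then show "\<forall>\<^sub>F n in sequentially. \<exists>B\<in>sets M. E n \<union> F n \<subseteq> B \<and> measure M B \<le> \<theta>"
  proof eventually_elim
    case (elim n)
    then obtain B B' where B: "B \<in> sets M" "E n \<subseteq> B" "measure M B \<le> \<theta> / 2"
      "B' \<in> sets M" "F n \<subseteq> B'" "measure M B' \<le> \<theta> / 2" by blast
    then have "measure M (B \<union> B') \<le> \<theta>" using measure_Un_le[of B M B'] by linarith
    then show ?case using B by (intro bexI[of _ "B \<union> B'"]) auto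
  qed
qed

lemma vanishing_outer_measure:
  assumes "finite_measure M" "vanishing M E"
  shows "(\<lambda>n. outer_measure_of M (E n)) \<longlonglongrightarrow> 0"
proof (rule order_tendstoI)
  fix c :: ennreal assume "0 < c"
  then obtain d where d: "0 < d" "d < c" using dense by blast
  define \<theta> where "\<theta> = enn2real d"
  have fin: "d \<noteq> \<top>" using d by auto
  have \<theta>: "\<theta> > 0" "ennreal \<theta> = d"
    using d fin by (auto simp: \<theta>_def enn2real_positive_iff top.not_eq_extremum)
  have "\<forall>\<^sub>F n in sequentially. \<exists>B\<in>sets M. E n \<subseteq> B \<and> measure M B \<le> \<theta>"
    using assms \<theta> by (auto simp: vanishing_def)
  then show "\<forall>\<^sub>F n in sequentially. outer_measure_of M (E n) < c"
  proof eventually_elim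
    case (elim n)
    then obtain B where B: "B \<in> sets M" "E n \<subseteq> B" "measure M B \<le> \<theta>" by blast
    have "outer_measure_of M (E n) \<le> outer_measure_of M B" by (rule outer_measure_of_mono) fact
    also have "\<dots> = ennreal (measure M B)"
      using B finite_measure.emeasure_eq_measure[OF assms(1)] by simp
    also have "\<dots> \<le> d" using B \<theta> by (metis ennreal_leI)
    finally show ?case using d by simp
  qed
qed simp

text \<open>Induction over the generated topology: missing an intersection is a union of two
  vanishing events, missing a union is contained in missing one member, and missing a basic set is a
  deviation of one test function, reduced to compact support by truncation.\<close>

lemma converges_in_prob_weakI:
  fixes X :: "nat \<Rightarrow> 'w \<Rightarrow> complex measure"
  assumes M: "finite_measure M" and \<mu>: "prob_space \<mu>" "sets \<mu> = sets borel"
    and X: "\<And>n \<omega>. prob_space (X n \<omega>)" "\<And>n \<omega>. sets (X n \<omega>) = sets borel"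
    and van: "\<And>g \<epsilon>. compact_supp g \<Longrightarrow> \<epsilon> > 0 \<Longrightarrow>
      vanishing M (\<lambda>n. {\<omega>\<in>space M. \<not> \<bar>(LINT x|X n \<omega>. g x) - (LINT x|\<mu>. g x)\<bar> < \<epsilon>})"
  shows "converges_in_prob M weak_topology X \<mu>"
proof -
  have bdd: "vanishing M (\<lambda>n. {\<omega>\<in>space M. \<not> \<bar>(LINT x|X n \<omega>. f x) - (LINT x|\<mu>. f x)\<bar> < \<epsilon>})"
    if f: "continuous_on UNIV f" "bounded (range f)" "\<epsilon> > 0" for f :: "complex \<Rightarrow> real" and \<epsilon>
  proof -
    obtain g h \<epsilon>' where gh: "compact_supp g" "compact_supp h" "\<epsilon>' > 0"
      "\<And>\<nu>. prob_space \<nu> \<Longrightarrow> sets \<nu> = sets borel \<Longrightarrow>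
        \<bar>(LINT x|\<nu>. g x) - (LINT x|\<mu>. g x)\<bar> < \<epsilon>' \<Longrightarrow> \<bar>(LINT x|\<nu>. h x) - (LINT x|\<mu>. h x)\<bar> < \<epsilon>' \<Longrightarrow>
        \<bar>(LINT x|\<nu>. f x) - (LINT x|\<mu>. f x)\<bar> < \<epsilon>"
      using weak_test_reduction[OF \<mu> f] by blast
    show ?thesis
      by (rule vanishing_mono[OF vanishing_Un[OF van[OF gh(1,3)] van[OF gh(2,3)]]])
         (use gh(4) X in \<open>auto intro!: always_eventually\<close>)
  qed
  have "\<mu> \<in> U \<longrightarrow> vanishing M (\<lambda>n. {\<omega>\<in>space M. X n \<omega> \<notin> U})" if "openin weak_topology U" for U
    using that[unfolded weak_topology_def openin_topology_generated_by_iff]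
  proof (induction U rule: generate_topology_on.induct)
    case (Int A B)
    show ?case
    proof
      assume "\<mu> \<in> A \<inter> B"
      then have "vanishing M (\<lambda>n. {\<omega>\<in>space M. X n \<omega> \<notin> A} \<union> {\<omega>\<in>space M. X n \<omega> \<notin> B})"
        using Int by (intro vanishing_Un) auto
      then show "vanishing M (\<lambda>n. {\<omega>\<in>space M. X n \<omega> \<notin> A \<inter> B})"
        by (rule vanishing_mono) (auto intro!: always_eventually)
    qed
  next
    case (UN K)
    show ?case
    proof
      assume "\<mu> \<in> \<Union>K"
      then obtain A where "A \<in> K" "\<mu> \<in> A" by blast
      with UN have "vanishing M (\<lambda>n. {\<omega>\<in>space M. X n \<omega> \<notin> A})" by blast
      then show "vanishing M (\<lambda>n. {\<omega>\<in>space M. X n \<omega> \<notin> \<Union>K})"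
        by (rule vanishing_mono) (use \<open>A \<in> K\<close> in \<open>auto intro!: always_eventually\<close>)
    qed
  next
    case (Basis s)
    then obtain f :: "complex \<Rightarrow> real" and V where s:
      "s = {\<nu>. prob_space \<nu> \<and> sets \<nu> = sets borel \<and> (LINT x|\<nu>. f x) \<in> V}"
      "continuous_on UNIV f" "bounded (range f)" "open V" by blast
    show ?case
    proof
      assume "\<mu> \<in> s"
      then obtain \<epsilon> where \<epsilon>: "\<epsilon> > 0" "\<And>y. \<bar>y - (LINT x|\<mu>. f x)\<bar> < \<epsilon> \<Longrightarrow> y \<in> V"
        using s(1,4) unfolding open_dist by (auto simp: dist_real_def)
      show "vanishing M (\<lambda>n. {\<omega>\<in>space M. X n \<omega> \<notin> s})"
        by (rule vanishing_mono[OF bdd[OF s(2,3) \<epsilon>(1)]])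
           (use \<epsilon>(2) X s(1) in \<open>auto intro!: always_eventually\<close>)
    qed
  qed simp
  then show ?thesis
    unfolding converges_in_prob_def using \<mu> vanishing_outer_measure[OF M]
    by (auto simp: topspace_weak_topology)
qed

subsection \<open>Random choices\<close>

context array_pair
begin

text \<open>The convolution estimate bounds the difference of averages by an integral over centres
  in a fixed disc; exchanging it with the coin average leaves the kernel estimate, which is uniform
  on that disc.\<close>

lemma pavg_mavg_close:
  assumes g: "compact_supp g" and \<epsilon>: "\<epsilon> > 0"
  shows "\<forall>\<^sub>F n in sequentially. pavg {1..n} (\<lambda>S.
     \<bar>mavg (choice_roots k n S) g -
      mavg (proots (root_poly n (choice n S))) g\<bar>) \<le> \<epsilon>"
proof -
  obtain F where F: "\<And>x. \<bar>g x\<bar> \<le> F" using compact_supp_bounded[OF g] by blast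
  have F0: "F \<ge> 0" using F[of 0] by linarith
  obtain R' where R': "\<And>z. cmod z > R' \<Longrightarrow> g z = 0" and cont: "continuous_on UNIV g"
    using g by (auto simp: compact_supp_def)
  define R where "R = max R' 0"
  have R: "\<And>z. cmod z > R \<Longrightarrow> g z = 0" "R \<ge> 0" using R' by (auto simp: R_def)
  obtain d where d: "d > 0" "\<And>x y. cmod (x - y) \<le> d \<Longrightarrow> \<bar>g x - g y\<bar> \<le> \<epsilon> / 4"
    using compact_supp_uniformly_continuous[OF g, of "\<epsilon> / 4"] \<epsilon> by auto
  \<comment> \<open>The kernel lives on radius \<open>2 * \<rho> = d\<close>, within which g varies
    by at most \<epsilon>/4.\<close>
  define \<rho> where "\<rho> = d / 2"
  have \<rho>: "\<rho> > 0" "2 * \<rho> = d" using d by (auto simp: \<rho>_def)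
  define V where "V = measure lborel (cball (0::complex) R)"
  have V: "V \<ge> 0" by (simp add: V_def)
  have Z: "kern_mass \<rho> > 0" by (rule kern_mass_pos[OF \<rho>(1)])
  define W where "W = F / kern_mass \<rho>"
  have W: "W \<ge> 0" using F0 Z by (simp add: W_def)
  \<comment> \<open>Smoothing g uses \<epsilon>/2 and the centre integral the other half; the added
    1 covers \<open>W * V = 0\<close>.\<close>
  define \<epsilon>' where "\<epsilon>' = \<epsilon> / (2 * (W * V + 1))"
  have WV: "W * V \<ge> 0" using W V by simp
  have \<epsilon>': "\<epsilon>' > 0" "W * (V * \<epsilon>') \<le> \<epsilon> / 2"
  proof -
    show "\<epsilon>' > 0" using \<epsilon> WV by (simp add: \<epsilon>'_def)
    have "(W * V) * \<epsilon> \<le> (W * V + 1) * \<epsilon>" using \<epsilon> by (intro mult_right_mono) auto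
    then show "W * (V * \<epsilon>') \<le> \<epsilon> / 2" using WV by (simp add: \<epsilon>'_def field_simps)
  qed
  have fin: "emeasure lborel (cball (0::complex) R) < \<infinity>" by (intro emeasure_bounded_finite) auto
  have iR: "integrable lborel (indicator (cball (0::complex) R) :: complex \<Rightarrow> real)"
    using fin by (auto simp: integrable_indicator_iff)
  show ?thesis
    using mavg_kern_close[OF \<epsilon>'(1) \<rho>(1) R(2), of k]
  proof eventually_elim
    case (elim n)
    define A where "A S = choice_roots k n S" for S
    define B where "B S = proots (root_poly n (choice n S))" for S
    define D where "D S c = indicator (cball 0 R) c *
      \<bar>mavg (A S) (\<lambda>y. kern \<rho> (y - c)) - mavg (B S) (\<lambda>y. kern \<rho> (y - c))\<bar>" for S c
    have iD: "integrable lborel (D S)" for S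
      unfolding D_def by (rule kern_mavg_diff_integrable[OF \<rho>(1)])
    have "pavg {1..n} (\<lambda>S. \<bar>mavg (A S) g - mavg (B S) g\<bar>) \<le>
          pavg {1..n} (\<lambda>S. 2 * (\<epsilon> / 4) + W * (LINT c|lborel. D S c))"
      unfolding W_def D_def
      by (intro pavg_mono mavg_convolution_le cont F R(1) \<rho>(1)) (use d \<rho> \<epsilon> in auto)
    also have "\<dots> = \<epsilon> / 2 + W * (LINT c|lborel. pavg {1..n} (\<lambda>S. D S c))"
      using pavg_integral(2)[of "{1..n}" lborel D, OF iD] by (simp add: pavg_add pavg_cmult)
    also have "(LINT c|lborel. pavg {1..n} (\<lambda>S. D S c)) \<le> (LINT c|lborel. \<epsilon>' * indicator (cball (0::complex) R) c)"
    proof (rule integral_mono)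
      show "integrable lborel (\<lambda>c. pavg {1..n} (\<lambda>S. D S c))" by (rule pavg_integral(1)) (rule iD)
      show "integrable lborel (\<lambda>c. \<epsilon>' * indicator (cball (0::complex) R) c :: real)" using iR by simp
      fix c :: complex
      show "pavg {1..n} (\<lambda>S. D S c) \<le> \<epsilon>' * indicator (cball 0 R) c"
      proof (cases "cmod c \<le> R")
        case True
        then show ?thesis using elim unfolding D_def A_def B_def by simp
      qed (simp add: D_def)
    qed
    also have "\<dots> = V * \<epsilon>'" by (simp add: V_def)
    finally have "pavg {1..n} (\<lambda>S. \<bar>mavg (A S) g - mavg (B S) g\<bar>) \<le> \<epsilon> / 2 + W * (V * \<epsilon>')"
      using W by (simp add: mult_left_mono)
    also have "\<dots> \<le> \<epsilon>" using \<epsilon>' by simp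
    finally show ?case unfolding A_def B_def .
  qed
qed

end

lemma root_poly_cong: "(\<And>i. i \<in> {1..n} \<Longrightarrow> x i = y i) \<Longrightarrow> root_poly n x = root_poly n y"
  unfolding root_poly_def by (intro prod.cong) auto

lemma measurable_compact_supp: "compact_supp g \<Longrightarrow> g \<in> borel_measurable borel"
  by (auto simp: compact_supp_def intro: borel_measurable_continuous_onI)

lemma integral_zeros_measure:
  assumes "k < n" "g \<in> borel_measurable borel"
  shows "(LINT z|zeros_measure ((pderiv ^^ k) (root_poly n x)). g z) =
           mavg (proots ((pderiv ^^ k) (root_poly n x))) g"
proof -
  have "size (proots ((pderiv ^^ k) (root_poly n x))) > 0"
    using assms by (simp add: size_proots_complex higher_pderiv_root_poly_degree)
  then have "proots ((pderiv ^^ k) (root_poly n x)) \<noteq> {#}" by auto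
  then show ?thesis
    unfolding zeros_measure_def using assms by (intro integral_uniform_mset_measure)
qed

text \<open>\<open>eventually_distinct\<close> also stems from the o(n^2) condition, where a
  coincidence would contribute an infinite term. It makes the subset of indices at which
  \<open>a\<close> was chosen readable from the values.\<close>

locale random_choice = array_pair a b C + prob_space M
  for a b :: "nat \<Rightarrow> nat \<Rightarrow> complex" and C :: real and M :: "'w measure" +
  fixes \<xi> :: "nat \<Rightarrow> nat \<Rightarrow> 'w \<Rightarrow> complex" and \<mu> :: "complex measure"
  assumes prob_\<mu>: "prob_space \<mu>" and sets_\<mu>: "sets \<mu> = sets borel"
    and mean_a: "\<And>g :: complex \<Rightarrow> real. continuous_on UNIV g \<Longrightarrow> bounded (range g) \<Longrightarrow>
      (\<lambda>n. (\<Sum>i=1..n. g (a n i)) / real n) \<longlonglongrightarrow> (LINT z|\<mu>. g z)"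
    and mean_b: "\<And>g :: complex \<Rightarrow> real. continuous_on UNIV g \<Longrightarrow> bounded (range g) \<Longrightarrow>
      (\<lambda>n. (\<Sum>i=1..n. g (b n i)) / real n) \<longlonglongrightarrow> (LINT z|\<mu>. g z)"
    and eventually_distinct: "\<forall>\<^sub>F n in sequentially. \<forall>i\<in>{1..n}. a n i \<noteq> b n i"
    and indep: "\<And>n. n \<ge> 1 \<Longrightarrow> indep_vars (\<lambda>_. borel) (\<xi> n) {1..n}"
    and law: "\<And>n j. 1 \<le> j \<Longrightarrow> j \<le> n \<Longrightarrow> distr M borel (\<xi> n j) =
       distr (measure_pmf (bernoulli_pmf (1/2))) borel (\<lambda>c. if c then a n j else b n j)"
begin

abbreviation deriv_roots :: "nat \<Rightarrow> nat \<Rightarrow> 'w \<Rightarrow> complex multiset" where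
  "deriv_roots k n \<omega> \<equiv> proots ((pderiv ^^ k) (root_poly n (\<lambda>j. \<xi> n j \<omega>)))"

section \<open>The random roots as a uniformly chosen subset\<close>

lemma rv_\<xi>: "i \<in> {1..n} \<Longrightarrow> \<xi> n i \<in> borel_measurable M"
  using indep[of n] by (auto simp: indep_vars_def)

lemma expectation_\<xi>:
  assumes i: "i \<in> {1..n}" and g: "g \<in> borel_measurable borel"
  shows "expectation (\<lambda>\<omega>. g (\<xi> n i \<omega>)) = ((g (a n i) + g (b n i)) / 2 :: real)"
proof -
  have "expectation (\<lambda>\<omega>. g (\<xi> n i \<omega>)) = (LINT z|distr M borel (\<xi> n i). g z)"
    using rv_\<xi>[OF i] g by (subst integral_distr) auto
  also have "\<dots> = (LINT c|measure_pmf (bernoulli_pmf (1/2)). g (if c then a n i else b n i))"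
    using i g by (subst law) (auto simp: integral_distr)
  also have "\<dots> = (g (a n i) + g (b n i)) / 2" by simp
  finally show ?thesis .
qed

lemma prob_\<xi>:
  assumes i: "i \<in> {1..n}" and X: "X \<in> sets borel"
  shows "prob (\<xi> n i -` X \<inter> space M) = (indicator X (a n i) + indicator X (b n i)) / 2"
proof -
  have m: "\<xi> n i -` X \<inter> space M \<in> sets M" using rv_\<xi>[OF i] X by (rule measurable_sets)
  have "prob (\<xi> n i -` X \<inter> space M) = expectation (indicator (\<xi> n i -` X \<inter> space M))" using m by simp
  also have "\<dots> = expectation (\<lambda>\<omega>. indicator X (\<xi> n i \<omega>))"
    by (intro Bochner_Integration.integral_cong) (auto simp: indicator_def)
  also have "\<dots> = (indicator X (a n i) + indicator X (b n i)) / 2"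
    by (rule expectation_\<xi>[OF i]) (use X in simp)
  finally show ?thesis .
qed

lemma AE_choice:
  "AE \<omega> in M. \<exists>S\<subseteq>{1..n}. \<forall>i\<in>{1..n}. \<xi> n i \<omega> = choice n S i"
proof -
  have "AE \<omega> in M. \<forall>i\<in>{1..n}. \<xi> n i \<omega> \<in> {a n i, b n i}"
  proof (rule AE_finite_allI)
    fix i assume i: "i \<in> {1..n}"
    have "prob (\<xi> n i -` {a n i, b n i} \<inter> space M) = 1"
      using prob_\<xi>[OF i, of "{a n i, b n i}"] by simp
    then have "AE \<omega> in M. \<omega> \<in> \<xi> n i -` {a n i, b n i} \<inter> space M" by (rule AE_prob_1)
    then show "AE \<omega> in M. \<xi> n i \<omega> \<in> {a n i, b n i}" by eventually_elim auto
  qed simp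
  then show ?thesis
  proof eventually_elim
    case (elim \<omega>)
    then show ?case
      by (intro exI[of _ "{i\<in>{1..n}. \<xi> n i \<omega> = a n i}"]) (auto simp: choice_def)
  qed
qed

definition outcome :: "nat \<Rightarrow> nat set \<Rightarrow> 'w set" where
  "outcome n S = (\<Inter>i\<in>{1..n}. \<xi> n i -` {choice n S i} \<inter> space M)"

lemma sets_outcome: "n \<ge> 1 \<Longrightarrow> outcome n S \<in> sets M"
  unfolding outcome_def by (intro sets.finite_INT measurable_sets[OF rv_\<xi>]) auto

text \<open>Independence factors the probability, and since the two values differ each is taken with
  probability exactly 1/2.\<close>

lemma prob_outcome:
  assumes n: "n \<ge> 1" and ne: "\<forall>i\<in>{1..n}. a n i \<noteq> b n i"
  shows "prob (outcome n S) = 1 / 2 ^ n"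
proof -
  have "prob (outcome n S) = (\<Prod>i\<in>{1..n}. prob (\<xi> n i -` {choice n S i} \<inter> space M))"
    unfolding outcome_def by (rule indep_varsD_finite[OF indep[OF n]]) (use n in auto)
  also have "\<dots> = (\<Prod>i\<in>{1..n}. 1 / 2)"
  proof (rule prod.cong)
    fix i assume i: "i \<in> {1..n}"
    show "prob (\<xi> n i -` {choice n S i} \<inter> space M) = 1 / 2"
      using bspec[OF ne i] by (subst prob_\<xi>[OF i]) (auto simp: choice_def indicator_def)
  qed simp
  finally show ?thesis by (simp add: power_divide)
qed

text \<open>The transfer from coin averages to \<open>M\<close>: a union bound over the bad
  outcomes, each of mass 2^(-n), plus a null set off which the roots are given by some subset. The
  exceptional set is measurable, as \<open>vanishing\<close> demands.\<close>

lemma prob_choice_le: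
  assumes n: "n \<ge> 1" and ne: "\<forall>i\<in>{1..n}. a n i \<noteq> b n i"
  shows "\<exists>B\<in>sets M. prob B \<le> pavg {1..n} (\<lambda>S. of_bool (Q S)) \<and>
     (\<forall>\<omega>\<in>space M - B. \<exists>S\<subseteq>{1..n}. \<not> Q S \<and> (\<forall>i\<in>{1..n}. \<xi> n i \<omega> = choice n S i))"
proof -
  obtain N where N: "{\<omega>\<in>space M. \<not> (\<exists>S\<subseteq>{1..n}. \<forall>i\<in>{1..n}. \<xi> n i \<omega> = choice n S i)} \<subseteq> N"
    "emeasure M N = 0" "N \<in> sets M"
    using AE_E[OF AE_choice[of n]] .
  define T where "T = {S\<in>Pow {1..n}. Q S}"
  define B where "B = (\<Union>S\<in>T. outcome n S) \<union> N"
  have finT: "finite T" by (simp add: T_def)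
  have U: "(\<Union>S\<in>T. outcome n S) \<in> sets M" using finT sets_outcome[OF n] by auto
  have "prob B \<le> prob (\<Union>S\<in>T. outcome n S) + prob N"
    unfolding B_def by (rule measure_Un_le) (use U N in auto)
  also have "prob N = 0" using N by (simp add: measure_def)
  also have "prob (\<Union>S\<in>T. outcome n S) \<le> (\<Sum>S\<in>T. prob (outcome n S))"
    by (rule finite_measure_subadditive_finite) (use finT sets_outcome[OF n] in auto)
  also have "\<dots> = real (card T) / 2 ^ n" by (simp add: prob_outcome[OF n ne])
  also have "\<dots> = pavg {1..n} (\<lambda>S. of_bool (Q S))"
    by (simp add: pavg_def T_def Int_def)
  finally have "prob B \<le> pavg {1..n} (\<lambda>S. of_bool (Q S))" by simp
  moreover have "B \<in> sets M" using U N by (auto simp: B_def)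
  moreover have "\<exists>S\<subseteq>{1..n}. \<not> Q S \<and> (\<forall>i\<in>{1..n}. \<xi> n i \<omega> = choice n S i)" if "\<omega> \<in> space M - B" for \<omega>
  proof -
    have "\<exists>S\<subseteq>{1..n}. \<forall>i\<in>{1..n}. \<xi> n i \<omega> = choice n S i"
      using that N(1) unfolding B_def by blast
    then obtain S where S: "S \<subseteq> {1..n}" "\<forall>i\<in>{1..n}. \<xi> n i \<omega> = choice n S i" by blast
    then have "\<omega> \<in> outcome n S" using that by (auto simp: outcome_def)
    then have "\<not> Q S" using that S by (auto simp: B_def T_def)
    then show ?thesis using S by blast
  qed
  ultimately show ?thesis by blast
qed

section \<open>Law of large numbers for the roots\<close>

definition emp :: "nat \<Rightarrow> 'w \<Rightarrow> complex multiset" where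
  "emp n \<omega> = image_mset (\<lambda>i. \<xi> n i \<omega>) (mset_set {1..n})"

text \<open>Averaging g over both arrays together is the expectation of its average over the random
  roots, so this is the deterministic centring for Hoeffding's inequality.\<close>

definition mid :: "nat \<Rightarrow> complex multiset" where
  "mid n = image_mset (a n) (mset_set {1..n}) + image_mset (b n) (mset_set {1..n})"

lemma mavg_emp: "mavg (emp n \<omega>) g = (\<Sum>i=1..n. g (\<xi> n i \<omega>)) / real n"
  unfolding mavg_def emp_def sum_mset_sum by simp

lemma mavg_mid: "mavg (mid n) g = ((\<Sum>i=1..n. g (a n i)) + (\<Sum>i=1..n. g (b n i))) / (2 * real n)"
  unfolding mavg_def mid_def image_mset_union sum_mset.union sum_mset_sum by simp

lemma mavg_mid_tendsto:
  fixes g :: "complex \<Rightarrow> real"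
  assumes "continuous_on UNIV g" "bounded (range g)"
  shows "(\<lambda>n. mavg (mid n) g) \<longlonglongrightarrow> (LINT z|\<mu>. g z)"
proof -
  have "(\<lambda>n. ((\<Sum>i=1..n. g (a n i)) / real n + (\<Sum>i=1..n. g (b n i)) / real n) / 2)
      \<longlonglongrightarrow> ((LINT z|\<mu>. g z) + (LINT z|\<mu>. g z)) / 2"
    by (intro tendsto_intros mean_a mean_b assms) simp
  then show ?thesis unfolding mavg_mid by (simp add: add_divide_distrib mult.commute)
qed

lemma sets_deviation:
  assumes "g \<in> borel_measurable borel"
  shows "{\<omega>\<in>space M. \<bar>mavg (emp n \<omega>) g - mavg (mid n) g\<bar> \<ge> \<epsilon>} \<in> sets M"
proof -
  have "(\<lambda>\<omega>. \<Sum>i=1..n. g (\<xi> n i \<omega>)) \<in> borel_measurable M"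
    by (intro borel_measurable_sum measurable_compose[OF rv_\<xi> assms])
  then show ?thesis unfolding mavg_emp by measurable
qed

lemma prob_deviation_le:
  assumes n: "n \<ge> 1" and g: "g \<in> borel_measurable borel" and F: "F > 0" "\<And>z. \<bar>g z\<bar> \<le> F" and \<epsilon>: "\<epsilon> \<ge> 0"
  shows "prob {\<omega>\<in>space M. \<bar>mavg (emp n \<omega>) g - mavg (mid n) g\<bar> \<ge> \<epsilon>} \<le>
           2 * exp (- (\<epsilon>\<^sup>2 / (2 * F\<^sup>2)) * real n)"
proof -
  define m where "m = (\<Sum>i\<in>{1..n}. expectation (\<lambda>\<omega>. g (\<xi> n i \<omega>)))"
  interpret H: Hoeffding_ineq M "{1..n}" "\<lambda>i \<omega>. g (\<xi> n i \<omega>)" "\<lambda>_. - F" "\<lambda>_. F" m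
  proof unfold_locales
    show "indep_vars (\<lambda>_. borel) (\<lambda>i \<omega>. g (\<xi> n i \<omega>)) {1..n}"
      by (rule indep_vars_compose2[OF indep[OF n]]) (use g in simp)
    show "AE \<omega> in M. g (\<xi> n i \<omega>) \<in> {- F..F}" for i
      using F(2) by (intro AE_I2) (simp add: abs_le_iff minus_le_iff)
  qed (auto simp: m_def)
  have m: "m = (\<Sum>i=1..n. (g (a n i) + g (b n i)) / 2)"
    unfolding m_def by (intro sum.cong expectation_\<xi> g) auto
  have eq: "\<bar>mavg (emp n \<omega>) g - mavg (mid n) g\<bar> \<ge> \<epsilon> \<longleftrightarrow> \<bar>(\<Sum>i\<in>{1..n}. g (\<xi> n i \<omega>)) - m\<bar> \<ge> \<epsilon> * real n" for \<omega>
  proof -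
    have "mavg (emp n \<omega>) g - mavg (mid n) g = ((\<Sum>i\<in>{1..n}. g (\<xi> n i \<omega>)) - m) / real n"
      unfolding mavg_emp mavg_mid m by (simp add: sum.distrib diff_divide_distrib flip: sum_divide_distrib)
    then show ?thesis using n by (simp add: abs_divide le_divide_eq)
  qed
  have s: "(\<Sum>i\<in>{1..n}. (F - - F)\<^sup>2) = real n * (4 * F\<^sup>2)" by (simp add: power2_eq_square)
  have "prob {\<omega>\<in>space M. \<bar>(\<Sum>i\<in>{1..n}. g (\<xi> n i \<omega>)) - m\<bar> \<ge> \<epsilon> * real n} \<le>
      2 * exp (- 2 * (\<epsilon> * real n)\<^sup>2 / (\<Sum>i\<in>{1..n}. (F - - F)\<^sup>2))"
  proof (rule H.Hoeffding_ineq_abs_ge)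
    show "0 < (\<Sum>i\<in>{1..n}. (F - - F)\<^sup>2)" unfolding s using n F by simp
  qed (use \<epsilon> in simp)
  also have "- 2 * (\<epsilon> * real n)\<^sup>2 / (\<Sum>i\<in>{1..n}. (F - - F)\<^sup>2) = - (\<epsilon>\<^sup>2 / (2 * F\<^sup>2)) * real n"
    unfolding s using n F by (simp add: power2_eq_square field_simps)
  finally show ?thesis unfolding eq .
qed

lemma deviation_vanishing:
  assumes g: "g \<in> borel_measurable borel" and F: "\<And>z. \<bar>g z\<bar> \<le> F" and \<epsilon>: "\<epsilon> > 0"
  shows "vanishing M (\<lambda>n. {\<omega>\<in>space M. \<bar>mavg (emp n \<omega>) g - mavg (mid n) g\<bar> \<ge> \<epsilon>})"
  unfolding vanishing_def
proof (intro allI impI)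
  fix \<theta> :: real assume \<theta>: "\<theta> > 0"
  \<comment> \<open>A strictly positive bound, as the exponent divides by its square.\<close>
  define F' where "F' = \<bar>F\<bar> + 1"
  have F': "F' > 0" "\<bar>g z\<bar> \<le> F'" for z using F[of z] by (auto simp: F'_def)
  define c where "c = \<epsilon>\<^sup>2 / (2 * F'\<^sup>2)"
  have c: "c > 0" using \<epsilon> F' by (simp add: c_def)
  have "\<forall>\<^sub>F n in sequentially. 2 * exp (- c * real n) < \<theta>"
  proof (rule order_tendstoD)
    show "(\<lambda>n. 2 * exp (- c * real n)) \<longlonglongrightarrow> 0" using c by real_asymp
  qed fact
  then show "\<forall>\<^sub>F n in sequentially. \<exists>B\<in>sets M.
      {\<omega>\<in>space M. \<bar>mavg (emp n \<omega>) g - mavg (mid n) g\<bar> \<ge> \<epsilon>} \<subseteq> B \<and> prob B \<le> \<theta>"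
    using eventually_ge_at_top[of 1]
  proof eventually_elim
    case (elim n)
    then show ?case
      using prob_deviation_le[OF _ g F', where n = n and \<epsilon> = \<epsilon>] \<epsilon> sets_deviation[OF g, where n = n and \<epsilon> = \<epsilon>]
      by (intro bexI[of _ "{\<omega>\<in>space M. \<bar>mavg (emp n \<omega>) g - mavg (mid n) g\<bar> \<ge> \<epsilon>}"])
         (auto simp: c_def)
  qed
qed

text \<open>The Hoeffding bounds are summable, so Borel-Cantelli applies at each threshold 1/(m+1),
  and countably many thresholds give convergence. The null set still depends on g.\<close>

lemma deviation_AE:
  assumes g: "g \<in> borel_measurable borel" and F: "\<And>z. \<bar>g z\<bar> \<le> F"
  shows "AE \<omega> in M. (\<lambda>n. mavg (emp n \<omega>) g - mavg (mid n) g) \<longlonglongrightarrow> 0"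
proof -
  define F' where "F' = \<bar>F\<bar> + 1"
  have F': "F' > 0" "\<bar>g z\<bar> \<le> F'" for z using F[of z] by (auto simp: F'_def)
  define A where "A \<epsilon> n = {\<omega>\<in>space M. \<bar>mavg (emp n \<omega>) g - mavg (mid n) g\<bar> \<ge> \<epsilon>}" for \<epsilon> :: real and n
  have "AE \<omega> in M. \<forall>\<^sub>F n in sequentially. \<omega> \<in> space M - A \<epsilon> n" if \<epsilon>: "\<epsilon> > 0" for \<epsilon>
  proof (rule borel_cantelli_AE1)
    show "A \<epsilon> n \<in> sets M" for n unfolding A_def by (rule sets_deviation[OF g])
    show "emeasure M (A \<epsilon> n) < \<infinity>" for n by (simp add: emeasure_eq_measure)
    define c where "c = \<epsilon>\<^sup>2 / (2 * F'\<^sup>2)"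
    have c: "c > 0" using \<epsilon> F' by (simp add: c_def)
    have "exp (- c * real n) = exp (- c) ^ n" for n
      by (simp add: mult.commute flip: exp_of_nat_mult)
    then have "summable (\<lambda>n. 2 * exp (- c * real n))"
      using c by (intro summable_mult) (simp add: summable_geometric)
    then show "summable (\<lambda>n. prob (A \<epsilon> n))"
    proof (rule summable_comparison_test_ev[rotated])
      show "\<forall>\<^sub>F n in sequentially. norm (prob (A \<epsilon> n)) \<le> 2 * exp (- c * real n)"
        using eventually_ge_at_top[of 1]
        by eventually_elim (use prob_deviation_le[OF _ g F', where \<epsilon> = \<epsilon>] \<epsilon> in \<open>auto simp: A_def c_def\<close>)
    qed
  qed
  then have "AE \<omega> in M. \<forall>m::nat. \<forall>\<^sub>F n in sequentially. \<omega> \<in> space M - A (1 / real (Suc m)) n"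
    by (subst AE_all_countable) auto
  then show ?thesis
  proof eventually_elim
    case (elim \<omega>)
    show ?case
    proof (rule tendstoI)
      fix e :: real assume "e > 0"
      then obtain m where m: "1 / real (Suc m) < e" using nat_approx_posE by blast
      have "\<forall>\<^sub>F n in sequentially. \<omega> \<in> space M - A (1 / real (Suc m)) n" using elim by blast
      then show "\<forall>\<^sub>F n in sequentially. dist (mavg (emp n \<omega>) g - mavg (mid n) g) 0 < e"
        by eventually_elim (use m in \<open>auto simp: A_def\<close>)
    qed
  qed
qed

section \<open>Roots of the derivatives\<close>

lemma proots_root_poly_\<xi>: "proots (root_poly n (\<lambda>j. \<xi> n j \<omega>)) = emp n \<omega>"
  by (simp add: proots_root_poly emp_def)

text \<open>Markov's inequality for the coin average, then transfer to \<open>M\<close>. The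
  averaged bound \<open>\<epsilon> * \<theta>\<close> leaves probability at most
  \<open>\<theta>\<close>.\<close>

lemma mavg_higher_pderiv_vanishing:
  assumes g: "compact_supp g" and \<epsilon>: "\<epsilon> > 0"
  shows "vanishing M (\<lambda>n. {\<omega>\<in>space M. \<not>
     \<bar>mavg (deriv_roots k n \<omega>) g - mavg (emp n \<omega>) g\<bar> < \<epsilon>})"
  unfolding vanishing_def
proof (intro allI impI)
  fix \<theta> :: real assume \<theta>: "\<theta> > 0"
  have pos: "\<epsilon> * \<theta> > 0" using \<epsilon> \<theta> by simp
  show "\<forall>\<^sub>F n in sequentially. \<exists>B\<in>sets M. {\<omega>\<in>space M. \<not>
     \<bar>mavg (deriv_roots k n \<omega>) g - mavg (emp n \<omega>) g\<bar> < \<epsilon>} \<subseteq> B \<and> prob B \<le> \<theta>"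
    using pavg_mavg_close[OF g pos, of k] eventually_distinct eventually_ge_at_top[of 1]
  proof eventually_elim
    case (elim n)
    define D where "D S = \<bar>mavg (choice_roots k n S) g -
      mavg (proots (root_poly n (choice n S))) g\<bar>" for S
    have "\<epsilon> * pavg {1..n} (\<lambda>S. of_bool (\<not> D S < \<epsilon>)) = pavg {1..n} (\<lambda>S. \<epsilon> * of_bool (\<not> D S < \<epsilon>))"
      by (simp only: pavg_cmult)
    also have "\<dots> \<le> pavg {1..n} D"
      by (intro pavg_mono) (use \<epsilon> in \<open>auto simp: D_def\<close>)
    also have "\<dots> \<le> \<epsilon> * \<theta>" using elim(1) unfolding D_def .
    finally have le: "pavg {1..n} (\<lambda>S. of_bool (\<not> D S < \<epsilon>)) \<le> \<theta>" using \<epsilon> by simp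
    obtain B where B: "B \<in> sets M" "prob B \<le> pavg {1..n} (\<lambda>S. of_bool (\<not> D S < \<epsilon>))"
      "\<forall>\<omega>\<in>space M - B. \<exists>S\<subseteq>{1..n}. \<not> \<not> D S < \<epsilon> \<and> (\<forall>i\<in>{1..n}. \<xi> n i \<omega> = choice n S i)"
      using prob_choice_le[OF elim(3,2), of "\<lambda>S. \<not> D S < \<epsilon>"] by blast
    have "{\<omega>\<in>space M. \<not> \<bar>mavg (deriv_roots k n \<omega>) g - mavg (emp n \<omega>) g\<bar> < \<epsilon>} \<subseteq> B"
    proof
      fix \<omega> assume \<omega>: "\<omega> \<in> {\<omega>\<in>space M. \<not> \<bar>mavg (deriv_roots k n \<omega>) g - mavg (emp n \<omega>) g\<bar> < \<epsilon>}"
      show "\<omega> \<in> B"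
      proof (rule ccontr)
        assume "\<omega> \<notin> B"
        then obtain S where S: "D S < \<epsilon>" "\<forall>i\<in>{1..n}. \<xi> n i \<omega> = choice n S i" using B(3) \<omega> by blast
        have "root_poly n (\<lambda>j. \<xi> n j \<omega>) = root_poly n (choice n S)"
          by (rule root_poly_cong) (use S in auto)
        then show False using \<omega> S(1) unfolding D_def by (simp add: proots_root_poly_\<xi>[symmetric])
      qed
    qed
    then show ?case using B le by (intro bexI[of _ B]) auto
  qed
qed

lemma zeros_measure_prob: "prob_space (zeros_measure p)" "sets (zeros_measure p) = sets borel"
  unfolding zeros_measure_def by (rule prob_space_uniform_mset_measure sets_uniform_mset_measure)+

text \<open>Three errors of \<epsilon>/3: derivative roots against roots, roots against their
  centring, and centring against \<open>\<mu>\<close>.\<close>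

theorem higher_pderiv_converges_in_prob:
  "converges_in_prob M weak_topology
     (\<lambda>n \<omega>. zeros_measure ((pderiv ^^ k) (root_poly n (\<lambda>j. \<xi> n j \<omega>)))) \<mu>"
proof (rule converges_in_prob_weakI[OF finite_measure_axioms prob_\<mu> sets_\<mu>])
  fix g :: "complex \<Rightarrow> real" and \<epsilon> :: real assume g: "compact_supp g" and \<epsilon>: "\<epsilon> > 0"
  have \<epsilon>3: "\<epsilon> / 3 > 0" using \<epsilon> by simp
  obtain F where F: "\<And>z. \<bar>g z\<bar> \<le> F" using compact_supp_bounded[OF g] by blast
  have gm: "g \<in> borel_measurable borel" by (rule measurable_compact_supp[OF g])
  have gc: "continuous_on UNIV g" "bounded (range g)"
    using g F by (auto simp: compact_supp_def bounded_iff)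
  have "\<forall>\<^sub>F n in sequentially. dist (mavg (mid n) g) (LINT z|\<mu>. g z) < \<epsilon> / 3"
    using mavg_mid_tendsto[OF gc] \<epsilon>3 by (rule tendstoD)
  then have "\<forall>\<^sub>F n in sequentially.
    {\<omega>\<in>space M. \<not> \<bar>(LINT x|zeros_measure ((pderiv ^^ k) (root_poly n (\<lambda>j. \<xi> n j \<omega>))). g x) - (LINT x|\<mu>. g x)\<bar> < \<epsilon>}
    \<subseteq> {\<omega>\<in>space M. \<not> \<bar>mavg (deriv_roots k n \<omega>) g - mavg (emp n \<omega>) g\<bar> < \<epsilon> / 3}
      \<union> {\<omega>\<in>space M. \<bar>mavg (emp n \<omega>) g - mavg (mid n) g\<bar> \<ge> \<epsilon> / 3}"
    using eventually_gt_at_top[of k]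
  proof eventually_elim
    case (elim n)
    have mid: "\<bar>mavg (mid n) g - (LINT z|\<mu>. g z)\<bar> < \<epsilon> / 3" using elim(1) by (simp add: dist_real_def)
    show ?case
      unfolding integral_zeros_measure[OF elim(2) gm]
    proof (rule subsetI, rule ccontr)
      fix \<omega>
      let ?u = "mavg (deriv_roots k n \<omega>) g"
      assume \<omega>: "\<omega> \<in> {\<omega>\<in>space M. \<not> \<bar>mavg (deriv_roots k n \<omega>) g - (LINT x|\<mu>. g x)\<bar> < \<epsilon>}"
        and "\<omega> \<notin> {\<omega>\<in>space M. \<not> \<bar>mavg (deriv_roots k n \<omega>) g - mavg (emp n \<omega>) g\<bar> < \<epsilon> / 3}
          \<union> {\<omega>\<in>space M. \<bar>mavg (emp n \<omega>) g - mavg (mid n) g\<bar> \<ge> \<epsilon> / 3}"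
      then have "\<bar>?u - mavg (emp n \<omega>) g\<bar> < \<epsilon> / 3" "\<bar>mavg (emp n \<omega>) g - mavg (mid n) g\<bar> < \<epsilon> / 3"
        by (simp_all add: not_le)
      with mid have "\<bar>?u - (LINT x|\<mu>. g x)\<bar> < \<epsilon>" by linarith
      then show False using \<omega> by simp
    qed
  qed
  with vanishing_Un[OF mavg_higher_pderiv_vanishing[OF g \<epsilon>3] deviation_vanishing[OF gm F \<epsilon>3]]
  show "vanishing M (\<lambda>n. {\<omega>\<in>space M. \<not> \<bar>(LINT x|zeros_measure ((pderiv ^^ k) (root_poly n (\<lambda>j. \<xi> n j \<omega>))). g x) -
      (LINT x|\<mu>. g x)\<bar> < \<epsilon>})"
    by (rule vanishing_mono)
qed (rule zeros_measure_prob)+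

text \<open>Deterministic, for one outcome: countably many kernels control every test function. The
  Lipschitz bound passes from the dense centres to all centres, dominated convergence integrates
  over a disc of centres, and the convolution estimate recovers g.\<close>

lemma emp_converges_on_compact_supp:
  assumes D: "\<And>c. \<And>X. open X \<Longrightarrow> X \<noteq> {} \<Longrightarrow> \<exists>d\<in>D. d \<in> X"
    and conv: "\<And>m d. d \<in> D \<Longrightarrow> (\<lambda>n. mavg (emp n \<omega>) (\<lambda>y. kern (1 / real (Suc m)) (y - d)) -
       mavg (mid n) (\<lambda>y. kern (1 / real (Suc m)) (y - d))) \<longlonglongrightarrow> 0"
    and g: "compact_supp g"
  shows "(\<lambda>n. mavg (emp n \<omega>) g - mavg (mid n) g) \<longlonglongrightarrow> 0"
proof (rule tendstoI)
  fix \<epsilon> :: real assume \<epsilon>: "\<epsilon> > 0"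
  obtain F where F: "\<And>x. \<bar>g x\<bar> \<le> F" using compact_supp_bounded[OF g] by blast
  obtain R where R: "\<And>z. cmod z > R \<Longrightarrow> g z = 0" and cont: "continuous_on UNIV g"
    using g by (auto simp: compact_supp_def)
  obtain d where d: "d > 0" "\<And>x y. cmod (x - y) \<le> d \<Longrightarrow> \<bar>g x - g y\<bar> \<le> \<epsilon> / 4"
    using compact_supp_uniformly_continuous[OF g, of "\<epsilon> / 4"] \<epsilon> by auto
  obtain m where m: "1 / real (Suc m) < d / 2" using nat_approx_posE[of "d / 2"] d by auto
  define \<rho> where "\<rho> = 1 / real (Suc m)"
  have \<rho>: "\<rho> > 0" "2 * \<rho> \<le> d" using m by (auto simp: \<rho>_def)
  define h where "h n c = mavg (emp n \<omega>) (\<lambda>y. kern \<rho> (y - c)) - mavg (mid n) (\<lambda>y. kern \<rho> (y - c))" for n c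
  have hD: "(\<lambda>n. h n c) \<longlonglongrightarrow> 0" if "c \<in> D" for c
    unfolding h_def \<rho>_def by (rule conv[OF that])
  have lip: "\<bar>h n c - h n c'\<bar> \<le> 2 * (2 / \<rho> * cmod (c - c'))" for n c c'
  proof -
    have "\<bar>mavg A (\<lambda>y. kern \<rho> (y - c)) - mavg A (\<lambda>y. kern \<rho> (y - c'))\<bar> \<le> 2 / \<rho> * cmod (c - c')" for A
    proof (rule mavg_diff_le)
      fix y show "\<bar>kern \<rho> (y - c) - kern \<rho> (y - c')\<bar> \<le> 2 / \<rho> * cmod (c - c')"
        using kern_Lipschitz[OF \<rho>(1), of "y - c" "y - c'"] by (simp add: norm_minus_commute)
    qed (use \<rho> in simp)
    from this[of "emp n \<omega>"] this[of "mid n"] show ?thesis unfolding h_def by linarith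
  qed
  have hc: "(\<lambda>n. h n c) \<longlonglongrightarrow> 0" for c
  proof (rule tendstoI)
    fix e :: real assume e: "e > 0"
    \<comment> \<open>The difference of two kernel averages has Lipschitz constant 4/\<rho>, so a
      centre within s changes it by at most e/2.\<close>
    define s where "s = e * \<rho> / 8"
    have s: "s > 0" using e \<rho> by (simp add: s_def)
    then obtain c' where c': "c' \<in> D" "c' \<in> ball c s" using D[of "ball c s"] by auto
    have "2 * (2 / \<rho> * cmod (c - c')) \<le> 2 * (2 / \<rho> * s)"
      using c' \<rho> by (intro mult_left_mono) (auto simp: dist_norm)
    also have "\<dots> = e / 2" using \<rho> by (simp add: s_def)
    finally have near: "2 * (2 / \<rho> * cmod (c - c')) \<le> e / 2" .
    have "\<forall>\<^sub>F n in sequentially. dist (h n c') 0 < e / 2" using hD[OF c'(1)] e by (intro tendstoD) auto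
    then show "\<forall>\<^sub>F n in sequentially. dist (h n c) 0 < e"
    proof eventually_elim
      case (elim n)
      then show ?case using lip[of n c c'] near by (auto simp: dist_real_def)
    qed
  qed
  have hb: "\<bar>h n c\<bar> \<le> ln 2" for n c
    using kern_mavg_bounds[OF \<rho>(1), of "emp n \<omega>" c] kern_mavg_bounds[OF \<rho>(1), of "mid n" c]
    by (simp add: h_def)
  define I where "I n = (LINT c|lborel. indicator (cball 0 R) c * \<bar>h n c\<bar>)" for n
  have "I \<longlonglongrightarrow> (LINT c|(lborel :: complex measure). (0::real))"
    unfolding I_def
  proof (rule integral_dominated_convergence[where w = "\<lambda>c::complex. ln 2 * indicator (cball 0 R) c"])
    have "emeasure lborel (cball (0::complex) R) < \<infinity>" by (intro emeasure_bounded_finite) auto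
    then show "integrable lborel (\<lambda>c::complex. ln 2 * indicator (cball 0 R) c :: real)"
      by (auto simp: integrable_indicator_iff)
    show "(\<lambda>c. indicator (cball 0 R) c * \<bar>h n c\<bar>) \<in> borel_measurable lborel" for n
      unfolding h_def by (rule borel_measurable_integrable[OF kern_mavg_diff_integrable[OF \<rho>(1)]])
    show "AE c in lborel. (\<lambda>n. indicator (cball 0 R) c * \<bar>h n c\<bar>) \<longlonglongrightarrow> 0"
      using hc by (intro AE_I2) (auto intro!: tendsto_eq_intros tendsto_rabs_zero)
    show "AE c in lborel. norm (indicator (cball 0 R) c * \<bar>h n c\<bar>) \<le> ln 2 * indicator (cball 0 R) c" for n
      using hb by (intro AE_I2) (auto simp: indicator_def)
  qed simp
  then have "(\<lambda>n. F / kern_mass \<rho> * I n) \<longlonglongrightarrow> F / kern_mass \<rho> * 0" by (intro tendsto_intros) simp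
  then have "\<forall>\<^sub>F n in sequentially. F / kern_mass \<rho> * I n < \<epsilon> / 2"
    using \<epsilon> by (intro order_tendstoD) auto
  then show "\<forall>\<^sub>F n in sequentially. dist (mavg (emp n \<omega>) g - mavg (mid n) g) 0 < \<epsilon>"
  proof eventually_elim
    case (elim n)
    have "\<bar>mavg (emp n \<omega>) g - mavg (mid n) g\<bar> \<le> 2 * (\<epsilon> / 4) + F / kern_mass \<rho> * I n"
      unfolding I_def h_def
      by (rule mavg_convolution_le[OF cont F R \<rho>(1)]) (use d(2) \<rho> \<epsilon> in auto)
    then have "\<bar>mavg (emp n \<omega>) g - mavg (mid n) g\<bar> < \<epsilon>" using elim by linarith
    then show ?case by (simp add: dist_real_def)
  qed
qed

text \<open>The null set must be fixed before the test function. It is taken for the countably many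
  kernels with centre in a dense set and radius 1/(m+1), after which the argument is
  pathwise.\<close>

theorem zeros_converge_AE:
  "AE \<omega> in M. weakly_converges (\<lambda>n. zeros_measure (root_poly n (\<lambda>j. \<xi> n j \<omega>))) \<mu>"
proof -
  obtain D :: "complex set" where D: "countable D" "\<And>X. open X \<Longrightarrow> X \<noteq> {} \<Longrightarrow> \<exists>d\<in>D. d \<in> X"
    by (rule countable_dense_setE) blast
  have "AE \<omega> in M. \<forall>m::nat. \<forall>d\<in>D. (\<lambda>n. mavg (emp n \<omega>) (\<lambda>y. kern (1 / real (Suc m)) (y - d)) -
       mavg (mid n) (\<lambda>y. kern (1 / real (Suc m)) (y - d))) \<longlonglongrightarrow> 0"
    unfolding AE_all_countable AE_ball_countable[OF D(1)]
  proof (intro allI ballI)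
    fix m :: nat and d :: complex
    have \<rho>: "1 / real (Suc m) > 0" by simp
    show "AE \<omega> in M. (\<lambda>n. mavg (emp n \<omega>) (\<lambda>y. kern (1 / real (Suc m)) (y - d)) -
       mavg (mid n) (\<lambda>y. kern (1 / real (Suc m)) (y - d))) \<longlonglongrightarrow> 0"
    proof (rule deviation_AE)
      show "(\<lambda>y. kern (1 / real (Suc m)) (y - d)) \<in> borel_measurable borel"
        by (intro borel_measurable_continuous_onI continuous_on_compose2[OF continuous_kern[OF \<rho>, of UNIV]]
            continuous_intros) auto
      show "\<bar>kern (1 / real (Suc m)) (y - d)\<bar> \<le> ln 2" for y using kern_bounds[OF \<rho>, of "y - d"] by simp
    qed
  qed
  then show ?thesis
  proof eventually_elim
    case (elim \<omega>)
    have conv: "(\<lambda>n. LINT z|zeros_measure (root_poly n (\<lambda>j. \<xi> n j \<omega>)). g z) \<longlonglongrightarrow> (LINT z|\<mu>. g z)"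
      if g: "compact_supp g" for g
    proof -
      obtain F where F: "\<And>z. \<bar>g z\<bar> \<le> F" using compact_supp_bounded[OF g] by blast
      have gc: "continuous_on UNIV g" "bounded (range g)"
        using g F by (auto simp: compact_supp_def bounded_iff)
      have "(\<lambda>n. mavg (emp n \<omega>) g - mavg (mid n) g) \<longlonglongrightarrow> 0"
        by (rule emp_converges_on_compact_supp[OF D(2) _ g]) (use elim in auto)
      from tendsto_add[OF this mavg_mid_tendsto[OF gc]]
      have lim: "(\<lambda>n. mavg (emp n \<omega>) g) \<longlonglongrightarrow> (LINT z|\<mu>. g z)" by simp
      show ?thesis
      proof (rule Lim_transform_eventually[OF lim])
        show "\<forall>\<^sub>F n in sequentially. mavg (emp n \<omega>) g = (LINT z|zeros_measure (root_poly n (\<lambda>j. \<xi> n j \<omega>)). g z)"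
          using eventually_gt_at_top[of 0]
        proof eventually_elim
          case (elim n)
          then show ?case
            using integral_zeros_measure[of 0 n g "\<lambda>j. \<xi> n j \<omega>"] measurable_compact_supp[OF g]
            by (simp add: proots_root_poly_\<xi>)
        qed
      qed
    qed
    show ?case
    proof (subst weakly_converges_iff[OF zeros_measure_prob prob_\<mu> sets_\<mu>], intro allI impI tendstoI)
      fix f :: "complex \<Rightarrow> real" and \<epsilon> :: real
      assume f: "continuous_on UNIV f \<and> bounded (range f)" and \<epsilon>: "\<epsilon> > 0"
      obtain g h \<epsilon>' where gh: "compact_supp g" "compact_supp h" "\<epsilon>' > 0"
        "\<And>\<nu>. prob_space \<nu> \<Longrightarrow> sets \<nu> = sets borel \<Longrightarrow>
          \<bar>(LINT x|\<nu>. g x) - (LINT x|\<mu>. g x)\<bar> < \<epsilon>' \<Longrightarrow> \<bar>(LINT x|\<nu>. h x) - (LINT x|\<mu>. h x)\<bar> < \<epsilon>' \<Longrightarrow>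
          \<bar>(LINT x|\<nu>. f x) - (LINT x|\<mu>. f x)\<bar> < \<epsilon>"
        using weak_test_reduction[OF prob_\<mu> sets_\<mu> conjunct1[OF f] conjunct2[OF f] \<epsilon>] by blast
      show "\<forall>\<^sub>F n in sequentially. dist (LINT x|zeros_measure (root_poly n (\<lambda>j. \<xi> n j \<omega>)). f x) (LINT x|\<mu>. f x) < \<epsilon>"
        using tendstoD[OF conv[OF gh(1)] gh(3)] tendstoD[OF conv[OF gh(2)] gh(3)]
        by eventually_elim (use gh(4)[OF zeros_measure_prob] in \<open>auto simp: dist_real_def\<close>)
    qed
  qed
qed

end

subsection \<open>The hypotheses in real-valued form\<close>

lemma mu_distributed_mean:
  fixes g :: "complex \<Rightarrow> real"
  assumes "prob_space \<mu>" "sets \<mu> = sets borel" "mu_distributed \<mu> x"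
    and g: "continuous_on UNIV g" "bounded (range g)"
  shows "(\<lambda>n. (\<Sum>i=1..n. g (x n i)) / real n) \<longlonglongrightarrow> (LINT z|\<mu>. g z)"
proof -
  have lim: "(\<lambda>n. LINT z|uniform_mset_measure (image_mset (x n) (mset_set {1..n})). g z) \<longlonglongrightarrow> (LINT z|\<mu>. g z)"
    using weakly_converges_iff[OF prob_space_uniform_mset_measure sets_uniform_mset_measure assms(1,2),
        THEN iffD1, rule_format, OF assms(3)[unfolded mu_distributed_def]] g by blast
  show ?thesis
  proof (rule Lim_transform_eventually[OF lim])
    show "\<forall>\<^sub>F n in sequentially. (LINT z|uniform_mset_measure (image_mset (x n) (mset_set {1..n})). g z) =
        (\<Sum>i=1..n. g (x n i)) / real n"
      \<comment> \<open>For n = 0 the multiset is empty and its uniform measure has no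
        meaning.\<close>
      using eventually_ge_at_top[of 1]
    proof eventually_elim
      case (elim n)
      then have "image_mset (x n) (mset_set {1..n}) \<noteq> {#}" by (simp add: mset_set_empty_iff)
      then show ?case
        using g by (subst integral_uniform_mset_measure)
          (auto simp: mavg_def sum_mset_sum[unfolded image_mset.compositionality] sum_unfold_sum_mset
            image_mset.compositionality o_def intro: borel_measurable_continuous_onI)
    qed
  qed
qed

lemma log_plus_cmod: "log_plus (ennreal (cmod z)) = ennreal (log_height z)"
proof -
  have "max (ln (cmod z)) 0 = log_height z"
  proof (cases "cmod z \<ge> 1")
    case True
    then have "0 \<le> ln (cmod z)" by simp
    then show ?thesis unfolding log_height_def using True by (simp only: max_absorb1 max_absorb2)
  next
    case False
    then have "ln (cmod z) \<le> 0" by (cases "z = 0") auto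
    then show ?thesis using False by (simp add: log_height_def max_def)
  qed
  then show ?thesis by (simp add: log_plus_def)
qed

lemma log_Cesaro_bounded_real:
  assumes "log_Cesaro_bounded x"
  shows "\<exists>C\<ge>0. \<forall>n\<ge>1. (\<Sum>i=1..n. log_height (x n i)) \<le> C * real n"
proof -
  obtain C where C: "\<And>n. n \<ge> 1 \<Longrightarrow> (\<Sum>i=1..n. log_plus (ennreal (cmod (x n i)))) / of_nat n \<le> ennreal C"
    using assms by (auto simp: log_Cesaro_bounded_def)
  show ?thesis
  \<comment> \<open>\<open>ennreal\<close> sends a negative \<open>C\<close> to 0, hence the
    maximum.\<close>
  proof (intro exI[of _ "max C 0"] conjI allI impI)
    fix n :: nat assume n: "n \<ge> 1"
    define s where "s = (\<Sum>i=1..n. log_height (x n i))"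
    have s: "s \<ge> 0" unfolding s_def by (intro sum_nonneg log_height_nonneg)
    have "ennreal (s / real n) = ennreal s / ennreal (real n)" using n s by (simp add: divide_ennreal)
    also have "\<dots> = (\<Sum>i=1..n. log_plus (ennreal (cmod (x n i)))) / of_nat n"
      by (simp add: s_def log_plus_cmod sum_ennreal log_height_nonneg ennreal_of_nat_eq_real_of_nat)
    also have "\<dots> \<le> ennreal C" by (rule C[OF n])
    also have "\<dots> \<le> ennreal (max C 0)" by (rule ennreal_leI) simp
    finally have "s / real n \<le> max C 0" by (subst (asm) ennreal_le_iff) auto
    then show "s \<le> max C 0 * real n" using n by (simp add: divide_le_eq)
  qed simp
qed

text \<open>Markov's inequality in the extended reals. Finiteness of the sum for large n already
  excludes d = 0.\<close>

lemma log_separation: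
  fixes d :: "nat \<Rightarrow> nat \<Rightarrow> real"
  assumes lim: "(\<lambda>n. (\<Sum>i=1..n. log_plus (1 / ennreal (d n i))) / of_nat (n ^ 2)) \<longlonglongrightarrow> 0"
    and d: "\<And>n i. d n i \<ge> 0"
  shows "\<forall>\<^sub>F n in sequentially. \<forall>i\<in>{1..n}. d n i > 0"
    and "\<epsilon> > 0 \<Longrightarrow> \<theta> > 0 \<Longrightarrow> \<forall>\<^sub>F n in sequentially.
       real (card {i\<in>{1..n}. d n i < exp (- (\<epsilon> * real n))}) \<le> \<theta> * real n"
proof -
  define T where "T n = (\<Sum>i=1..n. log_plus (1 / ennreal (d n i)))" for n
  have T: "\<forall>\<^sub>F n in sequentially. T n \<le> ennreal (\<delta> * (real n)\<^sup>2)" if \<delta>: "\<delta> > 0" for \<delta>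
  proof -
    have "\<forall>\<^sub>F n in sequentially. T n / of_nat (n ^ 2) < ennreal \<delta>"
      using lim \<delta> unfolding T_def by (intro order_tendstoD) auto
    then show ?thesis using eventually_ge_at_top[of 1]
    proof eventually_elim
      case (elim n)
      have n2: "(of_nat (n ^ 2) :: ennreal) = ennreal ((real n)\<^sup>2)"
        by (simp add: ennreal_of_nat_eq_real_of_nat)
      show ?case
      proof (cases "T n")
        case (real t)
        have "ennreal (t / (real n)\<^sup>2) < ennreal \<delta>"
          using elim real unfolding n2 by (simp add: divide_ennreal)
        then have "t / (real n)\<^sup>2 \<le> \<delta>" using \<delta> by (simp add: ennreal_less_iff real)
        then have "t \<le> \<delta> * (real n)\<^sup>2" using elim by (simp add: divide_le_eq)
        then show ?thesis using real by (simp add: ennreal_leI)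
      next
        case top
        then show ?thesis using elim unfolding n2 by (simp add: ennreal_top_divide)
      qed
    qed
  qed
  \<comment> \<open>In \<open>ennreal\<close>, 1/0 is infinite, and so is its
    \<open>log_plus\<close>.\<close>
  have term_top: "log_plus (1 / ennreal (d n i)) = \<top>" if "d n i = 0" for n i
    using that by (simp add: log_plus_def)
  have le_T: "log_plus (1 / ennreal (d n i)) \<le> T n" if "i \<in> {1..n}" for n i
    unfolding T_def by (rule member_le_sum[OF that]) auto
  show "\<forall>\<^sub>F n in sequentially. \<forall>i\<in>{1..n}. d n i > 0"
    using T[OF zero_less_one]
  proof eventually_elim
    case (elim n)
    show ?case
    proof (rule ballI, rule ccontr)
      fix i assume i: "i \<in> {1..n}" "\<not> d n i > 0"
      then have "d n i = 0" using d[of n i] by simp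
      then have "T n = \<top>" using le_T[OF i(1)] term_top by (simp add: top_unique)
      then show False using elim by (simp add: top_unique)
    qed
  qed
  assume \<epsilon>: "\<epsilon> > 0" and \<theta>: "\<theta> > 0"
  \<comment> \<open>Each counted index contributes at least \<epsilon>n, so a total of at most
    \<epsilon>\<theta>n^2 allows \<theta>n of them.\<close>
  then have "\<epsilon> * \<theta> > 0" by simp
  from T[OF this]
  show "\<forall>\<^sub>F n in sequentially. real (card {i\<in>{1..n}. d n i < exp (- (\<epsilon> * real n))}) \<le> \<theta> * real n"
    using eventually_ge_at_top[of 1]
  proof eventually_elim
    case (elim n)
    define X where "X = {i\<in>{1..n}. d n i < exp (- (\<epsilon> * real n))}"
    have "ennreal (real (card X) * (\<epsilon> * real n)) = (\<Sum>i\<in>X. ennreal (\<epsilon> * real n))"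
      using \<epsilon> by (simp add: ennreal_mult ennreal_of_nat_eq_real_of_nat)
    also have "\<dots> \<le> (\<Sum>i\<in>X. log_plus (1 / ennreal (d n i)))"
    proof (rule sum_mono)
      fix i assume i: "i \<in> X"
      show "ennreal (\<epsilon> * real n) \<le> log_plus (1 / ennreal (d n i))"
      proof (cases "d n i = 0")
        case True
        show ?thesis unfolding term_top[OF True] by simp
      next
        case False
        then have p: "d n i > 0" using d[of n i] by simp
        then have e: "1 / ennreal (d n i) = ennreal (1 / d n i)"
          using divide_ennreal[of 1 "d n i"] by simp
        have "ln (d n i) < - (\<epsilon> * real n)"
          using i p by (metis (mono_tags, lifting) X_def exp_gt_zero ln_exp ln_less_cancel_iff mem_Collect_eq)
        then have "\<epsilon> * real n \<le> ln (1 / d n i)" using p by (simp add: ln_div)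
        then show ?thesis unfolding e log_plus_def using p by (simp add: ennreal_leI)
      qed
    qed
    also have "\<dots> \<le> T n" unfolding T_def by (rule sum_mono2) (auto simp: X_def)
    also have "\<dots> \<le> ennreal (\<epsilon> * \<theta> * (real n)\<^sup>2)" by (rule elim(1))
    finally have "real (card X) * (\<epsilon> * real n) \<le> \<epsilon> * \<theta> * (real n)\<^sup>2"
      using \<epsilon> \<theta> by (subst (asm) ennreal_le_iff) auto
    also have "\<dots> = (\<theta> * real n) * (\<epsilon> * real n)" by (simp add: power2_eq_square)
    finally show ?case using \<epsilon> elim(2) by (simp add: X_def)
  qed
qed

theorem theorem1p4:
  fixes \<mu> :: "complex measure"
    and a b :: "nat \<Rightarrow> nat \<Rightarrow> complex"
    and M :: "'w measure"
    and \<xi> :: "nat \<Rightarrow> nat \<Rightarrow> 'w \<Rightarrow> complex"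
    and P :: "nat \<Rightarrow> 'w \<Rightarrow> complex poly"
  assumes "prob_space \<mu>" and "sets \<mu> = sets borel"
    and "mu_distributed \<mu> a" and "mu_distributed \<mu> b"
    and "log_Cesaro_bounded a" and "log_Cesaro_bounded b"
    and "(\<lambda>n. (\<Sum>i=1..n. log_plus (1 / ennreal (cmod (a n i - b n i)))) / of_nat (n ^ 2)) \<longlonglongrightarrow> 0"
    and "prob_space M"
    and "\<And>n. n \<ge> 1 \<Longrightarrow> prob_space.indep_vars M (\<lambda>_. borel) (\<xi> n) {1..n}"
    and "\<And>n j. 1 \<le> j \<Longrightarrow> j \<le> n \<Longrightarrow>
           distr M borel (\<xi> n j) =
           distr (measure_pmf (bernoulli_pmf (1/2))) borel (\<lambda>c. if c then a n j else b n j)"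
    and "\<And>n \<omega>. P n \<omega> = (\<Prod>j=1..n. [:- \<xi> n j \<omega>, 1:])"
  shows "(AE \<omega> in M. weakly_converges (\<lambda>n. zeros_measure (P n \<omega>)) \<mu>) \<and>
         (\<forall>k. converges_in_prob M weak_topology
                (\<lambda>n \<omega>. zeros_measure ((pderiv ^^ k) (P n \<omega>))) \<mu>)"
proof -
  obtain Ca where Ca: "Ca \<ge> 0" "\<And>n. n \<ge> 1 \<Longrightarrow> (\<Sum>i=1..n. log_height (a n i)) \<le> Ca * real n"
    using log_Cesaro_bounded_real[OF assms(5)] by blast
  obtain Cb where Cb: "Cb \<ge> 0" "\<And>n. n \<ge> 1 \<Longrightarrow> (\<Sum>i=1..n. log_height (b n i)) \<le> Cb * real n"
    using log_Cesaro_bounded_real[OF assms(6)] by blast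
  define C where "C = max Ca Cb"
  have bound: "Ca * real n \<le> C * real n" "Cb * real n \<le> C * real n" for n
    by (auto simp: C_def intro!: mult_right_mono)
  note sep = log_separation[OF assms(7) norm_ge_zero]
  interpret prob_space M by fact
  interpret random_choice a b C M \<xi> \<mu>
  proof (intro random_choice.intro array_pair.intro random_choice_axioms.intro)
    show "(\<Sum>i=1..n. log_height (a n i)) \<le> C * real n" if "n \<ge> 1" for n
      using Ca(2)[OF that] bound(1) by (rule order.trans)
    show "(\<Sum>i=1..n. log_height (b n i)) \<le> C * real n" if "n \<ge> 1" for n
      using Cb(2)[OF that] bound(2) by (rule order.trans)
    show "\<forall>\<^sub>F n in sequentially. \<forall>i\<in>{1..n}. a n i \<noteq> b n i"
      using sep(1) by simp
  qed (fact assms(1,2,8,9,10) sep(2) mu_distributed_mean[OF assms(1,2,3)] mu_distributed_mean[OF assms(1,2,4)])+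
  have P: "P n \<omega> = root_poly n (\<lambda>j. \<xi> n j \<omega>)" for n \<omega>
    by (simp add: assms(11) root_poly_def)
  show ?thesis
    unfolding P using zeros_converge_AE higher_pderiv_converges_in_prob by blast
qed

end
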